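(* Consider the single index volatility model $y=f(\langle x,\beta^\star\rangle)+g(\langle x,\gamma^\star\rangle)\epsilon$. Suppose the functions $x\mapsto f^2(\langle x,\beta^\star\rangle)$ and $x\mapsto g^2(\langle x,\gamma^\star\rangle)$ together with $x$ satisfy the second-order regularity condition, $\|\beta^\star\|_0\vee\|\gamma^\star\|_0\le s$, $\langle\beta^\star,\gamma^\star\rangle=0$, and $\mu_2=\mathbb{E}[(g'(x^T\gamma^\star))^2]+\mathbb{E}[g(x^T\gamma^\star)g''(x^T\gamma^\star)]\ne0$. Suppose the finite $p$-th moment assumption holds with $p\ge6$, and that $\hat\beta$ is an estimator of $\beta^\star$ which for any $0<\delta<1$ satisfies, with probability at least $1-\delta$, $$\|\hat\beta-\beta^\star\|_2\lesssim\sqrt{\tfrac{s\log(d/\delta)}{n}},\quad\|\hat\beta-\beta^\star\|_1\lesssim s\sqrt{\tfrac{\log(d/\delta)}{n}},\quad\|\hat\beta-\beta^\star\|_\infty\lesssim\sqrt{\tfrac{\log(d/\delta)}{n}} .$$ Let $\eta_2=\mathbb{E}[(f'(x^T\beta^\star))^2]+\mathbb{E}[f(x^T\beta^\star)f''(x^T\beta^\star)]$, $$\tilde U=\frac1n\sum_{i=1}^n\Psi_\tau(y_i)^2\,\Psi_\tau(H(x_i)),\qquad\bar U=\tilde U-(\hat\beta^T\tilde U\hat\beta)\,\hat\beta\hat\beta^T,$$ let $\bar V=\mathcal{T}_\lambda(\bar U,1)$, and let $\hat\gamma_6\in\arg\max_{\|\gamma\|_2\le1}|\gamma^T\bar V\gamma|$.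 Then for any $0<\delta<1$ there exists a constant $C'_{(\eta_2,\mu_2,\|\beta^\star\|_1,\|\gamma^\star\|_1)}$ such that $\hat\gamma_6$ with $\tau=\big(\frac{nM_6}{\log(2d^2/\delta)}\big)^{1/6}$ and $\lambda\ge C'_{(\eta_2,\mu_2,\|\beta^\star\|_1,\|\gamma^\star\|_1)}\sqrt{\frac{M_6\log(2d^2/\delta)}{n}}$ satisfies $$P\Big(\min_{\iota=\pm1}\|\iota\hat\gamma_6-\gamma^\star\|_2\le\frac{4\sqrt2\,s\lambda}{|\mu_2|}\Big)\ge1-\delta .$$
   Context: Model: $x\in\mathbb{R}^d$ is random with density $p_x$; $\epsilon$ is independent of $x$, $\mathbb{E}\epsilon=0$, $\mathbb{E}\epsilon^2=1$; $f,g:\mathbb{R}\to\mathbb{R}$ are unknown; $\beta^\star,\gamma^\star\in\mathbb{R}^d$ are unit vectors; $\|v\|_0$ is the number of nonzero entries. $\{(y_i,x_i)\}_{i=1}^n$ are i.i.d. samples from the model, independent of the sample (of size $n$) used to compute $\hat\beta$. Second-order regularity condition: $x$ has a (twice) differentiable density $p_x$ with support $\mathcal{X}\subseteq\mathbb{R}^d$, strictly positive in the interior of $\mathcal{X}$, with $|p_x(u)|\to0$ as $u$ goes to the boundary; the first- and second-order scores are $S(u)=-\nabla\log p_x(u)\in\mathbb{R}^d$ and $H(u)=\nabla^2p_x(u)/p_x(u)\in\mathbb{R}^{d\times d}$. A twice differentiable $\phi:\mathcal{X}\to\mathbb{R}$ together with $x$ satisfies the condition if $\mathbb{E}|\phi(x)H(x)|$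 and $\mathbb{E}|\nabla^2\phi(x)|$ exist. Finite $p$-th moment assumption: $\mathbb{E}|\epsilon|^p<\infty$ (regarded as a constant) and there is a constant $M_p>0$ with $\mathbb{E}|x^Tv|^p\vee\mathbb{E}|f(x^T\beta^\star)|^p\vee\mathbb{E}|g(x^T\gamma^\star)|^p\vee\mathbb{E}|S(x)_j|^p\vee\mathbb{E}|H(x)_{jk}|^p\le M_p$ for all $j,k\in[d]$ and all unit $v\in\mathbb{R}^d$; furthermore $\mathbb{E}|y|^p\lesssim M_p$. $\Psi_\tau(v)=v\,\mathbf{1}\{|v|\le\tau\}$, applied elementwise. For a symmetric matrix $A\in\mathbb{R}^{d\times d}$, tuning parameter $\lambda$ and integer $r$, $\mathcal{T}_\lambda(A,r)$ is the optimal solution of: maximize $\langle V,A\rangle-\lambda\|V\|_{1,1}$ over symmetric $V$ with $0\preceq V\preceq I_d$ and $\mathrm{Trace}(V)=r$, where $\|V\|_{1,1}=\sum_{i,j}|V_{ij}|$. $a\lesssim b$ means $a\le cb$ for a constant $c$. The subscript of $C'$ lists the model quantities on which it depends.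
   Formalization: V̄ is taken as T_λ(sgn(μ₂)Ū,1) instead of T_λ(Ū,1); the two agree for μ₂>0, while for μ₂<0 the claim as written is false (e.g. Gaussian x, f=0, g(t)=√(1+exp(−t²/2)), ε=±1), since maximizing ⟨V,Ū⟩ then gives a direction nearly orthogonal to γ*. *)

theory Defs
  imports "HOL-Probability.Probability"
begin

(* The dimension d has to be quantified inside the theorem, because the constant C' must not
   depend on it. Hence R^d is not a type: vectors are functions nat => real and matrices are
   functions nat => nat => real, of which only the entries with indices below d matter.
   As a measurable space and as a topological space R^d consists of the extensional functions
   on {..<d}. *)

type_synonym rvec = "nat \<Rightarrow> real"
type_synonym rmat = "nat \<Rightarrow> nat \<Rightarrow> real"

definition Rd :: "nat \<Rightarrow> rvec measure" where
  "Rd d = Pi\<^sub>M {..<d} (\<lambda>_. lborel)"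

definition Rd_top :: "nat \<Rightarrow> rvec topology" where
  "Rd_top d = powertop_real {..<d}"

definition dotp :: "nat \<Rightarrow> rvec \<Rightarrow> rvec \<Rightarrow> real" where
  "dotp d u v = (\<Sum>j<d. u j * v j)"

definition norm0 :: "nat \<Rightarrow> rvec \<Rightarrow> nat" where
  "norm0 d v = card {j. j < d \<and> v j \<noteq> 0}"

definition norm1 :: "nat \<Rightarrow> rvec \<Rightarrow> real" where
  "norm1 d v = (\<Sum>j<d. \<bar>v j\<bar>)"

definition norm2 :: "nat \<Rightarrow> rvec \<Rightarrow> real" where
  "norm2 d v = L2_set v {..<d}"

definition norm_inf :: "nat \<Rightarrow> rvec \<Rightarrow> real" where
  "norm_inf d v = Max ((\<lambda>j. \<bar>v j\<bar>) ` {..<d})"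

definition quad_form :: "nat \<Rightarrow> rmat \<Rightarrow> rvec \<Rightarrow> real" where
  "quad_form d A v = (\<Sum>j<d. \<Sum>k<d. v j * A j k * v k)"


definition partial :: "nat \<Rightarrow> (rvec \<Rightarrow> real) \<Rightarrow> rvec \<Rightarrow> real" where
  "partial j F u = deriv (\<lambda>t. F (u(j := t))) (u j)"

definition hessian :: "(rvec \<Rightarrow> real) \<Rightarrow> rvec \<Rightarrow> rmat" where
  "hessian F u j k = partial j (partial k F) u"

(* Frechet differentiability in R^d; the derivative, if it exists, is given by the partial
   derivatives. *)
definition frechet_diff_at :: "nat \<Rightarrow> (rvec \<Rightarrow> real) \<Rightarrow> rvec \<Rightarrow> bool" where
  "frechet_diff_at d F u \<longleftrightarrow>
     limitin euclideanreal
       (\<lambda>v. (F v - F u - (\<Sum>j<d. partial j F u * (v j - u j))) / norm2 d (\<lambda>j. v j - u j))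
       0 (atin (Rd_top d) u)"

definition twice_diff_on :: "nat \<Rightarrow> (rvec \<Rightarrow> real) \<Rightarrow> rvec set \<Rightarrow> bool" where
  "twice_diff_on d F U \<longleftrightarrow>
     (\<forall>u\<in>U. frechet_diff_at d F u \<and> (\<forall>j<d. frechet_diff_at d (partial j F) u))"

definition twice_diff_on_real :: "(real \<Rightarrow> real) \<Rightarrow> real set \<Rightarrow> bool" where
  "twice_diff_on_real h U \<longleftrightarrow> (\<forall>t\<in>U. h differentiable (at t) \<and> deriv h differentiable (at t))"


definition support :: "nat \<Rightarrow> (rvec \<Rightarrow> real) \<Rightarrow> rvec set" where
  "support d px = Rd_top d closure_of {u \<in> topspace (Rd_top d). px u \<noteq> 0}"

definition support_interior :: "nat \<Rightarrow> (rvec \<Rightarrow> real) \<Rightarrow> rvec set" where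
  "support_interior d px = Rd_top d interior_of (support d px)"

definition regular_density :: "'a measure \<Rightarrow> nat \<Rightarrow> ('a \<Rightarrow> rvec) \<Rightarrow> (rvec \<Rightarrow> real) \<Rightarrow> bool" where
  "regular_density M d x px \<longleftrightarrow>
     distributed M (Rd d) x (\<lambda>u. ennreal (px u)) \<and>
     (\<forall>u\<in>space (Rd d). 0 \<le> px u) \<and>
     (\<forall>u\<in>support_interior d px. 0 < px u) \<and>
     twice_diff_on d px (support_interior d px) \<and>
     (\<forall>b\<in>Rd_top d frontier_of (support d px).
        limitin euclideanreal px 0 (atin_within (Rd_top d) b (support d px)))"

(* The two score functions are meaningful in the interior of the support, which has
   probability one. *)
definition score1 :: "(rvec \<Rightarrow> real) \<Rightarrow> rvec \<Rightarrow> rvec" where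
  "score1 px u j = - partial j (\<lambda>w. ln (px w)) u"

definition score2 :: "(rvec \<Rightarrow> real) \<Rightarrow> rvec \<Rightarrow> rmat" where
  "score2 px u j k = hessian px u j k / px u"

definition second_order_regular ::
    "'a measure \<Rightarrow> nat \<Rightarrow> ('a \<Rightarrow> rvec) \<Rightarrow> (rvec \<Rightarrow> real) \<Rightarrow> (rvec \<Rightarrow> real) \<Rightarrow> bool" where
  "second_order_regular M d x px \<phi> \<longleftrightarrow>
     regular_density M d x px \<and>
     twice_diff_on d \<phi> (support_interior d px) \<and>
     (\<forall>j<d. \<forall>k<d. integrable M (\<lambda>\<omega>. \<phi> (x \<omega>) * score2 px (x \<omega>) j k)) \<and>
     (\<forall>j<d. \<forall>k<d. integrable M (\<lambda>\<omega>. hessian \<phi> (x \<omega>) j k))"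


(* The library's indep_var requires both variables to take values in the same type. *)
definition indep_rv ::
    "'a measure \<Rightarrow> 'b measure \<Rightarrow> ('a \<Rightarrow> 'b) \<Rightarrow> 'c measure \<Rightarrow> ('a \<Rightarrow> 'c) \<Rightarrow> bool" where
  "indep_rv M N X L Y \<longleftrightarrow>
     X \<in> measurable M N \<and> Y \<in> measurable M L \<and>
     prob_space.indep_set M {X -` A \<inter> space M | A. A \<in> sets N} {Y -` B \<inter> space M | B. B \<in> sets L}"

definition response ::
    "nat \<Rightarrow> (real \<Rightarrow> real) \<Rightarrow> (real \<Rightarrow> real) \<Rightarrow> rvec \<Rightarrow> rvec \<Rightarrow> ('a \<Rightarrow> rvec) \<Rightarrow> ('a \<Rightarrow> real)
      \<Rightarrow> 'a \<Rightarrow> real" where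
  "response d f g \<beta> \<gamma> x \<epsilon> \<omega> = f (dotp d (x \<omega>) \<beta>) + g (dotp d (x \<omega>) \<gamma>) * \<epsilon> \<omega>"

(* The derivatives of the link functions are only needed at the points that the index of x
   takes for x in the interior of the support. *)
locale index_volatility_model = prob_space M
  for M :: "'a measure" +
  fixes d :: nat and x :: "'a \<Rightarrow> rvec" and px :: "rvec \<Rightarrow> real" and \<epsilon> :: "'a \<Rightarrow> real"
    and f g :: "real \<Rightarrow> real" and \<beta> \<gamma> :: rvec
  assumes density: "distributed M (Rd d) x (\<lambda>u. ennreal (px u))"
    and indep: "indep_rv M borel \<epsilon> (Rd d) x"
    and eps_mean: "integrable M \<epsilon>" "expectation \<epsilon> = 0"
    and eps_var: "integrable M (\<lambda>\<omega>. (\<epsilon> \<omega>)\<^sup>2)" "expectation (\<lambda>\<omega>. (\<epsilon> \<omega>)\<^sup>2) = 1"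
    and links_measurable: "f \<in> borel_measurable borel" "g \<in> borel_measurable borel"
    and links_diff:
      "twice_diff_on_real f ((\<lambda>u. dotp d u \<beta>) ` support_interior d px)"
      "twice_diff_on_real g ((\<lambda>u. dotp d u \<gamma>) ` support_interior d px)"
    and unit_vectors: "norm2 d \<beta> = 1" "norm2 d \<gamma> = 1"

definition moment_le :: "'a measure \<Rightarrow> ('a \<Rightarrow> real) \<Rightarrow> real \<Rightarrow> real \<Rightarrow> bool" where
  "moment_le M Z p B \<longleftrightarrow>
     integrable M (\<lambda>\<omega>. \<bar>Z \<omega>\<bar> powr p) \<and> (\<integral>\<omega>. \<bar>Z \<omega>\<bar> powr p \<partial>M) \<le> B"

(* Ke bounds the moment of the noise and Ky is the constant hidden in E|y|^p <~ Mp; Mp itself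
   is not an absolute constant. *)
definition finite_moments ::
    "'a measure \<Rightarrow> nat \<Rightarrow> ('a \<Rightarrow> rvec) \<Rightarrow> (rvec \<Rightarrow> real) \<Rightarrow> ('a \<Rightarrow> real)
      \<Rightarrow> (real \<Rightarrow> real) \<Rightarrow> (real \<Rightarrow> real) \<Rightarrow> rvec \<Rightarrow> rvec
      \<Rightarrow> real \<Rightarrow> real \<Rightarrow> real \<Rightarrow> real \<Rightarrow> bool" where
  "finite_moments M d x px \<epsilon> f g \<beta> \<gamma> Ke Ky p Mp \<longleftrightarrow>
     0 < Mp \<and>
     moment_le M \<epsilon> p Ke \<and>
     (\<forall>v. norm2 d v = 1 \<longrightarrow> moment_le M (\<lambda>\<omega>. dotp d (x \<omega>) v) p Mp) \<and>
     moment_le M (\<lambda>\<omega>. f (dotp d (x \<omega>) \<beta>)) p Mp \<and>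
     moment_le M (\<lambda>\<omega>. g (dotp d (x \<omega>) \<gamma>)) p Mp \<and>
     (\<forall>j<d. moment_le M (\<lambda>\<omega>. score1 px (x \<omega>) j) p Mp) \<and>
     (\<forall>j<d. \<forall>k<d. moment_le M (\<lambda>\<omega>. score2 px (x \<omega>) j k) p Mp) \<and>
     moment_le M (response d f g \<beta> \<gamma> x \<epsilon>) p (Ky * Mp)"

(* With h = f and v = beta this is eta_2, with h = g and v = gamma it is mu_2. *)
definition curvature :: "'a measure \<Rightarrow> nat \<Rightarrow> ('a \<Rightarrow> rvec) \<Rightarrow> (real \<Rightarrow> real) \<Rightarrow> rvec \<Rightarrow> real" where
  "curvature M d x h v =
     (\<integral>\<omega>. (deriv h (dotp d (x \<omega>) v))\<^sup>2 \<partial>M)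
     + (\<integral>\<omega>. h (dotp d (x \<omega>) v) * deriv (deriv h) (dotp d (x \<omega>) v) \<partial>M)"

definition curvature_exists ::
    "'a measure \<Rightarrow> nat \<Rightarrow> ('a \<Rightarrow> rvec) \<Rightarrow> (real \<Rightarrow> real) \<Rightarrow> rvec \<Rightarrow> bool" where
  "curvature_exists M d x h v \<longleftrightarrow>
     integrable M (\<lambda>\<omega>. (deriv h (dotp d (x \<omega>) v))\<^sup>2) \<and>
     integrable M (\<lambda>\<omega>. h (dotp d (x \<omega>) v) * deriv (deriv h) (dotp d (x \<omega>) v))"


definition iid_samples ::
    "'a measure \<Rightarrow> nat \<Rightarrow> nat \<Rightarrow> ('a \<Rightarrow> real) \<Rightarrow> ('a \<Rightarrow> rvec)
      \<Rightarrow> (nat \<Rightarrow> 'a \<Rightarrow> real) \<Rightarrow> (nat \<Rightarrow> 'a \<Rightarrow> rvec) \<Rightarrow> bool" where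
  "iid_samples M d n y x ys xs \<longleftrightarrow>
     prob_space.indep_vars M (\<lambda>_. borel \<Otimes>\<^sub>M Rd d) (\<lambda>i \<omega>. (ys i \<omega>, xs i \<omega>)) {..<n} \<and>
     (\<forall>i<n. distr M (borel \<Otimes>\<^sub>M Rd d) (\<lambda>\<omega>. (ys i \<omega>, xs i \<omega>))
            = distr M (borel \<Otimes>\<^sub>M Rd d) (\<lambda>\<omega>. (y \<omega>, x \<omega>)))"

definition indep_of_samples ::
    "'a measure \<Rightarrow> nat \<Rightarrow> nat \<Rightarrow> (nat \<Rightarrow> 'a \<Rightarrow> real) \<Rightarrow> (nat \<Rightarrow> 'a \<Rightarrow> rvec)
      \<Rightarrow> ('a \<Rightarrow> rvec) \<Rightarrow> bool" where
  "indep_of_samples M d n ys xs \<beta>h \<longleftrightarrow>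
     indep_rv M (Rd d) \<beta>h
       (Pi\<^sub>M {..<n} (\<lambda>_. borel \<Otimes>\<^sub>M Rd d)) (\<lambda>\<omega>. \<lambda>i\<in>{..<n}. (ys i \<omega>, xs i \<omega>))"

(* c is the constant hidden in the three rates. *)
definition estimator_rate ::
    "'a measure \<Rightarrow> nat \<Rightarrow> nat \<Rightarrow> nat \<Rightarrow> real \<Rightarrow> rvec \<Rightarrow> ('a \<Rightarrow> rvec) \<Rightarrow> bool" where
  "estimator_rate M d n s c \<beta> \<beta>h \<longleftrightarrow>
     (\<forall>\<delta>. 0 < \<delta> \<and> \<delta> < 1 \<longrightarrow>
       measure M {\<omega> \<in> space M.
           norm2 d (\<lambda>j. \<beta>h \<omega> j - \<beta> j) \<le> c * sqrt (real s * ln (real d / \<delta>) / real n) \<and>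
           norm1 d (\<lambda>j. \<beta>h \<omega> j - \<beta> j) \<le> c * (real s * sqrt (ln (real d / \<delta>) / real n)) \<and>
           norm_inf d (\<lambda>j. \<beta>h \<omega> j - \<beta> j) \<le> c * sqrt (ln (real d / \<delta>) / real n)}
         \<ge> 1 - \<delta>)"


definition trunc :: "real \<Rightarrow> real \<Rightarrow> real" where
  "trunc \<tau> v = (if \<bar>v\<bar> \<le> \<tau> then v else 0)"

definition U_tilde ::
    "nat \<Rightarrow> real \<Rightarrow> (rvec \<Rightarrow> real) \<Rightarrow> (nat \<Rightarrow> 'a \<Rightarrow> real) \<Rightarrow> (nat \<Rightarrow> 'a \<Rightarrow> rvec) \<Rightarrow> 'a \<Rightarrow> rmat" where
  "U_tilde n \<tau> px ys xs \<omega> j k =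
     (1 / real n) * (\<Sum>i<n. (trunc \<tau> (ys i \<omega>))\<^sup>2 * trunc \<tau> (score2 px (xs i \<omega>) j k))"

definition deflate :: "nat \<Rightarrow> rmat \<Rightarrow> rvec \<Rightarrow> rmat" where
  "deflate d U b j k = U j k - quad_form d U b * (b j * b k)"

definition fantope :: "nat \<Rightarrow> nat \<Rightarrow> rmat \<Rightarrow> bool" where
  "fantope d r V \<longleftrightarrow>
     (\<forall>j<d. \<forall>k<d. V j k = V k j) \<and>
     (\<forall>v. 0 \<le> quad_form d V v) \<and>
     (\<forall>v. quad_form d V v \<le> dotp d v v) \<and>
     (\<Sum>j<d. V j j) = real r"

(* V is an optimal solution T_lambda(A, r); the optimum need not be unique. The program
   selects the algebraically largest eigendirections of A: for A close to
   2 mu_2 (gamma gamma^T) with mu_2 < 0 its solution is close to orthogonal to gamma. It is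
   therefore applied to sgn(mu_2) times the deflated matrix, which is the deflated matrix
   itself when mu_2 > 0. *)
definition is_T :: "nat \<Rightarrow> real \<Rightarrow> rmat \<Rightarrow> nat \<Rightarrow> rmat \<Rightarrow> bool" where
  "is_T d l A r V \<longleftrightarrow>
     is_arg_max
       (\<lambda>W. (\<Sum>j<d. \<Sum>k<d. W j k * A j k) - l * (\<Sum>j<d. \<Sum>k<d. \<bar>W j k\<bar>))
       (fantope d r) V"

definition is_leading_direction :: "nat \<Rightarrow> rmat \<Rightarrow> rvec \<Rightarrow> bool" where
  "is_leading_direction d V v \<longleftrightarrow>
     is_arg_max (\<lambda>w. \<bar>quad_form d V w\<bar>) (\<lambda>w. norm2 d w \<le> 1) v"

end

theory Submission
  imports Defs
begin

text \<open>
  Independence of \<open>\<epsilon>\<close> and \<open>x\<close> together with the second-order Stein identity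
  \<open>E[\<phi>(x) H(x)] = E[\<nabla>\<^sup>2\<phi>(x)]\<close> gives
  \<open>E[y\<^sup>2 H(x)] = 2 \<eta>\<^sub>2 \<beta>\<beta>\<^sup>T + 2 \<mu>\<^sub>2 \<gamma>\<gamma>\<^sup>T\<close>. With the prescribed \<open>\<tau>\<close> both the bias and the
  exponential-moment deviation of every truncated entry are of order
  \<open>\<rho> = sqrt (M6 ln (2 d\<^sup>2 / \<delta>) / n)\<close>. Deflation by \<open>\<beta>h\<close> removes the first term up to an entrywise
  error of the same order, provided that \<open>s \<rho>\<close> is small compared with \<open>\<mu>\<^sub>2\<close>; otherwise the
  claimed bound exceeds \<open>sqrt 2\<close> and holds trivially. The basic inequality for the penalised program bounds the
  Frobenius error of its solution, and a variational argument passes to the leading direction.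

  No boundary condition on the derivatives of the density is assumed in Stein's identity. It
  follows from \<open>p\<^sub>x \<rightarrow> 0\<close> and the finite moments of the scores: for an integrand \<open>F\<close> with
  \<open>F\<close>, \<open>\<partial>F\<close> and \<open>F \<partial>p\<^sub>x / p\<^sub>x\<close> integrable, one integrates the derivative of
  \<open>F (1 - e / p\<^sub>x)\<^sub>+\<^sup>2\<close>, which vanishes near the boundary, and lets \<open>e \<rightarrow> 0\<close>.
\<close>

subsection \<open>Partial derivatives along coordinate lines\<close>

text \<open>Neither s nor M6 may enter the constant. The l1 error of \<open>\<beta>h\<close>, of
  order s * sqrt (L / n), acts only through the quadratic form of the noise matrix, which already
  carries a factor \<open>\<rho>\<close>; so it only has to stay bounded, and in the nontrivial
  regime it does. The rates of \<open>\<beta>h\<close> lack the factor sqrt M6 that the threshold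
  for \<open>\<lambda>\<close> has. Stein's identity bounds |mu2| by a multiple of sqrt M6, and the
  missing factor is paid for by \<open>R = 3 * G\<^sup>2 / (2 * \<bar>\<mu>\<bar>)\<close>, which
  involves only mu2 and the l1 norm of \<open>\<gamma>\<close>. Orthogonality makes the contribution
  of mu2 to the deflation error quadratic in the error of \<open>\<beta>h\<close>. On the analytic
  side nothing is known about derivatives of the density off the interior of its support: there
  \<open>score2\<close> may fail to be measurable, and the boundary may have positive volume. The
  argument therefore runs with functions set to zero off the interior, together with a proof that
  \<open>x\<close> lies in the interior almost surely. The samples inherit this through their law,
  so the statistic built from \<open>score2\<close> agrees almost surely with a measurable
  one.\<close>

lemma integral_derivative_real_line:
  fixes G G' :: "real \<Rightarrow> real"
  assumes deriv: "\<And>t. (G has_real_derivative G' t) (at t)"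
    and iG: "integrable lborel G" and iG': "integrable lborel G'"
  shows "(\<integral>t. G' t \<partial>lborel) = 0"
proof (rule ccontr)
  define I where "I = (\<integral>t. G' t \<partial>lborel)"
  define K where "K t = G t - G (- t)" for t
  assume "(\<integral>t. G' t \<partial>lborel) \<noteq> 0"
  then have I: "I \<noteq> 0" by (simp add: I_def)
  \<comment> \<open>Integrability of \<open>G\<close> takes the place of decay at infinity:
    \<open>K t\<close> is a truncated integral of \<open>G'\<close> and converges to
    \<open>I\<close>, but \<open>K\<close> is integrable on the line, so its limit cannot be
    nonzero.\<close>
  have K_eq: "K t = (\<integral>x. indicator {-t..t} x *\<^sub>R G' x \<partial>lborel)" if "0 \<le> t" for t
  proof -
    have "set_integrable lborel {-t..t} G'"
      unfolding set_integrable_def by (intro integrable_mult_indicator iG') simp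
    then have "(LINT x:{-t..t}|lborel. G' x) = integral {-t..t} G'"
      by (rule set_borel_integral_eq_integral)
    also have "(G' has_integral (G t - G (-t))) {-t..t}"
      using that deriv
      by (intro fundamental_theorem_of_calculus)
         (auto simp: has_real_derivative_iff_has_vector_derivative[symmetric]
               intro: has_field_derivative_at_within)
    then have "integral {-t..t} G' = K t"
      by (simp add: K_def integral_unique)
    finally show ?thesis
      by (simp add: set_lebesgue_integral_def)
  qed
  have "((\<lambda>t. \<integral>x. indicator {-t..t} x *\<^sub>R G' x \<partial>lborel) \<longlongrightarrow> I) at_top"
    unfolding I_def
  proof (rule integral_dominated_convergence_at_top[where w = "\<lambda>x. norm (G' x)"])
    show "AE x in lborel. ((\<lambda>t. indicator {-t..t} x *\<^sub>R G' x) \<longlongrightarrow> G' x) at_top"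
    proof (intro AE_I2 tendsto_eventually)
      fix x :: real
      show "\<forall>\<^sub>F t in at_top. indicator {-t..t} x *\<^sub>R G' x = G' x"
        using eventually_ge_at_top[of "\<bar>x\<bar>"]
        by eventually_elim (auto simp: indicator_def)
    qed
  qed (use iG' in \<open>auto simp: indicator_def\<close>)
  then have "(K \<longlongrightarrow> I) at_top"
    by (rule Lim_transform_eventually)
       (use eventually_ge_at_top[of 0] in eventually_elim, simp add: K_eq)
  then have "\<forall>\<^sub>F t in at_top. dist (K t) I < \<bar>I\<bar> / 2"
    using I by (intro tendstoD) auto
  then obtain T where T: "\<And>t. T \<le> t \<Longrightarrow> dist (K t) I < \<bar>I\<bar> / 2"
    by (auto simp: eventually_at_top_linorder)
  have "integrable lborel (\<lambda>t. G (0 + (-1) * t))"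
    using iG by (rule lborel_integrable_real_affine) simp
  then have "integrable lborel K"
    unfolding K_def using iG by auto
  then have "integrable lborel (\<lambda>t. indicator {T..} t * (\<bar>I\<bar> / 2))"
  proof (rule Bochner_Integration.integrable_bound)
    have "\<bar>I\<bar> / 2 \<le> \<bar>K t\<bar>" if "T \<le> t" for t
      using T[OF that] unfolding dist_real_def by linarith
    then show "AE t in lborel. norm (indicator {T..} t * (\<bar>I\<bar> / 2)) \<le> norm (K t)"
      by (intro AE_I2) (auto simp: indicator_def)
  qed simp
  then have "integrable lborel (\<lambda>t. indicator {T..} t * (\<bar>I\<bar> / 2) * (2 / \<bar>I\<bar>))"
    by (rule integrable_mult_left)
  then have "integrable lborel (indicator {T..} :: real \<Rightarrow> real)"
    using I by simp
  then have "emeasure lborel {T..} < \<infinity>"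
    by (simp add: integrable_indicator_iff)
  moreover have "emeasure lborel {T..} \<ge> of_nat n" for n
  proof -
    have "emeasure lborel {T..T + real n} \<le> emeasure lborel {T..}"
      by (intro emeasure_mono) auto
    then show ?thesis by (simp add: ennreal_of_nat_eq_real_of_nat)
  qed
  ultimately show False
    by (metis ennreal_Ex_less_of_nat infinity_ennreal_def leD)
qed

text \<open>Each point gets an interval with rational end points that contains no other point of
  \<open>A\<close>, which injects \<open>A\<close> into a countable set. It serves to show that
  exceptional sets meet every coordinate line in a null set.\<close>

lemma countable_isolated_points:
  fixes A :: "real set"
  assumes "\<And>t. t \<in> A \<Longrightarrow> \<forall>\<^sub>F s in at t. s \<notin> A"
  shows "countable A"
proof -
  have "\<exists>a b. a \<in> \<rat> \<and> b \<in> \<rat> \<and> a < t \<and> t < b \<and> A \<inter> {a<..<b} = {t}" if t: "t \<in> A" for t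
  proof -
    from assms[OF t] obtain e where e: "e > 0" "\<And>s. s \<noteq> t \<Longrightarrow> dist s t < e \<Longrightarrow> s \<notin> A"
      by (auto simp: eventually_at)
    obtain a where a: "a \<in> \<rat>" "t - e < a" "a < t"
      using Rats_dense_in_real[of "t - e" t] e by auto
    obtain b where b: "b \<in> \<rat>" "t < b" "b < t + e"
      using Rats_dense_in_real[of t "t + e"] e by auto
    have "A \<inter> {a<..<b} = {t}"
      using a b t e(2) by (force simp: dist_real_def)
    then show ?thesis using a b by blast
  qed
  then obtain a b where ab: "\<And>t. t \<in> A \<Longrightarrow> a t \<in> \<rat> \<and> b t \<in> \<rat> \<and> A \<inter> {a t<..<b t} = {t}"
    by metis
  have "inj_on (\<lambda>t. (a t, b t)) A"
    by (rule inj_onI) (metis ab prod.inject singleton_inject)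
  moreover have "countable ((\<lambda>t. (a t, b t)) ` A)"
    by (rule countable_subset[of _ "\<rat> \<times> \<rat>"]) (use ab countable_rat in auto)
  ultimately show ?thesis
    by (rule countable_image_inj_on[rotated])
qed

section \<open>Topology and Lebesgue measure of R^d along coordinate lines\<close>

lemma space_Rd: "space (Rd d) = extensional {..<d}"
  by (simp add: Rd_def space_PiM PiE_UNIV_domain PiE_def)

lemma topspace_Rd_top: "topspace (Rd_top d) = extensional {..<d}"
  by (simp add: Rd_top_def PiE_def)

lemma upd_in_space_Rd: "u \<in> space (Rd d) \<Longrightarrow> j < d \<Longrightarrow> u(j := t) \<in> space (Rd d)"
  by (auto simp: space_Rd extensional_def)

text \<open>An open set is the union of the boxes inside it whose sides come from a countable basis
  of the reals, and there are only countably many such boxes because the number of coordinates is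
  finite.\<close>

lemma sets_Rd_openin:
  assumes "openin (Rd_top d) W"
  shows "W \<in> sets (Rd d)"
proof -
  obtain B :: "real set set" where B: "countable B" "topological_basis B"
    using ex_countable_basis by blast
  define C where "C = {Pi\<^sub>E {..<d} V | V. V \<in> {..<d} \<rightarrow>\<^sub>E B \<and> Pi\<^sub>E {..<d} V \<subseteq> W}"
  have "C \<subseteq> Pi\<^sub>E {..<d} ` ({..<d} \<rightarrow>\<^sub>E B)"
    by (auto simp: C_def)
  then have "countable C"
    by (rule countable_subset) (intro countable_image countable_PiE finite_lessThan B(1))
  have "W = \<Union>C"
  proof
    show "\<Union>C \<subseteq> W" by (auto simp: C_def)
    show "W \<subseteq> \<Union>C"
    proof
      fix w assume w: "w \<in> W"
      obtain X where X: "w \<in> Pi\<^sub>E {..<d} X" "\<And>i. open (X i)" "Pi\<^sub>E {..<d} X \<subseteq> W"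
        using product_topology_open_contains_basis[OF assms[unfolded Rd_top_def] w] by auto
      have "\<exists>V\<in>B. w i \<in> V \<and> V \<subseteq> X i" if "i < d" for i
      proof -
        have "w i \<in> X i" using X(1) that by (auto simp: PiE_iff)
        from topological_basisE[OF B(2) X(2) this] show ?thesis by metis
      qed
      then obtain V where V: "\<And>i. i < d \<Longrightarrow> V i \<in> B \<and> w i \<in> V i \<and> V i \<subseteq> X i"
        by metis
      let ?V = "restrict V {..<d}"
      have "Pi\<^sub>E {..<d} ?V \<subseteq> Pi\<^sub>E {..<d} X"
        using V by (intro PiE_mono) auto
      then have "Pi\<^sub>E {..<d} ?V \<subseteq> W"
        using X(3) by (rule subset_trans)
      moreover have "?V \<in> {..<d} \<rightarrow>\<^sub>E B"
        using V by auto
      ultimately have "Pi\<^sub>E {..<d} ?V \<in> C"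
        unfolding C_def by blast
      moreover have "w \<in> Pi\<^sub>E {..<d} ?V"
        using V X(1) by (auto simp: PiE_iff)
      ultimately show "w \<in> \<Union>C" by blast
    qed
  qed
  moreover have "\<Union>C \<in> sets (Rd d)"
  proof (rule sets.countable_Union[OF \<open>countable C\<close>])
    show "C \<subseteq> sets (Rd d)"
    proof
      fix P assume "P \<in> C"
      then obtain V where V: "P = Pi\<^sub>E {..<d} V" "V \<in> {..<d} \<rightarrow>\<^sub>E B"
        by (auto simp: C_def)
      have "V i \<in> sets lborel" if "i < d" for i
        using V(2) that topological_basis_open[OF B(2)] by (auto simp: PiE_iff)
      then show "P \<in> sets (Rd d)"
        unfolding V(1) Rd_def by (intro sets_PiM_I_finite) auto
    qed
  qed
  ultimately show ?thesis by simp
qed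

lemma eventually_line_openin:
  assumes "openin (Rd_top d) W" "u \<in> W" "j < d"
  shows "\<forall>\<^sub>F t in nhds (u j). u(j := t) \<in> W"
proof -
  obtain X where X: "u \<in> Pi\<^sub>E {..<d} X" "\<And>i. open (X i)" "Pi\<^sub>E {..<d} X \<subseteq> W"
    using product_topology_open_contains_basis[OF assms(1)[unfolded Rd_top_def] assms(2)] by auto
  have "\<forall>\<^sub>F t in nhds (u j). t \<in> X j"
    using X assms(3) by (intro eventually_nhds_in_open) auto
  then show ?thesis
  proof eventually_elim
    case (elim t)
    have "u(j := t) \<in> Pi\<^sub>E {..<d} X"
      using X(1) elim assms(3) by (auto simp: PiE_iff extensional_def)
    then show ?case using X(3) by blast
  qed
qed

text \<open>Changing one coordinate leaves \<open>u\<close>, so punctured neighbourhoods of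
  \<open>u\<close> pull back to punctured neighbourhoods on the line. This is how a Frechet limit is
  specialised to a single coordinate.\<close>

lemma filterlim_line_atin:
  assumes "u \<in> topspace (Rd_top d)" "j < d"
  shows "filterlim (\<lambda>t. u(j := t)) (atin (Rd_top d) u) (at (u j))"
  unfolding filterlim_iff
proof safe
  fix P assume "eventually P (atin (Rd_top d) u)"
  then obtain W where W: "openin (Rd_top d) W" "u \<in> W" "\<And>v. v \<in> W - {u} \<Longrightarrow> P v"
    using assms by (auto simp: eventually_atin)
  have "\<forall>\<^sub>F t in at (u j). u(j := t) \<in> W"
    using eventually_line_openin[OF W(1,2) assms(2)] by (simp add: eventually_nhds_conv_at)
  moreover have "\<forall>\<^sub>F t in at (u j). t \<noteq> u j"
    by (simp add: eventually_neq_at_within)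
  ultimately show "\<forall>\<^sub>F t in at (u j). P (u(j := t))"
  proof eventually_elim
    case (elim t)
    then show ?case using W(3)[of "u(j := t)"] by (metis Diff_iff fun_upd_same singletonD)
  qed
qed

text \<open>Unlike \<open>partial\<close>, this asserts that the derivative exists and names its
  value, so no default value of \<open>deriv\<close> can slip in.\<close>

definition line_deriv :: "nat \<Rightarrow> (rvec \<Rightarrow> real) \<Rightarrow> real \<Rightarrow> rvec \<Rightarrow> bool" where
  "line_deriv j F D u \<longleftrightarrow> ((\<lambda>t. F (u(j := t))) has_real_derivative D) (at (u j))"

lemma line_deriv_partial:
  assumes F: "frechet_diff_at d F u" and u: "u \<in> topspace (Rd_top d)" and j: "j < d"
  shows "line_deriv j F (partial j F u) u"
proof -
  define N where "N v = (\<Sum>i<d. partial i F u * (v i - u i))" for v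
  have N: "N (u(j := t)) = partial j F u * (t - u j)" for t
  proof -
    have "N (u(j := t)) = (\<Sum>i<d. if i = j then partial j F u * (t - u j) else 0)"
      unfolding N_def by (intro sum.cong) auto
    also have "\<dots> = partial j F u * (t - u j)"
      using j by (simp add: sum.delta')
    finally show ?thesis .
  qed
  have n2: "norm2 d (\<lambda>i. (u(j := t)) i - u i) = \<bar>t - u j\<bar>" for t
  proof -
    have "(\<Sum>i<d. ((u(j := t)) i - u i)\<^sup>2) = (\<Sum>i<d. if i = j then (t - u j)\<^sup>2 else 0)"
      by (intro sum.cong) auto
    also have "\<dots> = (t - u j)\<^sup>2"
      using j by (simp add: sum.delta')
    finally show ?thesis by (simp add: norm2_def L2_set_def)
  qed
  have "((\<lambda>v. (F v - F u - N v) / norm2 d (\<lambda>i. v i - u i)) \<longlongrightarrow> 0) (atin (Rd_top d) u)"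
    using F by (simp add: frechet_diff_at_def N_def)
  from filterlim_compose[OF this filterlim_line_atin[OF u j]]
  have "((\<lambda>t. (F (u(j := t)) - F u - partial j F u * (t - u j)) / \<bar>t - u j\<bar>) \<longlongrightarrow> 0) (at (u j))"
    unfolding N n2 .
  then have lim: "((\<lambda>t. \<bar>(F (u(j := t)) - F u - partial j F u * (t - u j)) / \<bar>t - u j\<bar>\<bar>) \<longlongrightarrow> 0) (at (u j))"
    by (rule tendsto_rabs_zero)
  have "((\<lambda>t. (F (u(j := t)) - F u) / (t - u j) - partial j F u) \<longlongrightarrow> 0) (at (u j))"
  proof (rule tendsto_rabs_zero_cancel, rule Lim_transform_eventually[OF lim])
    show "\<forall>\<^sub>F t in at (u j). \<bar>(F (u(j := t)) - F u - partial j F u * (t - u j)) / \<bar>t - u j\<bar>\<bar>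
        = \<bar>(F (u(j := t)) - F u) / (t - u j) - partial j F u\<bar>"
      using eventually_neq_at_within[of "u j"]
    proof eventually_elim
      case (elim t)
      have "\<bar>(F (u(j := t)) - F u - partial j F u * (t - u j)) / \<bar>t - u j\<bar>\<bar>
          = \<bar>(F (u(j := t)) - F u - partial j F u * (t - u j)) / (t - u j)\<bar>"
        by simp
      also have "(F (u(j := t)) - F u - partial j F u * (t - u j)) / (t - u j)
          = (F (u(j := t)) - F u) / (t - u j) - partial j F u"
        using elim by (simp add: field_simps)
      finally show ?case .
    qed
  qed
  then show ?thesis
    unfolding line_deriv_def has_field_derivative_iff
    by (simp add: LIM_zero_iff)
qed

lemma product_sigma_finite_lborel: "product_sigma_finite (\<lambda>_::nat. lborel :: real measure)"
  by (simp add: product_sigma_finite_def lborel.sigma_finite_measure_axioms)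

lemma measurable_Rd_upd:
  assumes "g \<in> borel_measurable (Rd d)" "j < d"
  shows "(\<lambda>u. u(j := g u)) \<in> measurable (Rd d) (Rd d)"
  unfolding Rd_def
proof (rule measurable_PiM_single')
  fix i assume i: "i \<in> {..<d}"
  show "(\<lambda>u. (u(j := g u)) i) \<in> measurable (Pi\<^sub>M {..<d} (\<lambda>_. lborel)) lborel"
    using assms(1) i by (cases "i = j") (auto simp: Rd_def)
next
  show "(\<lambda>u i. (u(j := g u)) i) \<in> space (Pi\<^sub>M {..<d} (\<lambda>_. lborel)) \<rightarrow> ({..<d} \<rightarrow>\<^sub>E space lborel)"
    using assms(2) by (auto simp: space_PiM PiE_iff extensional_def)
qed

lemma measurable_Rd_component [measurable]: "j < d \<Longrightarrow> (\<lambda>u. u j) \<in> borel_measurable (Rd d)"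
  unfolding Rd_def by (rule measurable_PiM_component_rev) auto

lemma measurable_Rd_line:
  assumes "u \<in> space (Rd d)" "j < d"
  shows "(\<lambda>t. u(j := t)) \<in> measurable lborel (Rd d)"
  unfolding Rd_def
proof (rule measurable_PiM_single')
  fix i assume i: "i \<in> {..<d}"
  show "(\<lambda>t. (u(j := t)) i) \<in> measurable lborel lborel"
    by (cases "i = j") auto
next
  show "(\<lambda>t i. (u(j := t)) i) \<in> space lborel \<rightarrow> ({..<d} \<rightarrow>\<^sub>E space lborel)"
    using assms by (auto simp: space_Rd PiE_iff extensional_def)
qed

lemma Rd_nn_integral_line:
  assumes j: "j < d" and f: "f \<in> borel_measurable (Rd d)"
  shows "integral\<^sup>N (Rd d) f
    = (\<integral>\<^sup>+u. (\<integral>\<^sup>+t. f (u(j := t)) \<partial>lborel) \<partial>Pi\<^sub>M ({..<d} - {j}) (\<lambda>_. lborel))"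
proof -
  interpret product_sigma_finite "\<lambda>_::nat. lborel :: real measure"
    by (rule product_sigma_finite_lborel)
  have I: "insert j {..<d} = {..<d}" using j by auto
  show ?thesis
    using product_nn_integral_insert[of "{..<d} - {j}" j f] f by (simp add: I Rd_def)
qed

lemma upd_in_space_Rd_of_Pi:
  assumes "u \<in> space (Pi\<^sub>M ({..<d} - {j}) (\<lambda>_. lborel :: real measure))" "j < d"
  shows "u(j := t) \<in> space (Rd d)"
  using assms by (auto simp: space_PiM space_Rd PiE_iff extensional_def)

lemma Rd_null_by_lines:
  assumes A: "A \<in> sets (Rd d)" and j: "j < d"
    and null: "\<And>u. u \<in> space (Rd d) \<Longrightarrow> emeasure lborel {t. u(j := t) \<in> A} = 0"
  shows "emeasure (Rd d) A = 0"
proof -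
  have "emeasure (Rd d) A = integral\<^sup>N (Rd d) (indicator A)"
    using A by simp
  also have "\<dots> = (\<integral>\<^sup>+u. (\<integral>\<^sup>+t. indicator A (u(j := t)) \<partial>lborel)
      \<partial>Pi\<^sub>M ({..<d} - {j}) (\<lambda>_. lborel))"
    using A by (intro Rd_nn_integral_line j) auto
  also have "\<dots> = (\<integral>\<^sup>+u. 0 \<partial>Pi\<^sub>M ({..<d} - {j}) (\<lambda>_. lborel :: real measure))"
  proof (rule nn_integral_cong)
    fix u assume u: "u \<in> space (Pi\<^sub>M ({..<d} - {j}) (\<lambda>_. lborel :: real measure))"
    have v: "u(j := 0) \<in> space (Rd d)" by (rule upd_in_space_Rd_of_Pi[OF u j])
    have "(\<lambda>t. (u(j := 0))(j := t)) -` A \<inter> space lborel \<in> sets lborel"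
      by (rule measurable_sets[OF measurable_Rd_line[OF v j] A])
    then have S: "{t. u(j := t) \<in> A} \<in> sets lborel"
      by (simp add: vimage_def)
    have "(\<integral>\<^sup>+t. indicator A (u(j := t)) \<partial>lborel)
        = (\<integral>\<^sup>+t. indicator {t. u(j := t) \<in> A} t \<partial>lborel)"
      by (intro nn_integral_cong) (auto simp: indicator_def)
    also have "\<dots> = emeasure lborel {t. u(j := t) \<in> A}"
      using S by simp
    also have "\<dots> = 0" using null[OF v] by simp
    finally show "(\<integral>\<^sup>+t. indicator A (u(j := t)) \<partial>lborel) = 0" .
  qed
  finally show ?thesis by simp
qed

text \<open>Fubini reduces the integral to lines. On almost every line \<open>G\<close> is
  integrable, and there the one-dimensional result applies.\<close>

lemma Rd_integral_line_derivative:
  assumes j: "j < d" and iG: "integrable (Rd d) G" and iG': "integrable (Rd d) G'"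
    and deriv: "\<And>u. u \<in> space (Rd d) \<Longrightarrow> line_deriv j G (G' u) u"
  shows "(\<integral>u. G' u \<partial>Rd d) = 0"
proof -
  interpret product_sigma_finite "\<lambda>_::nat. lborel :: real measure"
    by (rule product_sigma_finite_lborel)
  let ?I = "{..<d} - {j}" and ?P = "Pi\<^sub>M ({..<d} - {j}) (\<lambda>_. lborel :: real measure)"
  have I: "insert j {..<d} = {..<d}" using j by auto
  have mG: "G \<in> borel_measurable (Rd d)" using iG by auto
  have "(\<integral>\<^sup>+u. (\<integral>\<^sup>+t. norm (G (u(j := t))) \<partial>lborel) \<partial>?P) \<noteq> \<infinity>"
    using iG Rd_nn_integral_line[OF j, of "\<lambda>u. ennreal (norm (G u))"] mG
    by (auto simp: integrable_iff_bounded)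
  moreover have "(\<lambda>u. \<integral>\<^sup>+t. norm (G (u(j := t))) \<partial>lborel) \<in> borel_measurable ?P"
  proof -
    have "(\<lambda>(u, t). u(j := t)) \<in> measurable (?P \<Otimes>\<^sub>M lborel) (Rd d)"
      using measurable_add_dim[of j ?I "\<lambda>_. lborel :: real measure"] by (simp add: I Rd_def)
    then have "(\<lambda>z. ennreal (norm (G ((fst z)(j := snd z))))) \<in> borel_measurable (?P \<Otimes>\<^sub>M lborel)"
      using mG by (simp add: case_prod_beta')
    then show ?thesis
      by (intro lborel.borel_measurable_nn_integral) (simp add: case_prod_beta')
  qed
  ultimately have fin: "AE u in ?P. (\<integral>\<^sup>+t. norm (G (u(j := t))) \<partial>lborel) \<noteq> \<infinity>"
    by (rule nn_integral_PInf_AE[rotated])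
  have "(\<integral>u. G' u \<partial>Rd d) = (\<integral>u. (\<integral>t. G' (u(j := t)) \<partial>lborel) \<partial>?P)"
    using product_integral_insert[of ?I j G'] iG' by (simp add: I Rd_def)
  also have "\<dots> = (\<integral>u. 0 \<partial>?P)"
  proof (rule integral_cong_AE)
    show "(\<lambda>u. \<integral>t. G' (u(j := t)) \<partial>lborel) \<in> borel_measurable ?P"
    proof -
      have "(\<lambda>(u, t). u(j := t)) \<in> measurable (?P \<Otimes>\<^sub>M lborel) (Rd d)"
        using measurable_add_dim[of j ?I "\<lambda>_. lborel :: real measure"] by (simp add: I Rd_def)
      then have "(\<lambda>z. G' ((fst z)(j := snd z))) \<in> borel_measurable (?P \<Otimes>\<^sub>M lborel)"
        using iG' by (simp add: case_prod_beta')
      then show ?thesis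
        by (intro lborel.borel_measurable_lebesgue_integral) (simp add: case_prod_beta')
    qed
    show "AE u in ?P. (\<integral>t. G' (u(j := t)) \<partial>lborel) = 0"
      using fin AE_space
    proof eventually_elim
      case (elim u)
      have v: "u(j := t) \<in> space (Rd d)" for t
        using upd_in_space_Rd_of_Pi[OF _ j] elim(2) by blast
      have m: "(\<lambda>t. u(j := t)) \<in> measurable lborel (Rd d)"
        using measurable_Rd_line[OF v[of 0] j] by simp
      have iGl: "integrable lborel (\<lambda>t. G (u(j := t)))"
        using elim(1) measurable_compose[OF m mG] by (simp add: integrable_iff_bounded less_top)
      have "((\<lambda>t. G (u(j := t))) has_real_derivative G' (u(j := t))) (at t)" for t
        using deriv[OF v[of t]] by (simp add: line_deriv_def)
      \<comment> \<open>If \<open>G'\<close> is not integrable on this line, its Bochner integral is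
        0 by default, so both cases give the same value.\<close>
      then show ?case
        using integral_derivative_real_line[OF _ iGl]
        by (cases "integrable lborel (\<lambda>t. G' (u(j := t)))") (auto simp: not_integrable_integral_eq)
    qed
  qed auto
  finally show ?thesis by simp
qed

subsection \<open>Stein identities\<close>

text \<open>The square is what makes the positive part differentiable at 0, and with it the cutoff
  at the level where it starts to vanish.\<close>

lemma has_real_derivative_max0_squared:
  "((\<lambda>x. (max 0 x)\<^sup>2) has_real_derivative 2 * max 0 x) (at (x :: real))"
proof -
  consider "x < 0" | "x = 0" | "x > 0" by linarith
  then show ?thesis
  proof cases
    case 1
    have "((\<lambda>x. 0) has_real_derivative 0) (at x)" by simp
    then have "((\<lambda>x. (max 0 x)\<^sup>2) has_real_derivative 0) (at x)"
      by (rule has_field_derivative_transform_within_open[where S = "{..<0}"]) (use 1 in auto)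
    then show ?thesis using 1 by simp
  next
    case 2
    have "((\<lambda>h. max 0 h) \<longlongrightarrow> max 0 (0::real)) (at 0)"
      by (intro tendsto_intros)
    then have "((\<lambda>h. max 0 h) \<longlongrightarrow> (0::real)) (at 0)" by simp
    then have "((\<lambda>h. (max 0 h)\<^sup>2 / h) \<longlongrightarrow> (0::real)) (at 0)"
    proof (rule Lim_transform_eventually)
      show "\<forall>\<^sub>F h in at (0::real). max 0 h = (max 0 h)\<^sup>2 / h"
        using eventually_neq_at_within[of "0::real"]
        by eventually_elim (auto simp: max_def power2_eq_square)
    qed
    then show ?thesis
      unfolding 2 by (simp add: has_field_derivative_iff)
  next
    case 3
    have "((\<lambda>x. x\<^sup>2) has_real_derivative 2 * x) (at x)"
      by (auto intro!: derivative_eq_intros)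
    then have "((\<lambda>x. (max 0 x)\<^sup>2) has_real_derivative 2 * x) (at x)"
      by (rule has_field_derivative_transform_within_open[where S = "{0<..}"]) (use 3 in auto)
    then show ?thesis using 3 by simp
  qed
qed

definition cutoff :: "real \<Rightarrow> real \<Rightarrow> real" where
  "cutoff e q = (max 0 (1 - e / q))\<^sup>2"

definition cutoff_deriv :: "real \<Rightarrow> real \<Rightarrow> real" where
  "cutoff_deriv e q = 2 * max 0 (1 - e / q) * (e / q\<^sup>2)"

lemma cutoff_has_derivative:
  assumes "q > 0"
  shows "(cutoff e has_real_derivative cutoff_deriv e q) (at q)"
proof -
  have "((\<lambda>q. 1 - e / q) has_real_derivative e / q\<^sup>2) (at q)"
    using assms by (auto intro!: derivative_eq_intros simp: power2_eq_square field_simps)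
  from DERIV_chain2[OF has_real_derivative_max0_squared this]
  show ?thesis unfolding cutoff_def[abs_def] cutoff_deriv_def .
qed

lemma cutoff_eq_0: "0 < q \<Longrightarrow> q < e \<Longrightarrow> cutoff e q = 0"
  by (simp add: cutoff_def max_def field_simps)

lemma cutoff_bounds: "0 \<le> cutoff e q" "0 < q \<Longrightarrow> 0 < e \<Longrightarrow> cutoff e q \<le> 1"
  by (auto simp: cutoff_def max_def field_simps intro!: power_le_one)

text \<open>With t = e / q the product is twice t times the positive part of 1 - t, so the bound
  does not depend on \<open>e\<close>. It turns the term containing the derivative of the cutoff
  into at most twice |F q' / q|, an integrable majorant for all \<open>e\<close> at once.\<close>

lemma cutoff_deriv_bound:
  assumes "0 < q" "0 < e"
  shows "\<bar>q * cutoff_deriv e q\<bar> \<le> 2"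
proof (cases "e \<le> q")
  case True
  have "q * cutoff_deriv e q = 2 * (max 0 (1 - e / q) * (e / q))"
    using assms by (simp add: cutoff_deriv_def power2_eq_square)
  moreover have "0 \<le> max 0 (1 - e / q)" "max 0 (1 - e / q) \<le> 1" "0 \<le> e / q" "e / q \<le> 1"
    using assms True by auto
  ultimately show ?thesis
    using mult_le_one[of "max 0 (1 - e / q)" "e / q"]
      mult_nonneg_nonneg[of "max 0 (1 - e / q)" "e / q"]
    by linarith
next
  case False
  then show ?thesis using assms by (simp add: cutoff_deriv_def max_def field_simps)
qed

lemma cutoff_tendsto:
  assumes q: "q > 0" and e: "e \<longlonglongrightarrow> 0"
  shows "(\<lambda>m. cutoff (e m) q) \<longlonglongrightarrow> 1" "(\<lambda>m. cutoff_deriv (e m) q) \<longlonglongrightarrow> 0"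
proof -
  have "(\<lambda>m. (max 0 (1 - e m / q))\<^sup>2) \<longlonglongrightarrow> (max 0 (1 - 0 / q))\<^sup>2"
    using q by (intro tendsto_intros e) auto
  then show "(\<lambda>m. cutoff (e m) q) \<longlonglongrightarrow> 1" by (simp add: cutoff_def)
  have "(\<lambda>m. 2 * max 0 (1 - e m / q) * (e m / q\<^sup>2)) \<longlonglongrightarrow> 2 * max 0 (1 - 0 / q) * (0 / q\<^sup>2)"
    using q by (intro tendsto_intros e) auto
  then show "(\<lambda>m. cutoff_deriv (e m) q) \<longlonglongrightarrow> 0" by (simp add: cutoff_deriv_def)
qed

lemma borel_measurable_cutoff [measurable]:
  "cutoff e \<in> borel_measurable borel" "cutoff_deriv e \<in> borel_measurable borel"
  unfolding cutoff_def[abs_def] cutoff_deriv_def[abs_def] by measurable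

section \<open>Calculus along lines inside an open domain\<close>

lemma line_deriv_mult:
  assumes "line_deriv j F D u" "line_deriv j G E u"
  shows "line_deriv j (\<lambda>u. F u * G u) (D * G u + F u * E) u"
  using DERIV_mult[OF assms[unfolded line_deriv_def]]
  by (simp add: line_deriv_def algebra_simps)

lemma line_deriv_compose:
  assumes "(h has_real_derivative E) (at (F u))" "line_deriv j F D u"
  shows "line_deriv j (\<lambda>u. h (F u)) (E * D) u"
  using DERIV_chain2[of h E "\<lambda>t. F (u(j := t))" "u j" D UNIV] assms
  by (simp add: line_deriv_def)

locale line_open_domain =
  fixes d :: nat and U :: "rvec set"
  assumes U_sets: "U \<in> sets (Rd d)"
    and U_line: "\<And>u j. u \<in> U \<Longrightarrow> j < d \<Longrightarrow> \<forall>\<^sub>F t in nhds (u j). u(j := t) \<in> U"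
begin

lemma U_space: "u \<in> U \<Longrightarrow> u \<in> space (Rd d)"
  using sets.sets_into_space[OF U_sets] by auto

lemma line_deriv_cong:
  assumes "line_deriv j F D u" "u \<in> U" "j < d" "\<And>u. u \<in> U \<Longrightarrow> F u = G u"
  shows "line_deriv j G D u"
proof -
  have ev: "\<forall>\<^sub>F t in nhds (u j). F (u(j := t)) = G (u(j := t))"
    using U_line[OF assms(2,3)] by eventually_elim (rule assms(4))
  then show ?thesis
    using assms(1) DERIV_cong_ev[OF refl ev refl, of D] by (simp add: line_deriv_def)
qed

text \<open>The derivative is the pointwise limit of difference quotients with steps 1 / (n + 1).
  The model assumes measurability of the functions only; that of all their derivatives on
  \<open>U\<close> comes from here.\<close>

lemma line_deriv_measurable:
  assumes j: "j < d" and F: "F \<in> borel_measurable (Rd d)"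
    and deriv: "\<And>u. u \<in> U \<Longrightarrow> line_deriv j F (F' u) u"
    and off: "\<And>u. u \<notin> U \<Longrightarrow> F' u = 0"
  shows "F' \<in> borel_measurable (Rd d)"
proof (rule borel_measurable_LIMSEQ_real)
  let ?Q = "\<lambda>n u. indicator U u * ((F (u(j := u j + 1 / real (Suc n))) - F u) / (1 / real (Suc n)))"
  show "(\<lambda>n. ?Q n u) \<longlonglongrightarrow> F' u" for u
  proof (cases "u \<in> U")
    case True
    have "((\<lambda>h. (F (u(j := u j + h)) - F (u(j := u j))) / h) \<longlongrightarrow> F' u) (at 0)"
      using deriv[OF True] by (simp add: line_deriv_def DERIV_def)
    moreover have "filterlim (\<lambda>n. 1 / real (Suc n)) (at 0) sequentially"
      using LIMSEQ_inverse_real_of_nat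
      by (auto simp: filterlim_at inverse_eq_divide)
    ultimately have "(\<lambda>n. (F (u(j := u j + 1 / real (Suc n))) - F (u(j := u j))) / (1 / real (Suc n))) \<longlonglongrightarrow> F' u"
      by (rule filterlim_compose)
    then show ?thesis using True by simp
  qed (simp add: off)
  show "?Q n \<in> borel_measurable (Rd d)" for n
  proof -
    have "(\<lambda>u. u(j := u j + 1 / real (Suc n))) \<in> measurable (Rd d) (Rd d)"
      using j by (intro measurable_Rd_upd) measurable
    from measurable_compose[OF this F] show ?thesis
      using F U_sets by measurable
  qed
qed

end

text \<open>\<open>q_boundary\<close> expresses the decay of the density at the boundary on each
  line separately. It concerns punctured neighbourhoods of arbitrary points off \<open>U\<close>, so
  that boundary and exterior of the support are treated alike.\<close>

locale positive_domain = line_open_domain +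
  fixes q :: "rvec \<Rightarrow> real"
  assumes q_measurable: "q \<in> borel_measurable (Rd d)"
    and q_pos: "\<And>u. u \<in> U \<Longrightarrow> 0 < q u"
    and q_off: "\<And>u. u \<notin> U \<Longrightarrow> q u = 0"
    and q_boundary: "\<And>w j e. w \<in> space (Rd d) \<Longrightarrow> w \<notin> U \<Longrightarrow> j < d \<Longrightarrow> 0 < e \<Longrightarrow>
      \<forall>\<^sub>F t in at (w j). q (w(j := t)) < e"
begin

text \<open>Multiplying by \<open>cutoff e \<circ> q\<close> and extending by zero makes a function on \<open>U\<close> differentiable
  along every whole line, because \<open>q\<close> is small near the complement of \<open>U\<close>.\<close>

lemma integral_line_derivative_eq_0:
  assumes j: "j < d"
    and F: "integrable (Rd d) F" and F': "integrable (Rd d) F'"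
    and Fq: "integrable (Rd d) (\<lambda>u. F u * q' u / q u)"
    and dF: "\<And>u. u \<in> U \<Longrightarrow> line_deriv j F (F' u) u"
    and dq: "\<And>u. u \<in> U \<Longrightarrow> line_deriv j q (q' u) u"
    and off: "\<And>u. u \<notin> U \<Longrightarrow> F u = 0" "\<And>u. u \<notin> U \<Longrightarrow> F' u = 0" "\<And>u. u \<notin> U \<Longrightarrow> q' u = 0"
  shows "(\<integral>u. F' u \<partial>Rd d) = 0"
proof -
  note [measurable] = q_measurable
  have [measurable]: "F \<in> borel_measurable (Rd d)" "F' \<in> borel_measurable (Rd d)"
    using F F' by auto
  have [measurable]: "q' \<in> borel_measurable (Rd d)"
    by (rule line_deriv_measurable[OF j q_measurable dq off(3)])
  define G where "G e u = F u * cutoff e (q u)" for e u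
  define G' where "G' e u = F' u * cutoff e (q u) + F u * (cutoff_deriv e (q u) * q' u)" for e u
  have dom: "\<bar>G' e u\<bar> \<le> \<bar>F' u\<bar> + 2 * \<bar>F u * q' u / q u\<bar>" if e: "e > 0" for e u
  proof (cases "u \<in> U")
    case True
    note q = q_pos[OF True]
    have "\<bar>F' u * cutoff e (q u)\<bar> \<le> \<bar>F' u\<bar> * 1"
      using cutoff_bounds(1)[of e "q u"] cutoff_bounds(2)[OF q e] unfolding abs_mult by (intro mult_left_mono) auto
    moreover have "F u * (cutoff_deriv e (q u) * q' u)
        = (q u * cutoff_deriv e (q u)) * (F u * q' u / q u)"
      using q by simp
    then have "\<bar>F u * (cutoff_deriv e (q u) * q' u)\<bar> \<le> 2 * \<bar>F u * q' u / q u\<bar>"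
      using cutoff_deriv_bound[OF q e] by (simp only: abs_mult) (intro mult_right_mono, auto)
    ultimately show ?thesis unfolding G'_def by linarith
  qed (simp add: G'_def off)
  have zero: "(\<integral>u. G' e u \<partial>Rd d) = 0" if e: "e > 0" for e
  proof (rule Rd_integral_line_derivative[OF j, of "G e"])
    show "integrable (Rd d) (G e)"
    proof (rule Bochner_Integration.integrable_bound[OF F])
      show "AE u in Rd d. norm (G e u) \<le> norm (F u)"
      proof (rule AE_I2)
        fix u show "norm (G e u) \<le> norm (F u)"
        proof (cases "u \<in> U")
          case True
          then show ?thesis
            using cutoff_bounds(1)[of e "q u"] cutoff_bounds(2)[OF q_pos[OF True] e]
            by (auto simp: G_def abs_mult intro!: mult_left_le)
        qed (simp add: G_def off)
      qed
    qed (simp add: G_def[abs_def])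
    have "integrable (Rd d) (\<lambda>u. \<bar>F' u\<bar> + 2 * \<bar>F u * q' u / q u\<bar>)"
      by (intro Bochner_Integration.integrable_add integrable_abs integrable_mult_right F' Fq)
    then show "integrable (Rd d) (G' e)"
    proof (rule Bochner_Integration.integrable_bound)
      show "AE u in Rd d. norm (G' e u) \<le> norm (\<bar>F' u\<bar> + 2 * \<bar>F u * q' u / q u\<bar>)"
        using dom[OF e] by (intro AE_I2) (auto intro: order_trans)
    qed (simp add: G'_def[abs_def])
    fix u assume u: "u \<in> space (Rd d)"
    show "line_deriv j (G e) (G' e u) u"
    proof (cases "u \<in> U")
      case True
      show ?thesis
        unfolding G_def G'_def
        by (intro line_deriv_mult dF[OF True] line_deriv_compose[OF cutoff_has_derivative] dq[OF True] q_pos[OF True])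
    next
      case False
      have "\<forall>\<^sub>F t in at (u j). G e (u(j := t)) = 0"
        using q_boundary[OF u False j e]
      proof eventually_elim
        case (elim t)
        then show ?case
          using off(1)[of "u(j := t)"] cutoff_eq_0[OF q_pos, of "u(j := t)" e] by (auto simp: G_def)
      qed
      moreover have "G e (u(j := u j)) = 0"
        using False by (simp add: G_def off)
      ultimately have ev: "\<forall>\<^sub>F t in nhds (u j). G e (u(j := t)) = 0"
        by (simp add: eventually_nhds_conv_at)
      have "((\<lambda>t. G e (u(j := t))) has_real_derivative 0) (at (u j))"
        using DERIV_cong_ev[OF refl ev refl] by simp
      then show ?thesis
        using False by (simp add: line_deriv_def G'_def off)
    qed
  qed
  define e where "e m = 1 / real (Suc m)" for m
  have e: "e \<longlonglongrightarrow> 0" "\<And>m. e m > 0"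
    using LIMSEQ_inverse_real_of_nat by (auto simp: e_def[abs_def] inverse_eq_divide)
  have "(\<lambda>m. \<integral>u. G' (e m) u \<partial>Rd d) \<longlonglongrightarrow> (\<integral>u. F' u \<partial>Rd d)"
  proof (rule integral_dominated_convergence)
    show "integrable (Rd d) (\<lambda>u. \<bar>F' u\<bar> + 2 * \<bar>F u * q' u / q u\<bar>)"
      by (intro Bochner_Integration.integrable_add integrable_abs integrable_mult_right F' Fq)
    show "AE u in Rd d. (\<lambda>m. G' (e m) u) \<longlonglongrightarrow> F' u"
    proof (rule AE_I2)
      fix u show "(\<lambda>m. G' (e m) u) \<longlonglongrightarrow> F' u"
      proof (cases "u \<in> U")
        case True
        have "(\<lambda>m. G' (e m) u) \<longlonglongrightarrow> F' u * 1 + F u * (0 * q' u)"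
          unfolding G'_def by (intro tendsto_intros cutoff_tendsto q_pos[OF True] e(1))
        then show ?thesis by simp
      qed (simp add: G'_def off)
    qed
    show "AE u in Rd d. norm (G' (e m) u) \<le> \<bar>F' u\<bar> + 2 * \<bar>F u * q' u / q u\<bar>" for m
      using dom[OF e(2)] by (intro AE_I2) simp
  qed (simp_all add: G'_def[abs_def])
  then show ?thesis
    by (simp add: zero[OF e(2)] LIMSEQ_const_iff)
qed

end

text \<open>Every factor is at most \<open>m\<close>, and the sixth power of \<open>m\<close> is one
  of the four summands on the right. This one inequality replaces Hoelder's in the integrability
  arguments; the summand 1 admits degrees below six.\<close>

lemma monomial_le_sixth_powers:
  fixes a b c :: real
  assumes "i + j + k \<le> 6"
  shows "\<bar>a\<bar> ^ i * \<bar>b\<bar> ^ j * \<bar>c\<bar> ^ k \<le> 1 + a ^ 6 + b ^ 6 + c ^ 6"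
proof -
  define m where "m = max 1 (max \<bar>a\<bar> (max \<bar>b\<bar> \<bar>c\<bar>))"
  have m: "1 \<le> m" "\<bar>a\<bar> \<le> m" "\<bar>b\<bar> \<le> m" "\<bar>c\<bar> \<le> m" unfolding m_def le_max_iff_disj by simp_all
  have "\<bar>a\<bar> ^ i * \<bar>b\<bar> ^ j * \<bar>c\<bar> ^ k \<le> m ^ i * m ^ j * m ^ k"
    using m by (intro mult_mono power_mono mult_nonneg_nonneg) auto
  also have "\<dots> = m ^ (i + j + k)" by (simp add: power_add)
  also have "\<dots> \<le> m ^ 6" using m assms by (intro power_increasing) auto
  also have "m ^ 6 \<le> 1 + a ^ 6 + b ^ 6 + c ^ 6"
  proof -
    have "0 \<le> a ^ 6" "0 \<le> b ^ 6" "0 \<le> c ^ 6" by auto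
    moreover have "\<bar>a\<bar> ^ 6 = a ^ 6" "\<bar>b\<bar> ^ 6 = b ^ 6" "\<bar>c\<bar> ^ 6 = c ^ 6" by simp_all
    ultimately show ?thesis
      unfolding m_def max_def by auto
  qed
  finally show ?thesis .
qed

text \<open>\<open>Q1\<close> and \<open>Q2\<close> carry the first and second derivatives of
  \<open>q\<close> on \<open>U\<close> and are 0 elsewhere. This makes them measurable, which the
  literal partial derivatives of a density need not be off \<open>U\<close>.\<close>

locale smooth_density = positive_domain d U q + prob_space M
  for d U q and M :: "'a measure" +
  fixes x :: "'a \<Rightarrow> rvec" and Q1 :: "nat \<Rightarrow> rvec \<Rightarrow> real" and Q2 :: "nat \<Rightarrow> nat \<Rightarrow> rvec \<Rightarrow> real"
  assumes dist: "distributed M (Rd d) x (\<lambda>u. ennreal (q u))"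
    and Q1_deriv: "\<And>u j. u \<in> U \<Longrightarrow> j < d \<Longrightarrow> line_deriv j q (Q1 j u) u"
    and Q1_off: "\<And>u j. u \<notin> U \<Longrightarrow> Q1 j u = 0"
    and Q2_deriv: "\<And>u j k. u \<in> U \<Longrightarrow> j < d \<Longrightarrow> k < d \<Longrightarrow> line_deriv j (Q1 k) (Q2 j k u) u"
    and Q2_off: "\<And>u j k. u \<notin> U \<Longrightarrow> Q2 j k u = 0"
begin

lemma x_measurable [measurable]: "x \<in> measurable M (Rd d)"
  using dist by (simp add: distributed_def)

lemma q_nonneg: "0 \<le> q u"
  using q_pos[of u] q_off[of u] by (cases "u \<in> U") auto

lemma Q1_measurable: "j < d \<Longrightarrow> Q1 j \<in> borel_measurable (Rd d)"
  by (rule line_deriv_measurable[OF _ q_measurable Q1_deriv Q1_off])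

lemma Q2_measurable: "j < d \<Longrightarrow> k < d \<Longrightarrow> Q2 j k \<in> borel_measurable (Rd d)"
  by (rule line_deriv_measurable[OF _ Q1_measurable Q2_deriv Q2_off])

lemma integrable_density_iff:
  "g \<in> borel_measurable (Rd d) \<Longrightarrow> integrable (Rd d) (\<lambda>u. q u * g u) \<longleftrightarrow> integrable M (\<lambda>\<omega>. g (x \<omega>))"
  by (rule distributed_integrable[OF dist]) (auto simp: q_nonneg)

lemma integral_density:
  "g \<in> borel_measurable (Rd d) \<Longrightarrow> (\<integral>u. q u * g u \<partial>Rd d) = (\<integral>\<omega>. g (x \<omega>) \<partial>M)"
  by (rule distributed_integral[OF dist]) (auto simp: q_nonneg)

text \<open>\<open>A\<close>, \<open>B\<close>, \<open>C\<close> stand for h, h', h'' evaluated at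
  the index of u along \<open>v\<close>. The identity is two integrations by parts, of A^2 * Q1 k in
  direction j and of A * B * q in direction k. Differentiating \<open>A\<close> and \<open>B\<close>
  separately leaves integrands that the listed moments control.\<close>

lemma second_order_stein:
  fixes A B C :: "rvec \<Rightarrow> real" and v :: rvec
  defines "S \<equiv> \<lambda>j u. Q1 j u / q u" and "H \<equiv> \<lambda>j k u. Q2 j k u / q u"
  assumes jk: "j < d" "k < d"
    and i: "i < d" "v i \<noteq> 0"
    and mA: "A \<in> borel_measurable (Rd d)"
    and off: "\<And>u. u \<notin> U \<Longrightarrow> A u = 0 \<and> B u = 0 \<and> C u = 0"
    and dA: "\<And>u j. u \<in> U \<Longrightarrow> j < d \<Longrightarrow> line_deriv j A (B u * v j) u"
    and dB: "\<And>u j. u \<in> U \<Longrightarrow> j < d \<Longrightarrow> line_deriv j B (C u * v j) u"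
    and iA: "integrable M (\<lambda>\<omega>. A (x \<omega>) ^ 6)"
    and iB: "integrable M (\<lambda>\<omega>. (B (x \<omega>))\<^sup>2)"
    and iAC: "integrable M (\<lambda>\<omega>. A (x \<omega>) * C (x \<omega>))"
    and iS: "\<And>j. j < d \<Longrightarrow> integrable M (\<lambda>\<omega>. S j (x \<omega>) ^ 6)"
    and iH: "integrable M (\<lambda>\<omega>. H j k (x \<omega>) ^ 6)"
  shows "(\<integral>\<omega>. (A (x \<omega>))\<^sup>2 * H j k (x \<omega>) \<partial>M)
    = 2 * (v j * v k) * ((\<integral>\<omega>. (B (x \<omega>))\<^sup>2 \<partial>M) + (\<integral>\<omega>. A (x \<omega>) * C (x \<omega>) \<partial>M))"
proof -
  note [measurable] = q_measurable mA
  \<comment> \<open>Measurability is known for coordinate derivatives only; dividing by a nonzero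
    \<open>v i\<close> recovers \<open>B\<close>, and in the same way \<open>C\<close>.\<close>
  have "(\<lambda>u. B u * v i) \<in> borel_measurable (Rd d)"
    by (rule line_deriv_measurable[OF i(1) mA dA]) (use i off in auto)
  then have "(\<lambda>u. B u * v i / v i) \<in> borel_measurable (Rd d)" by measurable
  then have mB [measurable]: "B \<in> borel_measurable (Rd d)" using i by simp
  have "(\<lambda>u. C u * v i) \<in> borel_measurable (Rd d)"
    by (rule line_deriv_measurable[OF i(1) mB dB]) (use i off in auto)
  then have "(\<lambda>u. C u * v i / v i) \<in> borel_measurable (Rd d)" by measurable
  then have mC [measurable]: "C \<in> borel_measurable (Rd d)" using i by simp
  have mS [measurable]: "S j \<in> borel_measurable (Rd d)" "S k \<in> borel_measurable (Rd d)"
    using Q1_measurable jk by (auto simp: S_def)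
  have mH [measurable]: "H j k \<in> borel_measurable (Rd d)"
    using Q2_measurable jk by (auto simp: H_def)
  have bound: "integrable M (\<lambda>\<omega>. g (x \<omega>))"
    if g [measurable]: "g \<in> borel_measurable (Rd d)"
      and le: "\<And>u. \<bar>g u\<bar> \<le> 2 * (1 + A u ^ 6 + (B u)\<^sup>2 + S j u ^ 6 + S k u ^ 6 + H j k u ^ 6)" for g
  proof (rule Bochner_Integration.integrable_bound)
    show "integrable M (\<lambda>\<omega>. 2 * (1 + A (x \<omega>) ^ 6 + (B (x \<omega>))\<^sup>2 + S j (x \<omega>) ^ 6
        + S k (x \<omega>) ^ 6 + H j k (x \<omega>) ^ 6))"
      using iA iB iS jk iH by auto
    show "AE \<omega> in M. norm (g (x \<omega>)) \<le> norm (2 * (1 + A (x \<omega>) ^ 6 + (B (x \<omega>))\<^sup>2 + S j (x \<omega>) ^ 6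
        + S k (x \<omega>) ^ 6 + H j k (x \<omega>) ^ 6))"
      by (intro AE_I2) (use le in \<open>force intro: order_trans\<close>)
  qed simp
  let ?R = "\<lambda>u. 2 * (1 + A u ^ 6 + (B u)\<^sup>2 + S j u ^ 6 + S k u ^ 6 + H j k u ^ 6)"
  have nn: "0 \<le> A u ^ 6" "0 \<le> (B u)\<^sup>2" "0 \<le> S j u ^ 6" "0 \<le> S k u ^ 6" "0 \<le> H j k u ^ 6" for u
    by auto
  have AH: "\<bar>(A u)\<^sup>2 * H j k u\<bar> \<le> ?R u" for u
  proof -
    have "\<bar>(A u)\<^sup>2 * H j k u\<bar> \<le> 1 + A u ^ 6 + H j k u ^ 6"
      using monomial_le_sixth_powers[of 2 1 0 "A u" "H j k u" 0] by (simp add: abs_mult)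
    then show ?thesis using nn[of u] by argo
  qed
  have AS: "\<bar>(A u)\<^sup>2 * S k u\<bar> \<le> ?R u" for u
  proof -
    have "\<bar>(A u)\<^sup>2 * S k u\<bar> \<le> 1 + A u ^ 6 + S k u ^ 6"
      using monomial_le_sixth_powers[of 2 1 0 "A u" "S k u" 0] by (simp add: abs_mult)
    then show ?thesis using nn[of u] by argo
  qed
  have ASS: "\<bar>(A u)\<^sup>2 * S k u * S j u\<bar> \<le> ?R u" for u
  proof -
    have "\<bar>(A u)\<^sup>2 * S k u * S j u\<bar> \<le> 1 + A u ^ 6 + S k u ^ 6 + S j u ^ 6"
      using monomial_le_sixth_powers[of 2 1 1 "A u" "S k u" "S j u"] by (simp add: abs_mult)
    then show ?thesis using nn[of u] by argo
  qed
  have AB: "\<bar>A u * B u\<bar> \<le> ?R u" for u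
  proof -
    have "2 * \<bar>A u * B u\<bar> \<le> (A u)\<^sup>2 + (B u)\<^sup>2"
      using sum_squares_bound[of "\<bar>A u\<bar>" "\<bar>B u\<bar>"] by (simp add: abs_mult)
    moreover have "(A u)\<^sup>2 \<le> 1 + A u ^ 6"
      using monomial_le_sixth_powers[of 2 0 0 "A u" 0 0] by simp
    ultimately show ?thesis using nn[of u] by argo
  qed
  \<comment> \<open>\<open>B\<close> has only a second moment, so it is split off by 2 a b <= a^2 +
    b^2 and the sixth moments are spent on the square of \<open>A u * S k u\<close>.\<close>
  have ABS: "\<bar>A u * B u * S k u\<bar> \<le> ?R u" for u
  proof -
    have "2 * (\<bar>A u * S k u\<bar> * \<bar>B u\<bar>) \<le> (A u * S k u)\<^sup>2 + (B u)\<^sup>2"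
      using sum_squares_bound[of "\<bar>A u * S k u\<bar>" "\<bar>B u\<bar>"] by (simp only: power2_abs mult.assoc)
    moreover have "\<bar>A u * B u * S k u\<bar> = \<bar>A u * S k u\<bar> * \<bar>B u\<bar>"
      by (simp add: abs_mult)
    moreover have "(A u * S k u)\<^sup>2 \<le> 1 + A u ^ 6 + S k u ^ 6"
      using monomial_le_sixth_powers[of 2 2 0 "A u" "S k u" 0] by (simp add: power_mult_distrib)
    ultimately show ?thesis using nn[of u] by argo
  qed
  have iAH: "integrable M (\<lambda>\<omega>. (A (x \<omega>))\<^sup>2 * H j k (x \<omega>))" by (rule bound[OF _ AH]) simp
  have iAS: "integrable M (\<lambda>\<omega>. (A (x \<omega>))\<^sup>2 * S k (x \<omega>))" by (rule bound[OF _ AS]) simp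
  have iASS: "integrable M (\<lambda>\<omega>. (A (x \<omega>))\<^sup>2 * S k (x \<omega>) * S j (x \<omega>))" by (rule bound[OF _ ASS]) simp
  have iAB: "integrable M (\<lambda>\<omega>. A (x \<omega>) * B (x \<omega>))" by (rule bound[OF _ AB]) simp
  have iABS: "integrable M (\<lambda>\<omega>. A (x \<omega>) * B (x \<omega>) * S k (x \<omega>))" by (rule bound[OF _ ABS]) simp
  have Q1: "Q1 l u = q u * S l u" for l u
    using q_pos[of u] Q1_off[of u] by (cases "u \<in> U") (auto simp: S_def)
  have Q2: "Q2 j k u = q u * H j k u" for u
    using q_pos[of u] Q2_off[of u] by (cases "u \<in> U") (auto simp: H_def)
  \<comment> \<open>First integration by parts. The condition that replaces boundary terms is
    integrability of A^2 * S k * S j, of degree four and hence within reach of the sixth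
    moments.\<close>
  let ?F1 = "\<lambda>u. A u * A u * Q1 k u"
  let ?F1' = "\<lambda>u. (B u * v j * A u + A u * (B u * v j)) * Q1 k u + A u * A u * Q2 j k u"
  let ?g1 = "\<lambda>u. 2 * v j * (A u * B u * S k u) + (A u)\<^sup>2 * H j k u"
  have F1: "?F1 = (\<lambda>u. q u * ((A u)\<^sup>2 * S k u))" "?F1' = (\<lambda>u. q u * ?g1 u)"
    by (auto simp: Q1 Q2 power2_eq_square algebra_simps)
  have "(\<lambda>u. ?F1 u * Q1 j u / q u) = (\<lambda>u. q u * ((A u)\<^sup>2 * S k u * S j u))"
  proof
    fix u show "?F1 u * Q1 j u / q u = q u * ((A u)\<^sup>2 * S k u * S j u)"
      by (cases "q u = 0") (simp_all add: Q1 power2_eq_square)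
  qed
  then have F1q: "integrable (Rd d) (\<lambda>u. ?F1 u * Q1 j u / q u)"
    using iASS by (simp add: integrable_density_iff)
  have "(\<integral>u. ?F1' u \<partial>Rd d) = 0"
  proof (rule integral_line_derivative_eq_0[OF jk(1) _ _ F1q])
    show "integrable (Rd d) ?F1"
      unfolding F1 using iAS by (simp add: integrable_density_iff)
    have "integrable M (\<lambda>\<omega>. ?g1 (x \<omega>))" using iABS iAH by auto
    then show "integrable (Rd d) ?F1'"
      unfolding F1 by (subst integrable_density_iff) auto
    show "line_deriv j ?F1 (?F1' u) u" if "u \<in> U" for u
      by (intro line_deriv_mult dA Q2_deriv that jk)
  qed (auto simp: off Q1_off Q1_deriv jk)
  moreover have "(\<integral>u. ?F1' u \<partial>Rd d) = (\<integral>\<omega>. ?g1 (x \<omega>) \<partial>M)"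
    unfolding F1 by (rule integral_density) measurable
  ultimately have 1: "2 * v j * (\<integral>\<omega>. A (x \<omega>) * B (x \<omega>) * S k (x \<omega>) \<partial>M)
      + (\<integral>\<omega>. (A (x \<omega>))\<^sup>2 * H j k (x \<omega>) \<partial>M) = 0"
    using iABS iAH by simp
  \<comment> \<open>The second integration by parts removes the score \<open>S k\<close> that the
    first one left over.\<close>
  let ?F2 = "\<lambda>u. A u * B u * q u"
  let ?F2' = "\<lambda>u. (B u * v k * B u + A u * (C u * v k)) * q u + A u * B u * Q1 k u"
  let ?g2 = "\<lambda>u. v k * (B u)\<^sup>2 + v k * (A u * C u) + A u * B u * S k u"
  have F2: "?F2 = (\<lambda>u. q u * (A u * B u))" "?F2' = (\<lambda>u. q u * ?g2 u)"
    by (auto simp: Q1 power2_eq_square algebra_simps)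
  have "(\<lambda>u. ?F2 u * Q1 k u / q u) = (\<lambda>u. q u * (A u * B u * S k u))"
  proof
    fix u show "?F2 u * Q1 k u / q u = q u * (A u * B u * S k u)"
      by (cases "q u = 0") (simp_all add: Q1)
  qed
  then have F2q: "integrable (Rd d) (\<lambda>u. ?F2 u * Q1 k u / q u)"
    using iABS by (simp add: integrable_density_iff)
  have "(\<integral>u. ?F2' u \<partial>Rd d) = 0"
  proof (rule integral_line_derivative_eq_0[OF jk(2) _ _ F2q])
    show "integrable (Rd d) ?F2"
      unfolding F2 using iAB by (simp add: integrable_density_iff)
    have "integrable M (\<lambda>\<omega>. ?g2 (x \<omega>))" using iABS iB iAC by auto
    then show "integrable (Rd d) ?F2'"
      unfolding F2 by (subst integrable_density_iff) auto
    show "line_deriv k ?F2 (?F2' u) u" if "u \<in> U" for u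
      by (intro line_deriv_mult dA dB Q1_deriv that jk)
  qed (auto simp: off Q1_off Q1_deriv jk)
  moreover have "(\<integral>u. ?F2' u \<partial>Rd d) = (\<integral>\<omega>. ?g2 (x \<omega>) \<partial>M)"
    unfolding F2 by (rule integral_density) measurable
  ultimately have 2: "v k * (\<integral>\<omega>. (B (x \<omega>))\<^sup>2 \<partial>M) + v k * (\<integral>\<omega>. A (x \<omega>) * C (x \<omega>) \<partial>M)
      + (\<integral>\<omega>. A (x \<omega>) * B (x \<omega>) * S k (x \<omega>) \<partial>M) = 0"
    using iABS iB iAC by simp
  have "(\<integral>\<omega>. (A (x \<omega>))\<^sup>2 * H j k (x \<omega>) \<partial>M)
      = - 2 * v j * (\<integral>\<omega>. A (x \<omega>) * B (x \<omega>) * S k (x \<omega>) \<partial>M)"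
    using 1 by simp
  also have "(\<integral>\<omega>. A (x \<omega>) * B (x \<omega>) * S k (x \<omega>) \<partial>M)
      = - (v k * (\<integral>\<omega>. (B (x \<omega>))\<^sup>2 \<partial>M) + v k * (\<integral>\<omega>. A (x \<omega>) * C (x \<omega>) \<partial>M))"
    using 2 by simp
  finally show ?thesis by (simp add: algebra_simps)
qed

end

section \<open>The density cut to the interior of its support\<close>

definition zero_off :: "rvec set \<Rightarrow> (rvec \<Rightarrow> real) \<Rightarrow> rvec \<Rightarrow> real" where
  "zero_off U F u = (if u \<in> U then F u else 0)"

lemma support_interior_openin: "openin (Rd_top d) (support_interior d px)"
  by (simp add: support_interior_def)

lemma px_off_support: "u \<in> space (Rd d) \<Longrightarrow> u \<notin> support d px \<Longrightarrow> px u = 0"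
  using closure_of_subset[of "{u \<in> topspace (Rd_top d). px u \<noteq> 0}" "Rd_top d"]
  by (auto simp: support_def topspace_Rd_top space_Rd)

lemma line_open_domain_support: "line_open_domain d (support_interior d px)"
  by unfold_locales (auto intro: sets_Rd_openin eventually_line_openin support_interior_openin)

text \<open>A point off the interior either has a neighbourhood off the support, where the density
  is 0, or lies on the frontier. In the latter case the limit hypothesis governs nearby points of
  the support, and the remaining ones carry density 0.\<close>

lemma regular_density_boundary:
  assumes reg: "regular_density M d x px"
    and w: "w \<in> space (Rd d)" "w \<notin> support_interior d px" and j: "j < d" and e: "0 < e"
  shows "\<forall>\<^sub>F t in at (w j). px (w(j := t)) < e"
proof (cases "w \<in> support d px")
  case False
  have "closedin (Rd_top d) (support d px)"
    by (simp add: support_def)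
  then have "openin (Rd_top d) (topspace (Rd_top d) - support d px)"
    by (intro openin_diff) auto
  then have "\<forall>\<^sub>F t in nhds (w j). w(j := t) \<in> topspace (Rd_top d) - support d px"
    by (rule eventually_line_openin) (use False w j in \<open>auto simp: topspace_Rd_top space_Rd\<close>)
  then have "\<forall>\<^sub>F t in nhds (w j). px (w(j := t)) < e"
    by eventually_elim (use e px_off_support[of _ d px] in \<open>auto simp: topspace_Rd_top space_Rd\<close>)
  then show ?thesis
    by (simp add: eventually_nhds_conv_at)
next
  case True
  have "closedin (Rd_top d) (support d px)"
    by (simp add: support_def)
  then have "w \<in> Rd_top d frontier_of (support d px)"
    using True w by (simp add: frontier_of_def support_interior_def closure_of_closedin)
  then have "(px \<longlongrightarrow> 0) (atin_within (Rd_top d) w (support d px))"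
    using reg by (simp add: regular_density_def)
  then have "\<forall>\<^sub>F u in atin_within (Rd_top d) w (support d px). px u < e"
    using e by (rule order_tendstoD(2))
  then obtain T where T: "openin (Rd_top d) T" "w \<in> T"
      "\<And>u. u \<in> T \<Longrightarrow> u \<in> support d px \<Longrightarrow> u \<noteq> w \<Longrightarrow> px u < e"
    using w by (auto simp: eventually_atin_within topspace_Rd_top space_Rd)
  have "\<forall>\<^sub>F t in at (w j). w(j := t) \<in> T"
    using eventually_line_openin[OF T(1,2) j] by (simp add: eventually_nhds_conv_at)
  then show ?thesis
    using eventually_neq_at_within[of "w j"]
  proof eventually_elim
    case (elim t)
    have "w(j := t) \<noteq> w" using elim(2) by (metis fun_upd_same)
    then show ?case
      using T(3)[OF elim(1)] px_off_support[of "w(j := t)" d px] upd_in_space_Rd[OF w(1) j] e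
      by (cases "w(j := t) \<in> support d px") auto
  qed
qed

text \<open>The frontier of the support may have positive volume, so the density itself has to be
  shown to vanish there. On a line, a point off the interior with density above 1 / (m + 1) is
  isolated among such points because the density tends to 0 around it; these points are thus
  countable on every line, and Tonelli makes the whole set null.\<close>

lemma regular_density_AE:
  assumes reg: "regular_density M d x px" and d: "0 < d"
  shows "AE u in Rd d. px u = zero_off (support_interior d px) px u"
proof -
  let ?U = "support_interior d px"
  define A where "A m = {u \<in> space (Rd d) - ?U. 1 / real (Suc m) < px u}" for m
  have px: "px \<in> borel_measurable (Rd d)"
    by (rule distributed_real_measurable[of _ _ M x]) (use reg in \<open>auto simp: regular_density_def\<close>)
  have U: "?U \<in> sets (Rd d)" by (rule sets_Rd_openin[OF support_interior_openin])
  have A: "A m \<in> sets (Rd d)" for m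
  proof -
    have "A m = {u \<in> space (Rd d). 1 / real (Suc m) < px u} - ?U" by (auto simp: A_def)
    then show ?thesis using px U by simp
  qed
  have "emeasure (Rd d) (A m) = 0" for m
  proof (rule Rd_null_by_lines[OF A d])
    fix u assume u: "u \<in> space (Rd d)"
    have "countable {t. u(0 := t) \<in> A m}"
    proof (rule countable_isolated_points)
      fix t assume "t \<in> {t. u(0 := t) \<in> A m}"
      then have "\<forall>\<^sub>F s in at ((u(0 := t)) 0). px ((u(0 := t))(0 := s)) < 1 / real (Suc m)"
        by (intro regular_density_boundary[OF reg _ _ d]) (auto simp: A_def)
      then show "\<forall>\<^sub>F s in at t. s \<notin> {t. u(0 := t) \<in> A m}"
        by (simp, elim eventually_mono) (auto simp: A_def)
    qed
    then show "emeasure lborel {t. u(0 := t) \<in> A m} = 0"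
      by (rule emeasure_lborel_countable)
  qed
  then have "AE u in Rd d. u \<notin> A m" for m
    using A by (intro AE_not_in) (auto simp: null_sets_def)
  then have "AE u in Rd d. \<forall>m. u \<notin> A m" by (simp add: AE_all_countable)
  then show ?thesis
    using AE_space
  proof eventually_elim
    case (elim u)
    have "px u = 0" if "u \<notin> ?U"
    proof (rule ccontr)
      assume "px u \<noteq> 0"
      then have "0 < px u" using reg elim(2) by (force simp: regular_density_def)
      then obtain m where "1 / real (Suc m) < px u"
        using reals_Archimedean by (auto simp: inverse_eq_divide)
      then show False using elim that by (auto simp: A_def)
    qed
    then show ?case by (simp add: zero_off_def)
  qed
qed

lemma zero_off_measurable:
  "F \<in> borel_measurable (Rd d) \<Longrightarrow> U \<in> sets (Rd d) \<Longrightarrow> zero_off U F \<in> borel_measurable (Rd d)"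
  unfolding zero_off_def[abs_def] by (rule measurable_If_set) auto

lemma regular_density_smooth:
  assumes M: "prob_space M" and reg: "regular_density M d x px" and d: "0 < d"
  defines "U \<equiv> support_interior d px"
  shows "smooth_density d U (zero_off U px) M x (\<lambda>j. zero_off U (partial j px))
    (\<lambda>j k. zero_off U (\<lambda>u. hessian px u j k))"
proof -
  have px: "px \<in> borel_measurable (Rd d)"
    by (rule distributed_real_measurable[of _ _ M x]) (use reg in \<open>auto simp: regular_density_def\<close>)
  have U: "U \<in> sets (Rd d)" unfolding U_def by (rule sets_Rd_openin[OF support_interior_openin])
  interpret line_open_domain d U unfolding U_def by (rule line_open_domain_support)
  interpret prob_space M by (rule M)
  have diff: "\<And>u. u \<in> U \<Longrightarrow> frechet_diff_at d px u"
    "\<And>u j. u \<in> U \<Longrightarrow> j < d \<Longrightarrow> frechet_diff_at d (partial j px) u"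
    using reg by (auto simp: regular_density_def twice_diff_on_def U_def)
  have top: "u \<in> topspace (Rd_top d)" if "u \<in> U" for u
    using U_space[OF that] by (simp add: topspace_Rd_top space_Rd)
  show ?thesis
  proof
    show "zero_off U px \<in> borel_measurable (Rd d)" by (rule zero_off_measurable[OF px U])
    show "0 < zero_off U px u" if "u \<in> U" for u
      using reg that by (simp add: zero_off_def regular_density_def U_def)
    show "\<forall>\<^sub>F t in at (w j). zero_off U px (w(j := t)) < e"
      if "w \<in> space (Rd d)" "w \<notin> U" "j < d" "0 < e" for w j e
      using regular_density_boundary[OF reg that[unfolded U_def]]
      by eventually_elim (use that in \<open>auto simp: zero_off_def\<close>)
    have "distributed M (Rd d) x (\<lambda>u. ennreal (px u))"
      using reg by (simp add: regular_density_def)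
    then show "distributed M (Rd d) x (\<lambda>u. ennreal (zero_off U px u))"
    proof (subst distributed_cong_density[where g = "\<lambda>u. ennreal (px u)"])
      show "AE u in Rd d. ennreal (zero_off U px u) = ennreal (px u)"
        using regular_density_AE[OF reg d] unfolding U_def by eventually_elim simp
    qed (use px zero_off_measurable[OF px U] in simp_all)
    show "line_deriv j (zero_off U px) (zero_off U (partial j px) u) u" if "u \<in> U" "j < d" for u j
      by (rule line_deriv_cong[OF _ that])
         (use line_deriv_partial[OF diff(1) top that(2)] that in \<open>auto simp: zero_off_def\<close>)
    show "line_deriv j (zero_off U (partial k px)) (zero_off U (\<lambda>u. hessian px u j k) u) u"
      if "u \<in> U" "j < d" "k < d" for u j k
      by (rule line_deriv_cong[OF _ that(1,2)])
         (use line_deriv_partial[OF diff(2)[of u k] top that(2)] that in \<open>auto simp: zero_off_def hessian_def\<close>)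
  qed (auto simp: zero_off_def)
qed

lemma (in smooth_density) AE_in_U: "AE \<omega> in M. x \<omega> \<in> U"
proof -
  have "emeasure M (x -` (space (Rd d) - U) \<inter> space M)
      = (\<integral>\<^sup>+u. ennreal (q u) * indicator (space (Rd d) - U) u \<partial>Rd d)"
    using U_sets by (intro distributed_emeasure[OF dist]) auto
  also have "\<dots> = (\<integral>\<^sup>+u. 0 \<partial>Rd d)"
    by (intro nn_integral_cong) (auto simp: q_off indicator_def)
  finally have "emeasure M (x -` (space (Rd d) - U) \<inter> space M) = 0" by simp
  moreover have "x -` (space (Rd d) - U) \<inter> space M \<in> sets M"
    using U_sets by (intro measurable_sets[OF x_measurable]) auto
  ultimately have "AE \<omega> in M. \<omega> \<notin> x -` (space (Rd d) - U) \<inter> space M"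
    by (intro AE_not_in) (auto simp: null_sets_def)
  then show ?thesis
    using AE_space
    by eventually_elim (use measurable_space[OF x_measurable] in auto)
qed

lemma abs_powr_6: "\<bar>z\<bar> powr 6 = (z :: real) ^ 6"
proof (cases "z = 0")
  case False
  then show ?thesis using powr_realpow[of "\<bar>z\<bar>" 6] by simp
qed simp

lemma moment_le_6:
  "moment_le M Z 6 B \<longleftrightarrow> integrable M (\<lambda>\<omega>. Z \<omega> ^ 6) \<and> (\<integral>\<omega>. Z \<omega> ^ 6 \<partial>M) \<le> B"
  by (simp add: moment_le_def abs_powr_6)

text \<open>A Borel version of the second score: off the interior \<open>score2\<close> is built
  from derivatives that need not exist. Since \<open>x\<close> avoids that set almost surely,
  expectations do not change.\<close>

definition score2_in :: "nat \<Rightarrow> (rvec \<Rightarrow> real) \<Rightarrow> nat \<Rightarrow> nat \<Rightarrow> rvec \<Rightarrow> real" where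
  "score2_in d px j k = zero_off (support_interior d px) (\<lambda>u. score2 px u j k)"

lemma line_deriv_dotp: "j < d \<Longrightarrow> line_deriv j (\<lambda>u. dotp d u v) (v j) u"
proof -
  assume j: "j < d"
  have "dotp d (u(j := t)) v = t * v j + (\<Sum>i\<in>{..<d} - {j}. u i * v i)" for t
    unfolding dotp_def using j by (subst sum.remove[of _ j]) auto
  then show ?thesis
    unfolding line_deriv_def by (auto intro!: derivative_eq_intros)
qed

lemma dotp_measurable [measurable]: "(\<lambda>u. dotp d u v) \<in> borel_measurable (Rd d)"
  unfolding dotp_def by (intro borel_measurable_sum borel_measurable_times measurable_Rd_component) auto

lemma norm2_one_nonzero:
  assumes "norm2 d v = 1"
  obtains i where "i < d" "v i \<noteq> 0"
proof -
  have "\<not> (\<forall>i<d. v i = 0)"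
  proof
    assume "\<forall>i<d. v i = 0"
    then have "norm2 d v = 0" by (simp add: norm2_def L2_set_def)
    with assms show False by simp
  qed
  then show ?thesis using that by blast
qed

lemma integral_cong_AE_imp:
  fixes f g :: "'a \<Rightarrow> real"
  assumes "integrable M f" "g \<in> borel_measurable M" "AE \<omega> in M. f \<omega> = g \<omega>"
  shows "integrable M g" "integral\<^sup>L M f = integral\<^sup>L M g"
  using assms by (auto intro: integrable_cong_AE_imp integral_cong_AE)

lemma score2_in_measurable:
  assumes "prob_space M" "regular_density M d x px" "j < d" "k < d"
  shows "score2_in d px j k \<in> borel_measurable (Rd d)"
proof -
  let ?U = "support_interior d px"
  interpret smooth_density d ?U "zero_off ?U px" M x "\<lambda>j. zero_off ?U (partial j px)"
    "\<lambda>j k. zero_off ?U (\<lambda>u. hessian px u j k)"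
    using assms by (intro regular_density_smooth) auto
  \<comment> \<open>Off the interior the quotient is 0 / 0, which is 0.\<close>
  have "score2_in d px j k = (\<lambda>u. zero_off ?U (\<lambda>u. hessian px u j k) u / zero_off ?U px u)"
    by (auto simp: score2_in_def zero_off_def score2_def)
  then show ?thesis
    using Q2_measurable[OF assms(3,4)] q_measurable by simp
qed

text \<open>The moment hypotheses concern the original functions; they pass to the versions cut off
  outside the interior because \<open>x\<close> lies inside almost surely.\<close>

lemma second_order_stein_index:
  assumes M: "prob_space M" and reg: "regular_density M d x px"
    and h: "h \<in> borel_measurable borel"
    and diff: "twice_diff_on_real h ((\<lambda>u. dotp d u v) ` support_interior d px)"
    and v: "norm2 d v = 1"
    and mh: "moment_le M (\<lambda>\<omega>. h (dotp d (x \<omega>) v)) 6 B"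
    and mS: "\<And>j. j < d \<Longrightarrow> moment_le M (\<lambda>\<omega>. score1 px (x \<omega>) j) 6 B"
    and mH: "\<And>j k. j < d \<Longrightarrow> k < d \<Longrightarrow> moment_le M (\<lambda>\<omega>. score2 px (x \<omega>) j k) 6 B"
    and curv: "curvature_exists M d x h v"
    and jk: "j < d" "k < d"
  shows "(\<integral>\<omega>. (h (dotp d (x \<omega>) v))\<^sup>2 * score2_in d px j k (x \<omega>) \<partial>M)
    = 2 * (v j * v k) * curvature M d x h v"
proof -
  define U where "U = support_interior d px"
  define q where "q = zero_off U px"
  define Q1 where "Q1 j = zero_off U (partial j px)" for j
  define Q2 where "Q2 j k = zero_off U (\<lambda>u. hessian px u j k)" for j k
  obtain i where i: "i < d" "v i \<noteq> 0" using norm2_one_nonzero[OF v] by blast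
  interpret smooth_density d U q M x Q1 Q2
    unfolding U_def q_def Q1_def Q2_def by (rule regular_density_smooth[OF M reg]) (use i in simp)
  define A where "A = zero_off U (\<lambda>u. h (dotp d u v))"
  define B where "B = zero_off U (\<lambda>u. deriv h (dotp d u v))"
  define C where "C = zero_off U (\<lambda>u. deriv (deriv h) (dotp d u v))"
  have h_deriv: "(h has_real_derivative deriv h (dotp d u v)) (at (dotp d u v))"
    "(deriv h has_real_derivative deriv (deriv h) (dotp d u v)) (at (dotp d u v))" if "u \<in> U" for u
    using diff that unfolding twice_diff_on_real_def U_def
    by (auto simp: DERIV_deriv_iff_real_differentiable)
  have dA: "line_deriv j A (B u * v j) u" if "u \<in> U" "j < d" for u j
    by (rule line_deriv_cong[OF _ that])
       (use line_deriv_compose[OF h_deriv(1)[OF that(1)] line_deriv_dotp[OF that(2)]] that(1)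
         in \<open>auto simp: A_def B_def zero_off_def\<close>)
  have dB: "line_deriv j B (C u * v j) u" if "u \<in> U" "j < d" for u j
    by (rule line_deriv_cong[OF _ that])
       (use line_deriv_compose[OF h_deriv(2)[OF that(1)] line_deriv_dotp[OF that(2)]] that(1)
         in \<open>auto simp: C_def B_def zero_off_def\<close>)
  have off: "A u = 0 \<and> B u = 0 \<and> C u = 0" if "u \<notin> U" for u
    using that by (simp add: A_def B_def C_def zero_off_def)
  have mA [measurable]: "A \<in> borel_measurable (Rd d)"
    unfolding A_def by (intro zero_off_measurable measurable_compose[OF _ h] U_sets) measurable
  have "(\<lambda>u. B u * v i) \<in> borel_measurable (Rd d)"
    by (rule line_deriv_measurable[OF i(1) mA dA]) (use i off in auto)
  then have "(\<lambda>u. B u * v i / v i) \<in> borel_measurable (Rd d)" by measurable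
  then have mB [measurable]: "B \<in> borel_measurable (Rd d)" using i by simp
  have "(\<lambda>u. C u * v i) \<in> borel_measurable (Rd d)"
    by (rule line_deriv_measurable[OF i(1) mB dB]) (use i off in auto)
  then have "(\<lambda>u. C u * v i / v i) \<in> borel_measurable (Rd d)" by measurable
  then have mC [measurable]: "C \<in> borel_measurable (Rd d)" using i by simp
  have [measurable]: "\<And>j. j < d \<Longrightarrow> Q1 j \<in> borel_measurable (Rd d)"
    "\<And>j k. j < d \<Longrightarrow> k < d \<Longrightarrow> Q2 j k \<in> borel_measurable (Rd d)"
    by (rule Q1_measurable Q2_measurable; assumption)+
  note [measurable] = q_measurable
  have AE_eq: "AE \<omega> in M. A (x \<omega>) = h (dotp d (x \<omega>) v)"
      "AE \<omega> in M. B (x \<omega>) = deriv h (dotp d (x \<omega>) v)"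
      "AE \<omega> in M. C (x \<omega>) = deriv (deriv h) (dotp d (x \<omega>) v)"
    using AE_in_U by (eventually_elim, simp add: A_def B_def C_def zero_off_def)+
  have iA: "integrable M (\<lambda>\<omega>. A (x \<omega>) ^ 6)"
  proof (rule integral_cong_AE_imp(1)[where f = "\<lambda>\<omega>. h (dotp d (x \<omega>) v) ^ 6"])
    show "AE \<omega> in M. h (dotp d (x \<omega>) v) ^ 6 = A (x \<omega>) ^ 6"
      using AE_eq(1) by eventually_elim simp
  qed (use mh in \<open>simp_all add: moment_le_6\<close>)
  have "AE \<omega> in M. (deriv h (dotp d (x \<omega>) v))\<^sup>2 = (B (x \<omega>))\<^sup>2"
    using AE_eq(2) by eventually_elim simp
  from integral_cong_AE_imp[OF _ _ this]
  have iB: "integrable M (\<lambda>\<omega>. (B (x \<omega>))\<^sup>2)"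
      "(\<integral>\<omega>. (deriv h (dotp d (x \<omega>) v))\<^sup>2 \<partial>M) = (\<integral>\<omega>. (B (x \<omega>))\<^sup>2 \<partial>M)"
    using curv by (simp_all add: curvature_exists_def)
  have "AE \<omega> in M. h (dotp d (x \<omega>) v) * deriv (deriv h) (dotp d (x \<omega>) v) = A (x \<omega>) * C (x \<omega>)"
    using AE_eq(1,3) by eventually_elim simp
  from integral_cong_AE_imp[OF _ _ this]
  have iAC: "integrable M (\<lambda>\<omega>. A (x \<omega>) * C (x \<omega>))"
      "(\<integral>\<omega>. h (dotp d (x \<omega>) v) * deriv (deriv h) (dotp d (x \<omega>) v) \<partial>M) = (\<integral>\<omega>. A (x \<omega>) * C (x \<omega>) \<partial>M)"
    using curv by (simp_all add: curvature_exists_def)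
  \<comment> \<open>The sign in the definition of the first score disappears in the sixth power
    below.\<close>
  have score1: "score1 px u j = - (Q1 j u / q u)" if "u \<in> U" "j < d" for u j
  proof -
    have "line_deriv j (\<lambda>u. ln (q u)) (1 / q u * Q1 j u) u"
      by (intro line_deriv_compose[OF DERIV_ln_divide] q_pos Q1_deriv that)
    then have "line_deriv j (\<lambda>u. ln (px u)) (1 / q u * Q1 j u) u"
      by (rule line_deriv_cong[OF _ that]) (simp add: q_def zero_off_def)
    then have "partial j (\<lambda>u. ln (px u)) u = 1 / q u * Q1 j u"
      unfolding partial_def line_deriv_def by (rule DERIV_imp_deriv)
    then show ?thesis by (simp add: score1_def)
  qed
  have iS: "integrable M (\<lambda>\<omega>. (Q1 j (x \<omega>) / q (x \<omega>)) ^ 6)" if "j < d" for j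
  proof (rule integral_cong_AE_imp(1)[where f = "\<lambda>\<omega>. score1 px (x \<omega>) j ^ 6"])
    show "AE \<omega> in M. score1 px (x \<omega>) j ^ 6 = (Q1 j (x \<omega>) / q (x \<omega>)) ^ 6"
      using AE_in_U by eventually_elim (simp add: score1 that)
  qed (use mS[OF that] that in \<open>auto simp: moment_le_6\<close>)
  have score2: "score2_in d px j k u = Q2 j k u / q u" for u
    by (simp add: score2_in_def U_def[symmetric] zero_off_def score2_def Q2_def q_def)
  have iH: "integrable M (\<lambda>\<omega>. (Q2 j k (x \<omega>) / q (x \<omega>)) ^ 6)"
  proof (rule integral_cong_AE_imp(1)[where f = "\<lambda>\<omega>. score2 px (x \<omega>) j k ^ 6"])
    show "AE \<omega> in M. score2 px (x \<omega>) j k ^ 6 = (Q2 j k (x \<omega>) / q (x \<omega>)) ^ 6"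
      using AE_in_U by eventually_elim (simp add: score2_def zero_off_def Q2_def q_def)
  qed (use mH[OF jk] jk in \<open>auto simp: moment_le_6\<close>)
  have "(\<integral>\<omega>. (h (dotp d (x \<omega>) v))\<^sup>2 * score2_in d px j k (x \<omega>) \<partial>M)
      = (\<integral>\<omega>. (A (x \<omega>))\<^sup>2 * (Q2 j k (x \<omega>) / q (x \<omega>)) \<partial>M)"
    by (intro Bochner_Integration.integral_cong refl)
       (auto simp: score2 A_def zero_off_def Q2_def)
  also have "\<dots> = 2 * (v j * v k) * ((\<integral>\<omega>. (B (x \<omega>))\<^sup>2 \<partial>M) + (\<integral>\<omega>. A (x \<omega>) * C (x \<omega>) \<partial>M))"
    by (rule second_order_stein[OF jk i mA off dA dB iA iB(1) iAC(1) iS iH])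
  also have "\<dots> = 2 * (v j * v k) * curvature M d x h v"
    by (simp add: curvature_def iB(2) iAC(2))
  finally show ?thesis .
qed

subsection \<open>A tail bound for bounded independent variables\<close>

lemma exp_le_quadratic:
  fixes x :: real
  assumes "\<bar>x\<bar> \<le> 1"
  shows "exp x \<le> 1 + x + x\<^sup>2"
proof (cases "0 \<le> x")
  case True
  then show ?thesis using assms by (intro exp_bound) auto
next
  case False
  define y where "y = - x"
  have y: "0 \<le> y" "y \<le> 1" using False assms by (auto simp: y_def)
  have "1 + y + y\<^sup>2 / 2 \<le> exp y" using y by (intro exp_lower_Taylor_quadratic)
  \<comment> \<open>For a negative argument the claim amounts to 1 <= (1 - y + y^2) * exp y, and
    bounding exp y below by its quadratic Taylor polynomial already suffices.\<close>
  have "1 \<le> (1 - y + y\<^sup>2) * (1 + y + y\<^sup>2 / 2)"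
  proof -
    have "(1 - y + y\<^sup>2) * (1 + y + y\<^sup>2 / 2) = 1 + (y\<^sup>2 + y ^ 3 + y ^ 4) / 2"
      by (simp add: power2_eq_square power3_eq_cube power4_eq_xxxx field_simps)
    then show ?thesis using y by simp
  qed
  also have "\<dots> \<le> (1 - y + y\<^sup>2) * exp y"
    using \<open>1 + y + y\<^sup>2 / 2 \<le> exp y\<close> y by (intro mult_left_mono) auto
  finally have "exp (- y) \<le> 1 - y + y\<^sup>2"
    by (simp add: exp_minus field_simps)
  then show ?thesis by (simp add: y_def)
qed

context prob_space
begin

text \<open>Chernoff's bound at the parameter 1 / b, the largest for which the quadratic bound on
  exp applies to Z / b. For the truncation level chosen later both terms of the exponent are
  multiples of L, so this parameter is good enough without optimisation. The mean is carried along
  in the linear term, which is why \<open>V\<close> may be a raw second moment.\<close>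

lemma bounded_mean_upper_tail:
  fixes Z :: "nat \<Rightarrow> 'a \<Rightarrow> real"
  assumes n: "1 \<le> n" and b: "0 < b"
    and indep: "indep_vars (\<lambda>_. borel) Z {..<n}"
    and bound: "\<And>i \<omega>. i < n \<Longrightarrow> \<bar>Z i \<omega>\<bar> \<le> b"
    and mean: "\<And>i. i < n \<Longrightarrow> expectation (Z i) = m"
    and var: "\<And>i. i < n \<Longrightarrow> expectation (\<lambda>\<omega>. (Z i \<omega>)\<^sup>2) \<le> V"
  shows "prob {\<omega> \<in> space M. 1 / real n * (\<Sum>i<n. Z i \<omega>) - m \<ge> t} \<le> exp (real n * (V / b\<^sup>2 - t / b))"
proof -
  have Z: "random_variable borel (Z i)" if "i < n" for i
    using indep that by (auto simp: indep_vars_def)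
  have iZ: "integrable M (Z i)" "integrable M (\<lambda>\<omega>. (Z i \<omega>)\<^sup>2)" if "i < n" for i
  proof -
    note [measurable] = Z[OF that]
    show "integrable M (Z i)"
      by (rule integrable_const_bound[where B = b]) (use bound[OF that] in auto)
    have "(Z i \<omega>)\<^sup>2 \<le> b\<^sup>2" for \<omega>
      using bound[OF that] b by (intro abs_le_square_iff[THEN iffD1]) (simp add: abs_of_pos)
    then show "integrable M (\<lambda>\<omega>. (Z i \<omega>)\<^sup>2)"
      by (intro integrable_const_bound[where B = "b\<^sup>2"]) auto
  qed
  have le1: "\<bar>Z i \<omega> / b\<bar> \<le> 1" if "i < n" for i \<omega>
    using bound[OF that] b by simp
  have iexp: "integrable M (\<lambda>\<omega>. exp (Z i \<omega> / b))" if "i < n" for i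
  proof -
    note [measurable] = Z[OF that]
    show ?thesis
    proof (rule integrable_const_bound[where B = "exp 1"])
      show "AE \<omega> in M. norm (exp (Z i \<omega> / b)) \<le> exp 1"
        using abs_le_D1[OF le1[OF that]] by (intro AE_I2) simp
    qed simp
  qed
  have mgf: "expectation (\<lambda>\<omega>. exp (Z i \<omega> / b)) \<le> exp (m / b + V / b\<^sup>2)" if i: "i < n" for i
  proof -
    have "expectation (\<lambda>\<omega>. exp (Z i \<omega> / b)) \<le> expectation (\<lambda>\<omega>. 1 + Z i \<omega> / b + (Z i \<omega>)\<^sup>2 / b\<^sup>2)"
      using exp_le_quadratic[OF le1[OF i]] iexp[OF i] iZ[OF i]
      by (intro integral_mono) (auto simp: power_divide)
    also have "\<dots> = 1 + m / b + expectation (\<lambda>\<omega>. (Z i \<omega>)\<^sup>2) / b\<^sup>2"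
      using iZ[OF i] mean[OF i] by (simp add: prob_space)
    also have "\<dots> \<le> 1 + (m / b + V / b\<^sup>2)"
      using var[OF i] b by (simp add: divide_right_mono)
    also have "\<dots> \<le> exp (m / b + V / b\<^sup>2)" by (rule exp_ge_add_one_self)
    finally show ?thesis .
  qed
  have indep': "indep_vars (\<lambda>_. borel) (\<lambda>i \<omega>. exp (Z i \<omega> / b)) {..<n}"
    by (rule indep_vars_compose2[OF indep]) auto
  have exp_sum: "exp (1 / b * (\<Sum>i<n. Z i \<omega>)) = (\<Prod>i<n. exp (Z i \<omega> / b))" for \<omega>
    by (simp add: exp_sum sum_divide_distrib[symmetric] flip: exp_sum)
  have int: "integrable M (\<lambda>\<omega>. \<Prod>i<n. exp (Z i \<omega> / b))"
    by (rule indep_vars_integrable[OF _ indep']) (use iexp in auto)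
  have "expectation (\<lambda>\<omega>. \<Prod>i<n. exp (Z i \<omega> / b)) = (\<Prod>i<n. expectation (\<lambda>\<omega>. exp (Z i \<omega> / b)))"
    by (rule indep_vars_lebesgue_integral[OF _ indep']) (use iexp in auto)
  also have "\<dots> \<le> (\<Prod>i<n. exp (m / b + V / b\<^sup>2))"
    by (intro prod_mono) (use mgf in auto)
  also have "\<dots> = exp (real n * (m / b + V / b\<^sup>2))"
    by (simp add: exp_of_nat_mult)
  finally have E: "expectation (\<lambda>\<omega>. \<Prod>i<n. exp (Z i \<omega> / b)) \<le> exp (real n * (m / b + V / b\<^sup>2))" .
  have "{\<omega> \<in> space M. 1 / real n * (\<Sum>i<n. Z i \<omega>) - m \<ge> t}
      = {\<omega> \<in> space M. (\<Sum>i<n. Z i \<omega>) \<ge> real n * (m + t)}"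
    using n by (auto simp: field_simps)
  also have "prob \<dots> \<le> exp (- (1 / b) * (real n * (m + t))) * (\<integral>\<omega>\<in>space M. exp (1 / b * (\<Sum>i<n. Z i \<omega>)) \<partial>M)"
  proof (rule Chernoff_ineq_ge)
    show "set_integrable M (space M) (\<lambda>\<omega>. exp (1 / b * (\<Sum>i<n. Z i \<omega>)))"
      unfolding set_integrable_def exp_sum by (intro integrable_mult_indicator int) simp
  qed (use b in auto)
  also have "(\<integral>\<omega>\<in>space M. exp (1 / b * (\<Sum>i<n. Z i \<omega>)) \<partial>M) = expectation (\<lambda>\<omega>. \<Prod>i<n. exp (Z i \<omega> / b))"
    unfolding set_lebesgue_integral_def exp_sum by (intro Bochner_Integration.integral_cong) auto
  also have "exp (- (1 / b) * (real n * (m + t))) * expectation (\<lambda>\<omega>. \<Prod>i<n. exp (Z i \<omega> / b))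
      \<le> exp (- (1 / b) * (real n * (m + t))) * exp (real n * (m / b + V / b\<^sup>2))"
    using E by (intro mult_left_mono) auto
  also have "\<dots> = exp (real n * (V / b\<^sup>2 - t / b))"
    unfolding exp_add[symmetric] by (rule arg_cong[where f = exp]) (simp add: algebra_simps add_divide_distrib)
  finally show ?thesis .
qed

lemma bounded_mean_tail:
  fixes Z :: "nat \<Rightarrow> 'a \<Rightarrow> real"
  assumes n: "1 \<le> n" and b: "0 < b"
    and indep: "indep_vars (\<lambda>_. borel) Z {..<n}"
    and bound: "\<And>i \<omega>. i < n \<Longrightarrow> \<bar>Z i \<omega>\<bar> \<le> b"
    and mean: "\<And>i. i < n \<Longrightarrow> expectation (Z i) = m"
    and var: "\<And>i. i < n \<Longrightarrow> expectation (\<lambda>\<omega>. (Z i \<omega>)\<^sup>2) \<le> V"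
  shows "prob {\<omega> \<in> space M. \<bar>1 / real n * (\<Sum>i<n. Z i \<omega>) - m\<bar> \<ge> t}
    \<le> 2 * exp (real n * (V / b\<^sup>2 - t / b))"
proof -
  have [measurable]: "random_variable borel (Z i)" if "i < n" for i
    using indep that by (auto simp: indep_vars_def)
  let ?S = "\<lambda>\<omega>. 1 / real n * (\<Sum>i<n. Z i \<omega>) - m"
  have [measurable]: "random_variable borel ?S" by measurable
  have "prob {\<omega> \<in> space M. 1 / real n * (\<Sum>i<n. - Z i \<omega>) - (- m) \<ge> t} \<le> exp (real n * (V / b\<^sup>2 - t / b))"
  proof (rule bounded_mean_upper_tail[OF n b])
    show "indep_vars (\<lambda>_. borel) (\<lambda>i \<omega>. - Z i \<omega>) {..<n}"
      by (rule indep_vars_compose2[OF indep]) auto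
  qed (use bound mean var in auto)
  then have 1: "prob {\<omega> \<in> space M. - ?S \<omega> \<ge> t} \<le> exp (real n * (V / b\<^sup>2 - t / b))"
    by (simp add: sum_negf)
  have "{\<omega> \<in> space M. \<bar>?S \<omega>\<bar> \<ge> t} \<subseteq> {\<omega> \<in> space M. ?S \<omega> \<ge> t} \<union> {\<omega> \<in> space M. - ?S \<omega> \<ge> t}"
    by auto
  then have "prob {\<omega> \<in> space M. \<bar>?S \<omega>\<bar> \<ge> t} \<le> prob ({\<omega> \<in> space M. ?S \<omega> \<ge> t} \<union> {\<omega> \<in> space M. - ?S \<omega> \<ge> t})"
    by (rule finite_measure_mono) measurable
  also have "\<dots> \<le> prob {\<omega> \<in> space M. ?S \<omega> \<ge> t} + prob {\<omega> \<in> space M. - ?S \<omega> \<ge> t}"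
    by (rule measure_Un_le) measurable
  also have "\<dots> \<le> 2 * exp (real n * (V / b\<^sup>2 - t / b))"
    using 1 bounded_mean_upper_tail[OF n b indep bound mean var, of t] by simp
  finally show ?thesis .
qed

end

subsection \<open>The penalised program over the Fantope\<close>

abbreviation msum :: "nat \<Rightarrow> (nat \<Rightarrow> nat \<Rightarrow> real) \<Rightarrow> real" where
  "msum d W \<equiv> (\<Sum>j<d. \<Sum>k<d. W j k)"

lemma msum_prod: "msum d (\<lambda>j k. a j * b k) = (\<Sum>j<d. a j) * (\<Sum>k<d. b k)"
  by (simp add: sum_product)

lemma norm2_squared: "(norm2 d v)\<^sup>2 = (\<Sum>j<d. (v j)\<^sup>2)"
  by (simp add: norm2_def L2_set_def sum_nonneg)

lemma norm2_eq_1: "norm2 d v = 1 \<Longrightarrow> (\<Sum>j<d. (v j)\<^sup>2) = 1"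
  using norm2_squared[of d v] by simp

lemma norm2_nonneg: "0 \<le> norm2 d v"
  by (simp add: norm2_def)

lemma quad_form_two_coordinates:
  assumes "j < d" "k < d" "j \<noteq> k"
  shows "quad_form d V (\<lambda>i. a * of_bool (i = j) + b * of_bool (i = k))
    = a\<^sup>2 * V j j + a * b * (V j k + V k j) + b\<^sup>2 * V k k"
proof -
  let ?e = "\<lambda>j i. of_bool (i = j) :: real"
  have 1: "(\<Sum>m<d. W m * ?e j m) = W j" if "j < d" for W :: "nat \<Rightarrow> real" and j
  proof -
    have "(\<Sum>m<d. W m * ?e j m) = (\<Sum>m<d. if m = j then W m else 0)"
      by (intro sum.cong) auto
    then show ?thesis using that by (simp add: sum.delta)
  qed
  have "quad_form d V (\<lambda>i. a * ?e j i + b * ?e k i)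
      = (\<Sum>i<d. (a * ?e j i + b * ?e k i) * (\<Sum>m<d. V i m * (a * ?e j m + b * ?e k m)))"
    by (simp add: quad_form_def sum_distrib_left mult.assoc)
  also have "\<dots> = (\<Sum>i<d. (a * ?e j i + b * ?e k i) * (a * V i j + b * V i k))"
  proof -
    have "(\<Sum>m<d. V i m * (a * ?e j m + b * ?e k m)) = a * V i j + b * V i k" for i
    proof -
      have "(\<Sum>m<d. V i m * (a * ?e j m + b * ?e k m))
          = (\<Sum>m<d. (a * V i m) * ?e j m) + (\<Sum>m<d. (b * V i m) * ?e k m)"
        by (simp add: algebra_simps sum.distrib)
      then show ?thesis using 1[OF assms(1), of "\<lambda>m. a * V i m"] 1[OF assms(2), of "\<lambda>m. b * V i m"]
        by simp
    qed
    then show ?thesis by simp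
  qed
  also have "\<dots> = (\<Sum>i<d. (a * (a * V i j + b * V i k)) * ?e j i)
      + (\<Sum>i<d. (b * (a * V i j + b * V i k)) * ?e k i)"
    by (simp add: algebra_simps sum.distrib)
  also have "\<dots> = a * (a * V j j + b * V j k) + b * (a * V k j + b * V k k)"
    using 1[OF assms(1), of "\<lambda>i. a * (a * V i j + b * V i k)"]
      1[OF assms(2), of "\<lambda>i. b * (a * V i j + b * V i k)"] by simp
  finally show ?thesis by (simp add: power2_eq_square algebra_simps)
qed

text \<open>Nonnegativity of the 2 by 2 principal minors, obtained by testing the quadratic form on
  combinations of two basis vectors.\<close>

lemma fantope_entry_bound:
  assumes V: "fantope d r V" and jk: "j < d" "k < d"
  shows "(V j k)\<^sup>2 \<le> V j j * V k k"
proof (cases "j = k")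
  case False
  have sym: "V k j = V j k" using V jk by (simp add: fantope_def)
  have nn: "0 \<le> a\<^sup>2 * V j j + 2 * a * b * V j k + b\<^sup>2 * V k k" for a b
  proof -
    have "0 \<le> quad_form d V (\<lambda>i. a * of_bool (i = j) + b * of_bool (i = k))"
      using V by (simp add: fantope_def)
    then show ?thesis
      using quad_form_two_coordinates[OF jk False, of V a b] by (simp add: sym algebra_simps)
  qed
  have "0 \<le> V j j" "0 \<le> V k k" using nn[of 1 0] nn[of 0 1] by auto
  show ?thesis
  proof (cases "V k k = 0")
    case True
    have "V j k = 0"
    proof (rule ccontr)
      assume "V j k \<noteq> 0"
      \<comment> \<open>With these coefficients the form takes the value -1.\<close>
      then show False
        using nn[of 1 "- (V j j + 1) / (2 * V j k)"] True by (simp add: field_simps)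
    qed
    then show ?thesis using True by simp
  next
    case False
    have "0 \<le> V k k * (V j j * V k k - (V j k)\<^sup>2)"
      using nn[of "V k k" "- V j k"] by (simp add: power2_eq_square algebra_simps)
    then show ?thesis
      using False \<open>0 \<le> V k k\<close> by (simp add: zero_le_mult_iff)
  qed
qed (simp add: power2_eq_square)

text \<open>Summing the minor inequalities bounds the squared Frobenius norm by the squared trace,
  without eigenvalues.\<close>

lemma fantope_frobenius:
  assumes "fantope d 1 V"
  shows "msum d (\<lambda>j k. (V j k)\<^sup>2) \<le> 1"
proof -
  have "msum d (\<lambda>j k. (V j k)\<^sup>2) \<le> msum d (\<lambda>j k. V j j * V k k)"
    by (intro sum_mono fantope_entry_bound[OF assms]) auto
  also have "\<dots> = (\<Sum>j<d. V j j) * (\<Sum>k<d. V k k)" by (rule msum_prod)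
  also have "\<dots> = 1" using assms by (simp add: fantope_def)
  finally show ?thesis .
qed

lemma quad_form_outer:
  "quad_form d (\<lambda>j k. a j * a k) v = (dotp d a v)\<^sup>2"
proof -
  have "quad_form d (\<lambda>j k. a j * a k) v = msum d (\<lambda>j k. (a j * v j) * (a k * v k))"
    unfolding quad_form_def by (intro sum.cong refl) (simp add: algebra_simps)
  then show ?thesis by (simp only: msum_prod dotp_def power2_eq_square)
qed

lemma dotp_squared_le: "(dotp d a v)\<^sup>2 \<le> (\<Sum>j<d. (a j)\<^sup>2) * (\<Sum>j<d. (v j)\<^sup>2)"
  unfolding dotp_def by (rule Cauchy_Schwarz_ineq_sum)

text \<open>It makes the target matrix a feasible competitor in the program.\<close>

lemma fantope_outer:
  assumes "norm2 d a = 1"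
  shows "fantope d 1 (\<lambda>j k. a j * a k)"
  unfolding fantope_def
proof (intro conjI allI impI)
  note a = norm2_eq_1[OF assms]
  show "quad_form d (\<lambda>j k. a j * a k) v \<le> dotp d v v" for v
    using dotp_squared_le[of d a v] by (simp add: quad_form_outer a) (simp add: dotp_def power2_eq_square)
  show "(\<Sum>j<d. a j * a j) = real 1" using a by (simp add: power2_eq_square)
qed (simp_all add: quad_form_outer)

lemma msum_Cauchy_Schwarz:
  "(msum d (\<lambda>j k. X j k * Y j k))\<^sup>2 \<le> msum d (\<lambda>j k. (X j k)\<^sup>2) * msum d (\<lambda>j k. (Y j k)\<^sup>2)"
proof -
  have *: "msum d W = (\<Sum>p\<in>{..<d} \<times> {..<d}. W (fst p) (snd p))" for W
    by (simp add: sum.cartesian_product case_prod_beta)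
  show ?thesis unfolding * by (rule Cauchy_Schwarz_ineq_sum)
qed

lemma msum_outer_inner: "msum d (\<lambda>j k. V j k * (a j * a k)) = quad_form d V a"
  unfolding quad_form_def by (intro sum.cong refl) (simp add: algebra_simps)

text \<open>Optimality of V is compared with a a^T. With D = V - a a^T, the noise costs at most l |D
  j k| per entry. Off the support of a a^T the penalty on V pays for this exactly; on the support,
  which has at most s^2 entries, the cost is 2 l |D j k|. As V has Frobenius norm at most 1, the
  squared norm of D is at most 2 (1 - a^T V a), so the linear signal term controls the square of the
  error, and one factor cancels.\<close>

lemma is_T_frobenius_error:
  assumes T: "is_T d l A 1 V" and a: "norm2 d a = 1" and s: "norm0 d a \<le> s"
    and m: "0 < m" and l: "0 \<le> l"
    and A: "\<And>j k. j < d \<Longrightarrow> k < d \<Longrightarrow> \<bar>A j k - 2 * m * (a j * a k)\<bar> \<le> l"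
  shows "sqrt (msum d (\<lambda>j k. (V j k - a j * a k)\<^sup>2)) \<le> 2 * real s * l / m"
proof -
  define D where "D j k = V j k - a j * a k" for j k
  define P where "P = {j. j < d \<and> a j \<noteq> 0}"
  define F where "F = sqrt (msum d (\<lambda>j k. (D j k)\<^sup>2))"
  have F2: "F\<^sup>2 = msum d (\<lambda>j k. (D j k)\<^sup>2)" and F0: "0 \<le> F"
    unfolding F_def by (auto intro!: sum_nonneg)
  have V: "fantope d 1 V" using T by (simp add: is_T_def is_arg_max_def)
  have opt: "msum d (\<lambda>j k. a j * a k * A j k) - l * msum d (\<lambda>j k. \<bar>a j * a k\<bar>)
      \<le> msum d (\<lambda>j k. V j k * A j k) - l * msum d (\<lambda>j k. \<bar>V j k\<bar>)"
    using T fantope_outer[OF a] by (auto simp: is_T_def is_arg_max_def not_less)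
  have entry: "V j k * A j k - l * \<bar>V j k\<bar> - (a j * a k * A j k - l * \<bar>a j * a k\<bar>)
      \<le> 2 * m * (D j k * (a j * a k)) + 2 * l * (if j \<in> P \<and> k \<in> P then \<bar>D j k\<bar> else 0)"
    if jk: "j < d" "k < d" for j k
  proof -
    have "D j k * (A j k - 2 * m * (a j * a k)) \<le> \<bar>D j k\<bar> * l"
    proof -
      have "\<bar>D j k * (A j k - 2 * m * (a j * a k))\<bar> \<le> \<bar>D j k\<bar> * l"
        unfolding abs_mult[of "D j k"] using A[OF jk] by (rule mult_left_mono) simp
      then show ?thesis by linarith
    qed
    moreover have "V j k * A j k - a j * a k * A j k
        = 2 * m * (D j k * (a j * a k)) + D j k * (A j k - 2 * m * (a j * a k))"
      by (simp add: D_def algebra_simps)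
    moreover have "l * \<bar>D j k\<bar> - l * \<bar>V j k\<bar> + l * \<bar>a j * a k\<bar>
        \<le> 2 * l * (if j \<in> P \<and> k \<in> P then \<bar>D j k\<bar> else 0)"
    proof (cases "j \<in> P \<and> k \<in> P")
      case True
      have "\<bar>a j * a k\<bar> \<le> \<bar>D j k\<bar> + \<bar>V j k\<bar>" by (simp add: D_def)
      then have "l * \<bar>a j * a k\<bar> \<le> l * (\<bar>D j k\<bar> + \<bar>V j k\<bar>)" using l by (rule mult_left_mono)
      then have "l * \<bar>a j * a k\<bar> \<le> l * \<bar>D j k\<bar> + l * \<bar>V j k\<bar>" by (simp only: distrib_left)
      then show ?thesis using True by simp
    next
      case False
      then have "a j * a k = 0" using jk by (auto simp: P_def)
      then show ?thesis unfolding D_def using False by (simp only: if_False) simp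
    qed
    ultimately show ?thesis by (simp only: mult.commute[of _ l])
  qed
  have "0 \<le> msum d (\<lambda>j k. V j k * A j k - l * \<bar>V j k\<bar> - (a j * a k * A j k - l * \<bar>a j * a k\<bar>))"
    using opt by (simp add: sum_subtractf sum_distrib_left)
  also have "\<dots> \<le> msum d (\<lambda>j k. 2 * m * (D j k * (a j * a k)) + 2 * l * (if j \<in> P \<and> k \<in> P then \<bar>D j k\<bar> else 0))"
    by (intro sum_mono entry) auto
  also have "\<dots> = 2 * m * msum d (\<lambda>j k. D j k * (a j * a k))
      + 2 * l * msum d (\<lambda>j k. if j \<in> P \<and> k \<in> P then \<bar>D j k\<bar> else 0)"
    by (simp add: sum.distrib sum_distrib_left)
  finally have basic: "- m * msum d (\<lambda>j k. D j k * (a j * a k))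
      \<le> l * msum d (\<lambda>j k. if j \<in> P \<and> k \<in> P then \<bar>D j k\<bar> else 0)"
    by (simp add: algebra_simps)
  have unit: "msum d (\<lambda>j k. (a j * a k)\<^sup>2) = 1"
    using norm2_eq_1[OF a] msum_prod[where d = d and a = "\<lambda>j. (a j)\<^sup>2" and b = "\<lambda>j. (a j)\<^sup>2"] by (simp add: power_mult_distrib)
  have inner: "msum d (\<lambda>j k. D j k * (a j * a k)) = quad_form d V a - 1"
  proof -
    have "msum d (\<lambda>j k. D j k * (a j * a k))
        = msum d (\<lambda>j k. V j k * (a j * a k)) - msum d (\<lambda>j k. (a j * a k)\<^sup>2)"
      by (simp add: D_def algebra_simps sum_subtractf power2_eq_square)
    then show ?thesis by (simp add: unit msum_outer_inner)
  qed
  have "F\<^sup>2 = msum d (\<lambda>j k. (V j k)\<^sup>2) - 2 * msum d (\<lambda>j k. V j k * (a j * a k)) + msum d (\<lambda>j k. (a j * a k)\<^sup>2)"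
    unfolding F2 D_def
    by (simp add: power2_diff sum.distrib sum_subtractf sum_distrib_left mult.assoc)
  also have "\<dots> \<le> 2 * (1 - quad_form d V a)"
    using fantope_frobenius[OF V] by (simp add: unit msum_outer_inner)
  finally have curv: "F\<^sup>2 \<le> 2 * (1 - quad_form d V a)" .
  \<comment> \<open>The sum of absolute values is the inner product of \<open>D\<close> with its
    sign pattern on the support. Cauchy-Schwarz then gives the factor s, the root of the bound s^2
    on the number of nonzero signs.\<close>
  have "msum d (\<lambda>j k. if j \<in> P \<and> k \<in> P then \<bar>D j k\<bar> else 0)
      = msum d (\<lambda>j k. D j k * (if j \<in> P \<and> k \<in> P then sgn (D j k) else 0))"
    by (intro sum.cong refl) (auto simp: abs_sgn)
  then have "(msum d (\<lambda>j k. if j \<in> P \<and> k \<in> P then \<bar>D j k\<bar> else 0))\<^sup>2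
      \<le> F\<^sup>2 * msum d (\<lambda>j k. (if j \<in> P \<and> k \<in> P then sgn (D j k) else 0)\<^sup>2)"
    unfolding F2 using msum_Cauchy_Schwarz[where d = d and X = D and Y = "\<lambda>j k. if j \<in> P \<and> k \<in> P then sgn (D j k) else 0"]
    by simp
  also have "\<dots> \<le> F\<^sup>2 * (real s)\<^sup>2"
  proof (rule mult_left_mono)
    have "msum d (\<lambda>j k. (if j \<in> P \<and> k \<in> P then sgn (D j k) else 0)\<^sup>2)
        \<le> msum d (\<lambda>j k. of_bool (j \<in> P) * of_bool (k \<in> P))"
      by (intro sum_mono) (auto simp: sgn_if)
    also have "\<dots> = (\<Sum>j<d. of_bool (j \<in> P)) * (\<Sum>k<d. of_bool (k \<in> P))" by (rule msum_prod)
    also have "(\<Sum>j<d. of_bool (j \<in> P)) = real (norm0 d a)"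
    proof -
      have "{..<d} \<inter> {j. j \<in> P} = {j. j < d \<and> a j \<noteq> 0}" by (auto simp: P_def)
      then show ?thesis by (simp add: sum_of_bool_eq norm0_def)
    qed
    also have "real (norm0 d a) * real (norm0 d a) \<le> (real s)\<^sup>2"
      unfolding power2_eq_square using s by (intro mult_mono) auto
    finally show "msum d (\<lambda>j k. (if j \<in> P \<and> k \<in> P then sgn (D j k) else 0)\<^sup>2) \<le> (real s)\<^sup>2" .
  qed simp
  also have "\<dots> = (F * real s)\<^sup>2" by (simp add: power_mult_distrib)
  finally have supp: "msum d (\<lambda>j k. if j \<in> P \<and> k \<in> P then \<bar>D j k\<bar> else 0) \<le> F * real s"
    by (rule power2_le_imp_le) (simp add: F0)
  have "m * F\<^sup>2 \<le> m * (2 * (1 - quad_form d V a))"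
    using curv m by simp
  also have "\<dots> = 2 * (- m * msum d (\<lambda>j k. D j k * (a j * a k)))"
    unfolding inner by (simp add: algebra_simps)
  also have "\<dots> \<le> 2 * (l * (F * real s))"
    using basic mult_left_mono[OF supp l] by linarith
  finally have "m * F\<^sup>2 \<le> (2 * real s * l) * F" by (simp add: algebra_simps)
  then have "m * F \<le> 2 * real s * l"
    using F0 l by (cases "F = 0") (auto simp: power2_eq_square)
  then show ?thesis
    using m by (simp add: F_def D_def field_simps)
qed

text \<open>In the expanded square the sign appears only in front of the inner product of v and a,
  and the better of the two signs makes that term equal to its modulus.\<close>

lemma sign_distance_squared:
  assumes a: "norm2 d a = 1" and v: "norm2 d v \<le> 1"
  shows "(Min ((\<lambda>\<iota>. norm2 d (\<lambda>j. \<iota> * v j - a j)) ` {1, -1}))\<^sup>2 \<le> 2 - 2 * \<bar>dotp d v a\<bar>"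
proof -
  define \<theta> where "\<theta> = dotp d v a"
  have n: "(norm2 d (\<lambda>j. \<iota> * v j - a j))\<^sup>2 \<le> 2 - 2 * \<iota> * \<theta>" if \<iota>: "\<iota>\<^sup>2 = 1" for \<iota> :: real
  proof -
    have "(norm2 d (\<lambda>j. \<iota> * v j - a j))\<^sup>2 = (\<Sum>j<d. \<iota>\<^sup>2 * (v j)\<^sup>2 - 2 * \<iota> * (v j * a j) + (a j)\<^sup>2)"
      unfolding norm2_squared by (intro sum.cong refl) (simp add: power2_eq_square algebra_simps)
    also have "\<dots> = (norm2 d v)\<^sup>2 - 2 * \<iota> * \<theta> + 1"
      by (simp add: \<iota> sum.distrib sum_subtractf sum_distrib_left \<theta>_def dotp_def norm2_squared norm2_eq_1[OF a])
    finally show ?thesis using v norm2_nonneg[of d v] power_le_one[of "norm2 d v" 2] by simp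
  qed
  define p where "p = norm2 d (\<lambda>j. 1 * v j - a j)"
  define q where "q = norm2 d (\<lambda>j. - 1 * v j - a j)"
  have "p\<^sup>2 \<le> 2 - 2 * \<theta>" "q\<^sup>2 \<le> 2 + 2 * \<theta>"
    using n[of 1] n[of "-1"] unfolding p_def q_def by simp_all
  moreover have "(min p q)\<^sup>2 \<le> p\<^sup>2" "(min p q)\<^sup>2 \<le> q\<^sup>2"
    by (auto intro!: power_mono simp: p_def q_def norm2_nonneg)
  ultimately have "(min p q)\<^sup>2 \<le> 2 - 2 * \<bar>\<theta>\<bar>"
    by (cases "0 \<le> \<theta>") auto
  then show ?thesis
    by (simp add: p_def q_def \<theta>_def)
qed

text \<open>A self-bounding argument in place of eigenvector perturbation. With
  \<open>\<theta>\<close> the inner product of v and a, maximality of v bounds 1 -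
  \<open>\<theta>\<close>^2 by the inner product of D with v v^T - a a^T, and the squared norm of
  the latter matrix is itself at most 2 (1 - \<open>\<theta>\<close>^2). Cancelling leaves 1 -
  \<open>\<theta>\<close>^2 at most twice the squared norm of D. Positive semidefiniteness of V
  removes the modulus from the objective.\<close>

lemma leading_direction_error:
  assumes V: "fantope d 1 V" and a: "norm2 d a = 1" and lead: "is_leading_direction d V v"
  shows "Min ((\<lambda>\<iota>. norm2 d (\<lambda>j. \<iota> * v j - a j)) ` {1, -1})
    \<le> 2 * sqrt (msum d (\<lambda>j k. (V j k - a j * a k)\<^sup>2))"
proof -
  define D where "D j k = V j k - a j * a k" for j k
  define F2 where "F2 = msum d (\<lambda>j k. (D j k)\<^sup>2)"
  define \<theta> where "\<theta> = dotp d v a"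
  have v: "norm2 d v \<le> 1" using lead by (simp add: is_leading_direction_def is_arg_max_def)
  have v2: "(\<Sum>j<d. (v j)\<^sup>2) \<le> 1"
    using v norm2_nonneg[of d v] power_le_one[of "norm2 d v" 2] by (simp add: norm2_squared)
  have "0 \<le> quad_form d V v" "0 \<le> quad_form d V a" using V by (auto simp: fantope_def)
  moreover have "\<bar>quad_form d V a\<bar> \<le> \<bar>quad_form d V v\<bar>"
    using lead a by (auto simp: is_leading_direction_def is_arg_max_def not_less)
  ultimately have le: "quad_form d V a \<le> quad_form d V v" by simp
  have \<theta>2: "\<theta>\<^sup>2 \<le> 1"
    using dotp_squared_le[of d v a] v2 by (simp add: \<theta>_def norm2_eq_1[OF a])
  have quadD: "quad_form d V w = (dotp d w a)\<^sup>2 + msum d (\<lambda>j k. D j k * (w j * w k))" for w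
  proof -
    have "quad_form d V w = msum d (\<lambda>j k. (a j * w j) * (a k * w k)) + msum d (\<lambda>j k. D j k * (w j * w k))"
      unfolding msum_outer_inner[symmetric] sum.distrib[symmetric]
      by (intro sum.cong refl) (simp add: D_def algebra_simps)
    then show ?thesis by (simp only: msum_prod) (simp add: dotp_def power2_eq_square mult.commute)
  qed
  have "dotp d a a = 1" using norm2_eq_1[OF a] by (simp add: dotp_def power2_eq_square)
  then have "1 - \<theta>\<^sup>2 \<le> msum d (\<lambda>j k. D j k * (v j * v k)) - msum d (\<lambda>j k. D j k * (a j * a k))"
    using le unfolding quadD \<theta>_def by simp
  also have "\<dots> = msum d (\<lambda>j k. D j k * (v j * v k - a j * a k))"
    by (simp add: sum_subtractf algebra_simps)
  finally have X: "1 - \<theta>\<^sup>2 \<le> msum d (\<lambda>j k. D j k * (v j * v k - a j * a k))" .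
  have "msum d (\<lambda>j k. (v j * v k - a j * a k)\<^sup>2)
      = msum d (\<lambda>j k. (v j)\<^sup>2 * (v k)\<^sup>2) - 2 * msum d (\<lambda>j k. (v j * a j) * (v k * a k))
        + msum d (\<lambda>j k. (a j)\<^sup>2 * (a k)\<^sup>2)"
    by (simp add: power2_diff power_mult_distrib sum.distrib sum_subtractf sum_distrib_left algebra_simps)
  also have "\<dots> = (\<Sum>j<d. (v j)\<^sup>2)\<^sup>2 - 2 * \<theta>\<^sup>2 + 1"
    unfolding msum_prod by (simp add: \<theta>_def dotp_def norm2_eq_1[OF a] flip: power2_eq_square)
  also have "\<dots> \<le> 2 * (1 - \<theta>\<^sup>2)"
    using power_le_one[of "\<Sum>j<d. (v j)\<^sup>2" 2] v2 by (simp add: sum_nonneg)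
  finally have Y: "msum d (\<lambda>j k. (v j * v k - a j * a k)\<^sup>2) \<le> 2 * (1 - \<theta>\<^sup>2)" .
  have F2: "0 \<le> F2" by (auto simp: F2_def intro!: sum_nonneg)
  have "(1 - \<theta>\<^sup>2)\<^sup>2 \<le> (msum d (\<lambda>j k. D j k * (v j * v k - a j * a k)))\<^sup>2"
    using X \<theta>2 by (intro power_mono) auto
  also have "\<dots> \<le> F2 * msum d (\<lambda>j k. (v j * v k - a j * a k)\<^sup>2)"
    unfolding F2_def by (rule msum_Cauchy_Schwarz)
  also have "\<dots> \<le> F2 * (2 * (1 - \<theta>\<^sup>2))"
    using Y F2 by (rule mult_left_mono)
  finally have "(1 - \<theta>\<^sup>2) * (1 - \<theta>\<^sup>2) \<le> (2 * F2) * (1 - \<theta>\<^sup>2)"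
    by (simp add: power2_eq_square algebra_simps)
  then have Z: "1 - \<theta>\<^sup>2 \<le> 2 * F2"
    using \<theta>2 F2 by (cases "1 - \<theta>\<^sup>2 = 0") auto
  have "(Min ((\<lambda>\<iota>. norm2 d (\<lambda>j. \<iota> * v j - a j)) ` {1, -1}))\<^sup>2 \<le> 2 - 2 * \<bar>\<theta>\<bar>"
    unfolding \<theta>_def by (rule sign_distance_squared[OF a v])
  also have "\<dots> \<le> 2 * (1 - \<theta>\<^sup>2)"
  proof -
    have "\<bar>\<theta>\<bar> \<le> 1" using \<theta>2 by (simp add: abs_square_le_1)
    then have "\<bar>\<theta>\<bar> * \<bar>\<theta>\<bar> \<le> \<bar>\<theta>\<bar> * 1" by (intro mult_left_mono) auto
    then show ?thesis by (simp add: power2_eq_square)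
  qed
  also have "\<dots> \<le> (2 * sqrt F2)\<^sup>2" using Z F2 by (simp add: power_mult_distrib)
  finally show ?thesis
    unfolding F2_def D_def by (rule power2_le_imp_le) (auto intro!: sum_nonneg)
qed

section \<open>Deflation by an approximate direction\<close>

lemma quad_form_le_norm1:
  assumes "\<And>j k. j < d \<Longrightarrow> k < d \<Longrightarrow> \<bar>E j k\<bar> \<le> e"
  shows "\<bar>quad_form d E b\<bar> \<le> e * (norm1 d b)\<^sup>2"
proof -
  have "\<bar>quad_form d E b\<bar> \<le> msum d (\<lambda>j k. \<bar>b j * E j k * b k\<bar>)"
    unfolding quad_form_def by (intro order_trans[OF sum_abs] sum_mono sum_abs)
  also have "\<dots> \<le> msum d (\<lambda>j k. (e * \<bar>b j\<bar>) * \<bar>b k\<bar>)"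
  proof (intro sum_mono)
    fix j k assume "j \<in> {..<d}" "k \<in> {..<d}"
    then have "\<bar>E j k\<bar> * (\<bar>b j\<bar> * \<bar>b k\<bar>) \<le> e * (\<bar>b j\<bar> * \<bar>b k\<bar>)"
      using assms by (intro mult_right_mono) auto
    then show "\<bar>b j * E j k * b k\<bar> \<le> (e * \<bar>b j\<bar>) * \<bar>b k\<bar>"
      by (simp add: abs_mult algebra_simps)
  qed
  also have "\<dots> = e * (norm1 d b)\<^sup>2"
    unfolding msum_prod by (simp add: norm1_def power2_eq_square flip: sum_distrib_left)
  finally show ?thesis .
qed

lemma abs_dotp_le:
  assumes "\<And>j. j < d \<Longrightarrow> \<bar>w j\<bar> \<le> D"
  shows "\<bar>dotp d w v\<bar> \<le> norm1 d v * D"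
proof -
  have "\<bar>dotp d w v\<bar> \<le> (\<Sum>j<d. \<bar>w j * v j\<bar>)" unfolding dotp_def by (rule sum_abs)
  also have "\<dots> \<le> (\<Sum>j<d. \<bar>v j\<bar> * D)"
    unfolding abs_mult mult.commute[of "\<bar>w _\<bar>"]
    by (intro sum_mono mult_left_mono assms) auto
  finally show ?thesis by (simp add: norm1_def sum_distrib_right)
qed

lemma unit_entry_le_1: "norm2 d v = 1 \<Longrightarrow> j < d \<Longrightarrow> \<bar>v j\<bar> \<le> 1"
proof -
  assume v: "norm2 d v = 1" and j: "j < d"
  have "(v j)\<^sup>2 \<le> (\<Sum>j<d. (v j)\<^sup>2)" using j by (intro member_le_sum) auto
  then show ?thesis using norm2_eq_1[OF v] by (simp add: abs_square_le_1)
qed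

text \<open>Write U = 2 \<eta> \<beta> \<beta>^T + 2 \<mu> \<gamma> \<gamma>^T + E and b = \<beta> +
  w. The error splits into E, the replacement of \<beta> \<beta>^T by b b^T, and the discrepancy 2
  \<eta> - b^T U b times b b^T. The l1 rate \<open>\<kappa>\<close> is used only for b^T E b, where
  it meets the factor \<open>e\<close>; everything else uses the entrywise rate. By orthogonality
  the inner product of \<gamma> and b is that of \<gamma> and w, so \<mu> enters at second order in
  \<open>\<Delta>\<close>.\<close>

lemma deflate_error:
  fixes d :: nat and \<beta> \<gamma> :: rvec and \<eta> \<mu> e \<Delta> \<kappa> :: real
  defines "B \<equiv> norm1 d \<beta>" and "G \<equiv> norm1 d \<gamma>"
  assumes beta: "norm2 d \<beta> = 1" and orth: "dotp d \<beta> \<gamma> = 0"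
    and U: "\<And>j k. j < d \<Longrightarrow> k < d \<Longrightarrow> \<bar>U j k - (2 * \<eta> * (\<beta> j * \<beta> k) + 2 * \<mu> * (\<gamma> j * \<gamma> k))\<bar> \<le> e"
    and e: "0 \<le> e" and D0: "0 \<le> \<Delta>"
    and \<Delta>: "\<And>j. j < d \<Longrightarrow> \<bar>b j - \<beta> j\<bar> \<le> \<Delta>"
    and \<kappa>: "norm1 d (\<lambda>j. b j - \<beta> j) \<le> \<kappa>"
    and jk: "j < d" "k < d"
  shows "\<bar>deflate d U b j k - 2 * \<mu> * (\<gamma> j * \<gamma> k)\<bar>
    \<le> e + 2 * \<bar>\<eta>\<bar> * (\<Delta> * (2 + \<Delta>))
      + (1 + \<Delta>)\<^sup>2 * (e * (B + \<kappa>)\<^sup>2 + 2 * \<bar>\<eta>\<bar> * (B * \<Delta> * (2 + B * \<Delta>)) + 2 * \<bar>\<mu>\<bar> * (G * \<Delta>)\<^sup>2)"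
proof -
  define E where "E j k = U j k - (2 * \<eta> * (\<beta> j * \<beta> k) + 2 * \<mu> * (\<gamma> j * \<gamma> k))" for j k
  define w where "w j = b j - \<beta> j" for j
  have w: "\<bar>w j\<bar> \<le> \<Delta>" if "j < d" for j using \<Delta>[OF that] by (simp add: w_def)
  have E: "\<bar>E j k\<bar> \<le> e" if "j < d" "k < d" for j k using U[OF that] by (simp add: E_def)
  have B0: "0 \<le> B" "0 \<le> G" by (auto simp: B_def G_def norm1_def intro: sum_nonneg)
  have quad: "quad_form d U b = quad_form d E b + 2 * \<eta> * (dotp d \<beta> b)\<^sup>2 + 2 * \<mu> * (dotp d \<gamma> b)\<^sup>2"
  proof -
    have "quad_form d U b = quad_form d E b + 2 * \<eta> * quad_form d (\<lambda>j k. \<beta> j * \<beta> k) b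
        + 2 * \<mu> * quad_form d (\<lambda>j k. \<gamma> j * \<gamma> k) b"
      unfolding quad_form_def E_def
      by (simp add: algebra_simps sum.distrib sum_subtractf sum_distrib_left)
    then show ?thesis by (simp add: quad_form_outer)
  qed
  have b1: "norm1 d b \<le> B + \<kappa>"
  proof -
    have "norm1 d b \<le> (\<Sum>j<d. \<bar>\<beta> j\<bar> + \<bar>b j - \<beta> j\<bar>)"
      unfolding norm1_def by (intro sum_mono) simp
    then show ?thesis using \<kappa> by (simp add: sum.distrib norm1_def B_def)
  qed
  have "0 \<le> norm1 d b" by (auto simp: norm1_def intro: sum_nonneg)
  then have q1: "\<bar>quad_form d E b\<bar> \<le> e * (B + \<kappa>)\<^sup>2"
    using b1 e by (intro order_trans[OF quad_form_le_norm1[OF E]] mult_left_mono power_mono) auto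
  have q2: "\<bar>2 * \<eta> * ((dotp d \<beta> b)\<^sup>2 - 1)\<bar> \<le> 2 * \<bar>\<eta>\<bar> * (B * \<Delta> * (2 + B * \<Delta>))"
  proof -
    have "dotp d \<beta> \<beta> = 1" using norm2_eq_1[OF beta] by (simp add: dotp_def power2_eq_square)
    moreover have "dotp d \<beta> b = dotp d \<beta> \<beta> + dotp d w \<beta>"
      unfolding dotp_def w_def sum.distrib[symmetric] by (intro sum.cong refl) (simp add: algebra_simps)
    ultimately have t: "(dotp d \<beta> b)\<^sup>2 - 1 = dotp d w \<beta> * (2 + dotp d w \<beta>)"
      by (simp add: power2_eq_square algebra_simps)
    have "\<bar>dotp d w \<beta>\<bar> \<le> B * \<Delta>" unfolding B_def by (rule abs_dotp_le[OF w])
    then have "\<bar>dotp d w \<beta>\<bar> * \<bar>2 + dotp d w \<beta>\<bar> \<le> B * \<Delta> * (2 + B * \<Delta>)"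
      by (intro mult_mono) auto
    then show ?thesis unfolding t abs_mult by (simp add: mult_left_mono mult.assoc)
  qed
  have q3: "\<bar>2 * \<mu> * (dotp d \<gamma> b)\<^sup>2\<bar> \<le> 2 * \<bar>\<mu>\<bar> * (G * \<Delta>)\<^sup>2"
  proof -
    have "dotp d \<gamma> b = dotp d \<beta> \<gamma> + dotp d w \<gamma>"
      unfolding dotp_def w_def sum.distrib[symmetric] by (intro sum.cong refl) (simp add: algebra_simps)
    then have "\<bar>dotp d \<gamma> b\<bar> \<le> G * \<Delta>" using abs_dotp_le[OF w, where v = \<gamma>] by (simp add: orth G_def)
    then have "\<bar>dotp d \<gamma> b\<bar>\<^sup>2 \<le> (G * \<Delta>)\<^sup>2" by (rule power_mono) simp
    then show ?thesis by (simp add: abs_mult mult_left_mono)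
  qed
  have q4: "2 * \<eta> - quad_form d U b
      = - quad_form d E b - 2 * \<eta> * ((dotp d \<beta> b)\<^sup>2 - 1) - 2 * \<mu> * (dotp d \<gamma> b)\<^sup>2"
    by (simp add: quad algebra_simps)
  have triangle: "\<bar>w\<bar> \<le> p + q + r"
    if "\<bar>u\<bar> \<le> p" "\<bar>v\<bar> \<le> q" "\<bar>z\<bar> \<le> r" "w = - u - v - z \<or> w = u + v + z" for u v w z p q r :: real
    using that by linarith
  from q4 have q: "\<bar>2 * \<eta> - quad_form d U b\<bar>
      \<le> e * (B + \<kappa>)\<^sup>2 + 2 * \<bar>\<eta>\<bar> * (B * \<Delta> * (2 + B * \<Delta>)) + 2 * \<bar>\<mu>\<bar> * (G * \<Delta>)\<^sup>2"
    by (intro triangle[OF q1 q2 q3] disjI1)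
  have \<beta>1: "\<bar>\<beta> j\<bar> \<le> 1" "\<bar>\<beta> k\<bar> \<le> 1" using unit_entry_le_1[OF beta] jk by auto
  have b: "\<bar>b j\<bar> \<le> 1 + \<Delta>" "\<bar>b k\<bar> \<le> 1 + \<Delta>"
    using \<beta>1 \<Delta>[OF jk(1)] \<Delta>[OF jk(2)] by linarith+
  have bb: "\<bar>b j * b k\<bar> \<le> (1 + \<Delta>)\<^sup>2"
    unfolding abs_mult power2_eq_square using b by (intro mult_mono) auto
  have "\<bar>\<beta> j * \<beta> k - b j * b k\<bar> \<le> \<Delta> * (2 + \<Delta>)"
  proof -
    have "\<beta> j * \<beta> k - b j * b k = - (\<beta> j * w k) - w j * b k"
      by (simp add: w_def algebra_simps)
    moreover have "\<bar>\<beta> j * w k\<bar> \<le> 1 * \<Delta>"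
      unfolding abs_mult using \<beta>1 w[OF jk(2)] by (intro mult_mono) auto
    moreover have "\<bar>w j * b k\<bar> \<le> \<Delta> * (1 + \<Delta>)"
      unfolding abs_mult using b w[OF jk(1)] D0 by (intro mult_mono) auto
    ultimately show ?thesis by (simp add: algebra_simps)
  qed
  then have e2: "\<bar>2 * \<eta> * (\<beta> j * \<beta> k - b j * b k)\<bar> \<le> 2 * \<bar>\<eta>\<bar> * (\<Delta> * (2 + \<Delta>))"
    by (simp add: abs_mult mult_left_mono mult.assoc)
  have e3: "\<bar>b j * b k * (2 * \<eta> - quad_form d U b)\<bar>
      \<le> (1 + \<Delta>)\<^sup>2 * (e * (B + \<kappa>)\<^sup>2 + 2 * \<bar>\<eta>\<bar> * (B * \<Delta> * (2 + B * \<Delta>)) + 2 * \<bar>\<mu>\<bar> * (G * \<Delta>)\<^sup>2)"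
    unfolding abs_mult[of "b j * b k"] using bb q by (intro mult_mono) auto
  have "deflate d U b j k - 2 * \<mu> * (\<gamma> j * \<gamma> k)
      = E j k + 2 * \<eta> * (\<beta> j * \<beta> k - b j * b k) + b j * b k * (2 * \<eta> - quad_form d U b)"
    by (simp add: deflate_def E_def algebra_simps)
  then show ?thesis by (intro triangle[OF E[OF jk] e2 e3] disjI2)
qed

subsection \<open>Truncated moments of the response\<close>

text \<open>Composition with real-valued functions brings both variables to one type, so that the
  product rule for expectations under \<open>indep_var\<close> applies to the noise and functions of
  \<open>x\<close>.\<close>

lemma (in prob_space) indep_rv_compose:
  fixes \<phi> :: "'b \<Rightarrow> real" and \<psi> :: "'c \<Rightarrow> real"
  assumes indep: "indep_rv M N X L Y"
    and m: "\<phi> \<in> borel_measurable N" "\<psi> \<in> borel_measurable L"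
  shows "indep_var borel (\<lambda>\<omega>. \<phi> (X \<omega>)) borel (\<lambda>\<omega>. \<psi> (Y \<omega>))"
proof -
  have X: "X \<in> measurable M N" and Y: "Y \<in> measurable M L"
    using indep by (auto simp: indep_rv_def)
  have sets: "{(\<lambda>\<omega>. g (Z \<omega>)) -` A \<inter> space M |A. A \<in> sets borel} \<subseteq> {Z -` A \<inter> space M |A. A \<in> sets P}"
    if Z: "Z \<in> measurable M P" and g: "g \<in> borel_measurable P"
    for Z :: "'a \<Rightarrow> 'd" and P and g :: "'d \<Rightarrow> real"
  proof safe
    fix A :: "real set" assume "A \<in> sets borel"
    then have "g -` A \<inter> space P \<in> sets P" by (rule measurable_sets[OF g])
    moreover have "(\<lambda>\<omega>. g (Z \<omega>)) -` A \<inter> space M = Z -` (g -` A \<inter> space P) \<inter> space M"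
      using measurable_space[OF Z] by auto
    ultimately show "\<exists>B. (\<lambda>\<omega>. g (Z \<omega>)) -` A \<inter> space M = Z -` B \<inter> space M \<and> B \<in> sets P" by blast
  qed
  have "indep_sets (case_bool {X -` A \<inter> space M |A. A \<in> sets N} {Y -` B \<inter> space M |B. B \<in> sets L}) UNIV"
    using indep by (simp add: indep_rv_def indep_set_def)
  then have "indep_sets (\<lambda>i. {case_bool (\<lambda>\<omega>. \<phi> (X \<omega>)) (\<lambda>\<omega>. \<psi> (Y \<omega>)) i -` A \<inter> space M |A.
      A \<in> sets (case_bool borel borel i)}) UNIV"
  proof (rule indep_sets_mono_sets)
    fix i :: bool
    show "{case_bool (\<lambda>\<omega>. \<phi> (X \<omega>)) (\<lambda>\<omega>. \<psi> (Y \<omega>)) i -` A \<inter> space M |A. A \<in> sets (case_bool borel borel i)}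
      \<subseteq> (case i of True \<Rightarrow> {X -` A \<inter> space M |A. A \<in> sets N} | False \<Rightarrow> {Y -` B \<inter> space M |B. B \<in> sets L})"
      using sets[OF X m(1)] sets[OF Y m(2)] by (cases i) auto
  qed
  then show ?thesis
    unfolding indep_var_def indep_vars_def2
    using measurable_compose[OF X m(1)] measurable_compose[OF Y m(2)]
    by (auto split: bool.split)
qed

lemma trunc_abs_le: "0 \<le> \<tau> \<Longrightarrow> \<bar>trunc \<tau> v\<bar> \<le> \<tau>"
  by (simp add: trunc_def)

lemma trunc_measurable [measurable]: "trunc \<tau> \<in> borel_measurable borel"
  unfolding trunc_def[abs_def] by measurable

definition trunc_prod :: "real \<Rightarrow> real \<Rightarrow> real \<Rightarrow> real" where
  "trunc_prod \<tau> y h = (trunc \<tau> y)\<^sup>2 * trunc \<tau> h"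

lemma trunc_prod_abs_le:
  assumes "0 \<le> \<tau>"
  shows "\<bar>trunc_prod \<tau> y h\<bar> \<le> \<tau> ^ 3"
proof -
  have "\<bar>trunc \<tau> y\<bar> ^ 2 * \<bar>trunc \<tau> h\<bar> \<le> \<tau> ^ 2 * \<tau>"
    using assms by (intro mult_mono power_mono trunc_abs_le) auto
  then show ?thesis
    by (simp add: trunc_prod_def abs_mult power2_eq_square power3_eq_cube mult.assoc)
qed

lemma max_abs_power_6: "(max \<bar>y\<bar> \<bar>h\<bar>) ^ 6 \<le> (y :: real) ^ 6 + h ^ 6"
  by (simp add: max_def)

text \<open>Four powers of y and two of h are at most six powers of the larger one: the second
  moment needed for the tail bound costs sixth moments and is free of \<open>\<tau>\<close>.\<close>

lemma trunc_prod_squared_le: "(trunc_prod \<tau> y h)\<^sup>2 \<le> y ^ 6 + h ^ 6"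
proof -
  let ?m = "max \<bar>y\<bar> \<bar>h\<bar>"
  have "(trunc_prod \<tau> y h)\<^sup>2 = \<bar>trunc \<tau> y\<bar> ^ 4 * \<bar>trunc \<tau> h\<bar> ^ 2"
    by (simp add: trunc_prod_def power_mult_distrib flip: power_mult)
  also have "\<dots> \<le> ?m ^ 4 * ?m ^ 2"
    by (intro mult_mono power_mono) (auto simp: trunc_def)
  also have "\<dots> = ?m ^ 6" by (simp flip: power_add)
  finally show ?thesis using max_abs_power_6[of y h] by simp
qed

text \<open>If the product is affected by the truncation at all, then \<open>max \<bar>y\<bar> \<bar>h\<bar> > \<tau>\<close>.\<close>

lemma trunc_prod_error:
  assumes \<tau>: "0 < \<tau>"
  shows "\<bar>trunc_prod \<tau> y h - y\<^sup>2 * h\<bar> \<le> (y ^ 6 + h ^ 6) / \<tau> ^ 3"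
proof (cases "\<bar>y\<bar> \<le> \<tau> \<and> \<bar>h\<bar> \<le> \<tau>")
  case True
  then show ?thesis using \<tau> by (simp add: trunc_prod_def trunc_def)
next
  case False
  let ?m = "max \<bar>y\<bar> \<bar>h\<bar>"
  have "\<bar>trunc_prod \<tau> y h - y\<^sup>2 * h\<bar> = \<bar>y\<bar> ^ 2 * \<bar>h\<bar>"
    using False by (auto simp: trunc_prod_def trunc_def abs_mult)
  also have "\<dots> \<le> ?m ^ 2 * ?m" by (intro mult_mono power_mono) auto
  also have "\<dots> = ?m ^ 3" by (simp add: power2_eq_square power3_eq_cube)
  also have "\<dots> \<le> ?m ^ 6 / \<tau> ^ 3"
  proof -
    have "\<tau> ^ 3 \<le> ?m ^ 3" using False \<tau> by (intro power_mono) auto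
    then have "?m ^ 3 * \<tau> ^ 3 \<le> ?m ^ 3 * ?m ^ 3" by (intro mult_left_mono) auto
    also have "\<dots> = ?m ^ 6" by (simp flip: power_add)
    finally show ?thesis using \<tau> by (simp add: pos_le_divide_eq)
  qed
  also have "\<dots> \<le> (y ^ 6 + h ^ 6) / \<tau> ^ 3"
    using max_abs_power_6[of y h] \<tau> by (intro divide_right_mono) auto
  finally show ?thesis .
qed

section \<open>Population moments and tail bounds for the truncated entries\<close>

context index_volatility_model
begin

lemma x_measurable [measurable]: "x \<in> measurable M (Rd d)"
  using density by (simp add: distributed_def)

lemma eps_measurable [measurable]: "\<epsilon> \<in> borel_measurable M"
  using eps_mean by auto

lemma response_measurable [measurable]: "response d f g \<beta> \<gamma> x \<epsilon> \<in> borel_measurable M"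
proof -
  note [measurable] = links_measurable
  show ?thesis unfolding response_def[abs_def] by measurable
qed

lemma score2_in_AE:
  assumes reg: "regular_density M d x px"
  shows "AE \<omega> in M. \<forall>j k. score2_in d px j k (x \<omega>) = score2 px (x \<omega>) j k"
proof -
  obtain i where "i < d" using norm2_one_nonzero[OF unit_vectors(1)] by blast
  then interpret smooth_density d "support_interior d px" "zero_off (support_interior d px) px" M x
    "\<lambda>j. zero_off (support_interior d px) (partial j px)"
    "\<lambda>j k. zero_off (support_interior d px) (\<lambda>u. hessian px u j k)"
    by (intro regular_density_smooth[OF prob_space_axioms reg]) simp
  show ?thesis
    using AE_in_U by eventually_elim (simp add: score2_in_def zero_off_def)
qed

context
  fixes Ke Ky M6 :: real
  assumes reg: "regular_density M d x px"
    and fin: "finite_moments M d x px \<epsilon> f g \<beta> \<gamma> Ke Ky 6 M6"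
    and curvs: "curvature_exists M d x f \<beta>" "curvature_exists M d x g \<gamma>"
begin

abbreviation "y \<equiv> response d f g \<beta> \<gamma> x \<epsilon>"

lemma M6_pos: "0 < M6" using fin by (simp add: finite_moments_def)

lemma y_moment: "integrable M (\<lambda>\<omega>. y \<omega> ^ 6)" "expectation (\<lambda>\<omega>. y \<omega> ^ 6) \<le> Ky * M6"
  using fin by (simp_all add: finite_moments_def moment_le_6)

lemma Ky_nonneg: "0 \<le> Ky"
proof -
  have "0 \<le> expectation (\<lambda>\<omega>. y \<omega> ^ 6)" by (intro integral_nonneg_AE) auto
  then have "0 \<le> Ky * M6" using y_moment by linarith
  then show ?thesis using M6_pos by (simp add: zero_le_mult_iff)
qed

lemma H_measurable: "j < d \<Longrightarrow> k < d \<Longrightarrow> score2_in d px j k \<in> borel_measurable (Rd d)"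
  by (rule score2_in_measurable[OF prob_space_axioms reg])

lemma H_moment:
  assumes jk: "j < d" "k < d"
  shows "integrable M (\<lambda>\<omega>. score2_in d px j k (x \<omega>) ^ 6)"
    "expectation (\<lambda>\<omega>. score2_in d px j k (x \<omega>) ^ 6) \<le> M6"
proof -
  note [measurable] = H_measurable[OF jk]
  have "AE \<omega> in M. score2 px (x \<omega>) j k ^ 6 = score2_in d px j k (x \<omega>) ^ 6"
    using score2_in_AE[OF reg] by eventually_elim simp
  note eq = integral_cong_AE_imp[OF _ _ this]
  show "integrable M (\<lambda>\<omega>. score2_in d px j k (x \<omega>) ^ 6)"
    using fin jk by (intro eq) (simp_all add: finite_moments_def moment_le_6)
  have "expectation (\<lambda>\<omega>. score2 px (x \<omega>) j k ^ 6) = expectation (\<lambda>\<omega>. score2_in d px j k (x \<omega>) ^ 6)"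
    using fin jk by (intro eq) (simp_all add: finite_moments_def moment_le_6)
  moreover have "expectation (\<lambda>\<omega>. score2 px (x \<omega>) j k ^ 6) \<le> M6"
    using fin jk by (simp add: finite_moments_def moment_le_6)
  ultimately show "expectation (\<lambda>\<omega>. score2_in d px j k (x \<omega>) ^ 6) \<le> M6"
    by simp
qed

lemma stein_f:
  assumes "j < d" "k < d"
  shows "expectation (\<lambda>\<omega>. (f (dotp d (x \<omega>) \<beta>))\<^sup>2 * score2_in d px j k (x \<omega>))
    = 2 * (\<beta> j * \<beta> k) * curvature M d x f \<beta>"
  by (rule second_order_stein_index[OF prob_space_axioms reg links_measurable(1) links_diff(1)
        unit_vectors(1) _ _ _ curvs(1) assms, where B = M6])
     (use fin in \<open>simp_all add: finite_moments_def\<close>)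

lemma stein_g:
  assumes "j < d" "k < d"
  shows "expectation (\<lambda>\<omega>. (g (dotp d (x \<omega>) \<gamma>))\<^sup>2 * score2_in d px j k (x \<omega>))
    = 2 * (\<gamma> j * \<gamma> k) * curvature M d x g \<gamma>"
  by (rule second_order_stein_index[OF prob_space_axioms reg links_measurable(2) links_diff(2)
        unit_vectors(2) _ _ _ curvs(2) assms, where B = M6])
     (use fin in \<open>simp_all add: finite_moments_def\<close>)

lemma fg_moments:
  "integrable M (\<lambda>\<omega>. f (dotp d (x \<omega>) \<beta>) ^ 6)" "expectation (\<lambda>\<omega>. f (dotp d (x \<omega>) \<beta>) ^ 6) \<le> M6"
  "integrable M (\<lambda>\<omega>. g (dotp d (x \<omega>) \<gamma>) ^ 6)" "expectation (\<lambda>\<omega>. g (dotp d (x \<omega>) \<gamma>) ^ 6) \<le> M6"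
  using fin by (simp_all add: finite_moments_def moment_le_6)

lemma fgH_integrable:
  assumes jk: "j < d" "k < d" and pq: "p + q \<le> 5"
  shows "integrable M (\<lambda>\<omega>. f (dotp d (x \<omega>) \<beta>) ^ p * g (dotp d (x \<omega>) \<gamma>) ^ q * score2_in d px j k (x \<omega>))"
proof (rule Bochner_Integration.integrable_bound)
  note [measurable] = H_measurable[OF jk] links_measurable
  show "integrable M (\<lambda>\<omega>. 1 + f (dotp d (x \<omega>) \<beta>) ^ 6 + g (dotp d (x \<omega>) \<gamma>) ^ 6 + score2_in d px j k (x \<omega>) ^ 6)"
    using fg_moments H_moment[OF jk] by auto
  show "AE \<omega> in M. norm (f (dotp d (x \<omega>) \<beta>) ^ p * g (dotp d (x \<omega>) \<gamma>) ^ q * score2_in d px j k (x \<omega>))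
    \<le> norm (1 + f (dotp d (x \<omega>) \<beta>) ^ 6 + g (dotp d (x \<omega>) \<gamma>) ^ 6 + score2_in d px j k (x \<omega>) ^ 6)"
  proof (rule AE_I2)
    fix \<omega>
    have "\<bar>f (dotp d (x \<omega>) \<beta>) ^ p * g (dotp d (x \<omega>) \<gamma>) ^ q * score2_in d px j k (x \<omega>)\<bar>
      \<le> 1 + f (dotp d (x \<omega>) \<beta>) ^ 6 + g (dotp d (x \<omega>) \<gamma>) ^ 6 + score2_in d px j k (x \<omega>) ^ 6"
      using monomial_le_sixth_powers[of p q 1 "f (dotp d (x \<omega>) \<beta>)" "g (dotp d (x \<omega>) \<gamma>)" "score2_in d px j k (x \<omega>)"] pq
      by (simp add: abs_mult power_abs)
    then show "norm (f (dotp d (x \<omega>) \<beta>) ^ p * g (dotp d (x \<omega>) \<gamma>) ^ q * score2_in d px j k (x \<omega>))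
      \<le> norm (1 + f (dotp d (x \<omega>) \<beta>) ^ 6 + g (dotp d (x \<omega>) \<gamma>) ^ 6 + score2_in d px j k (x \<omega>) ^ 6)"
      by simp
  qed
  show "random_variable borel (\<lambda>\<omega>. f (dotp d (x \<omega>) \<beta>) ^ p * g (dotp d (x \<omega>) \<gamma>) ^ q * score2_in d px j k (x \<omega>))"
    by measurable
qed

lemma response_second_moment:
  assumes jk: "j < d" "k < d"
  shows "integrable M (\<lambda>\<omega>. (y \<omega>)\<^sup>2 * score2_in d px j k (x \<omega>))"
    "expectation (\<lambda>\<omega>. (y \<omega>)\<^sup>2 * score2_in d px j k (x \<omega>))
      = 2 * curvature M d x f \<beta> * (\<beta> j * \<beta> k) + 2 * curvature M d x g \<gamma> * (\<gamma> j * \<gamma> k)"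
proof -
  note [measurable] = H_measurable[OF jk] links_measurable
  let ?f = "\<lambda>u. f (dotp d u \<beta>)" and ?g = "\<lambda>u. g (dotp d u \<gamma>)" and ?H = "score2_in d px j k"
  have ff: "integrable M (\<lambda>\<omega>. (?f (x \<omega>))\<^sup>2 * ?H (x \<omega>))"
    using fgH_integrable[OF jk, of 2 0] by simp
  have fg: "integrable M (\<lambda>\<omega>. ?f (x \<omega>) * ?g (x \<omega>) * ?H (x \<omega>))"
    using fgH_integrable[OF jk, of 1 1] by simp
  have gg: "integrable M (\<lambda>\<omega>. (?g (x \<omega>))\<^sup>2 * ?H (x \<omega>))"
    using fgH_integrable[OF jk, of 0 2] by simp
  have i1: "indep_var borel \<epsilon> borel (\<lambda>\<omega>. ?f (x \<omega>) * ?g (x \<omega>) * ?H (x \<omega>))"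
    by (rule indep_rv_compose[OF indep, of "\<lambda>e. e" "\<lambda>u. ?f u * ?g u * ?H u"]) measurable
  have i2: "indep_var borel (\<lambda>\<omega>. (\<epsilon> \<omega>)\<^sup>2) borel (\<lambda>\<omega>. (?g (x \<omega>))\<^sup>2 * ?H (x \<omega>))"
    by (rule indep_rv_compose[OF indep, of "\<lambda>e. e\<^sup>2" "\<lambda>u. (?g u)\<^sup>2 * ?H u"]) measurable
  \<comment> \<open>In expectation the term linear in \<open>\<epsilon>\<close> vanishes with the
    mean of the noise, and \<open>(\<epsilon> \<omega>)\<^sup>2\<close> contributes the factor
    1.\<close>
  have eq: "(y \<omega>)\<^sup>2 * ?H (x \<omega>) = (?f (x \<omega>))\<^sup>2 * ?H (x \<omega>)
      + 2 * (\<epsilon> \<omega> * (?f (x \<omega>) * ?g (x \<omega>) * ?H (x \<omega>))) + (\<epsilon> \<omega>)\<^sup>2 * ((?g (x \<omega>))\<^sup>2 * ?H (x \<omega>))" for \<omega>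
    by (simp add: response_def power2_eq_square algebra_simps)
  note int = ff indep_var_integrable[OF i1 eps_mean(1) fg] indep_var_integrable[OF i2 eps_var(1) gg]
  show "integrable M (\<lambda>\<omega>. (y \<omega>)\<^sup>2 * ?H (x \<omega>))"
    unfolding eq using int by auto
  have "expectation (\<lambda>\<omega>. (y \<omega>)\<^sup>2 * ?H (x \<omega>))
      = expectation (\<lambda>\<omega>. (?f (x \<omega>))\<^sup>2 * ?H (x \<omega>)) + expectation (\<lambda>\<omega>. (?g (x \<omega>))\<^sup>2 * ?H (x \<omega>))"
    unfolding eq using int
    by (simp add: indep_var_lebesgue_integral[OF i1 eps_mean(1) fg]
        indep_var_lebesgue_integral[OF i2 eps_var(1) gg] eps_mean(2) eps_var(2))
  then show "expectation (\<lambda>\<omega>. (y \<omega>)\<^sup>2 * ?H (x \<omega>))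
      = 2 * curvature M d x f \<beta> * (\<beta> j * \<beta> k) + 2 * curvature M d x g \<gamma> * (\<gamma> j * \<gamma> k)"
    by (simp only: stein_f[OF jk] stein_g[OF jk]) (simp add: algebra_simps)
qed

text \<open>This bounds \<open>M6\<close> from below, which makes the rates of \<open>\<beta>h\<close>, in which \<open>M6\<close> does not
  occur, comparable to \<open>\<lambda>\<close>.\<close>

lemma curvature_le_moment:
  "2 * \<bar>curvature M d x g \<gamma>\<bar> \<le> 3 * sqrt M6 * (norm1 d \<gamma>)\<^sup>2"
proof -
  let ?\<mu> = "curvature M d x g \<gamma>"
  \<comment> \<open>Rescaling by the sixth root of M6 makes the normalised sixth moments at most 1;
    the inhomogeneous monomial bound then becomes a homogeneous one with constant 1 + 1 + 1.\<close>
  define m where "m = M6 powr (1 / 6)"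
  have m: "0 < m" using M6_pos by (simp add: m_def)
  have m6: "m ^ 6 = M6"
    using M6_pos by (simp add: m_def powr_realpow[symmetric] powr_powr)
  have m3: "m ^ 3 = sqrt M6"
    using m by (intro real_sqrt_unique[symmetric]) (simp_all add: m6[symmetric] flip: power_mult)
  have entry: "2 * \<bar>?\<mu>\<bar> * (\<bar>\<gamma> j\<bar> * \<bar>\<gamma> k\<bar>) \<le> 3 * sqrt M6" if jk: "j < d" "k < d" for j k
  proof -
    let ?g = "\<lambda>\<omega>. g (dotp d (x \<omega>) \<gamma>)" and ?H = "\<lambda>\<omega>. score2_in d px j k (x \<omega>)"
    have "2 * \<bar>?\<mu>\<bar> * (\<bar>\<gamma> j\<bar> * \<bar>\<gamma> k\<bar>) = \<bar>expectation (\<lambda>\<omega>. (?g \<omega>)\<^sup>2 * ?H \<omega>)\<bar>"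
      unfolding stein_g[OF jk] by (simp add: abs_mult)
    also have "\<dots> \<le> expectation (\<lambda>\<omega>. \<bar>(?g \<omega>)\<^sup>2 * ?H \<omega>\<bar>)"
      by (rule integral_abs_bound)
    also have "\<dots> \<le> expectation (\<lambda>\<omega>. m ^ 3 * (1 + ?g \<omega> ^ 6 / M6 + ?H \<omega> ^ 6 / M6))"
    proof (rule integral_mono)
      show "integrable M (\<lambda>\<omega>. \<bar>(?g \<omega>)\<^sup>2 * ?H \<omega>\<bar>)"
        using fgH_integrable[OF jk, of 0 2] by simp
      show "integrable M (\<lambda>\<omega>. m ^ 3 * (1 + ?g \<omega> ^ 6 / M6 + ?H \<omega> ^ 6 / M6))"
        using fg_moments H_moment[OF jk] by auto
      fix \<omega>
      have "\<bar>?g \<omega> / m\<bar> ^ 2 * \<bar>?H \<omega> / m\<bar> ^ 1 * \<bar>0\<bar> ^ 0 \<le> 1 + (?g \<omega> / m) ^ 6 + (?H \<omega> / m) ^ 6 + 0 ^ 6"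
        by (rule monomial_le_sixth_powers) simp
      then have "m ^ 3 * (\<bar>?g \<omega> / m\<bar> ^ 2 * \<bar>?H \<omega> / m\<bar>) \<le> m ^ 3 * (1 + ?g \<omega> ^ 6 / M6 + ?H \<omega> ^ 6 / M6)"
        using m by (intro mult_left_mono) (simp_all add: power_divide m6)
      also have "m ^ 3 * (\<bar>?g \<omega> / m\<bar> ^ 2 * \<bar>?H \<omega> / m\<bar>) = \<bar>(?g \<omega>)\<^sup>2 * ?H \<omega>\<bar>"
        using m by (simp add: abs_mult power_divide power2_eq_square power3_eq_cube)
      finally show "\<bar>(?g \<omega>)\<^sup>2 * ?H \<omega>\<bar> \<le> m ^ 3 * (1 + ?g \<omega> ^ 6 / M6 + ?H \<omega> ^ 6 / M6)" .
    qed
    also have "\<dots> = m ^ 3 * (1 + expectation (\<lambda>\<omega>. ?g \<omega> ^ 6) / M6 + expectation (\<lambda>\<omega>. ?H \<omega> ^ 6) / M6)"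
      using fg_moments H_moment[OF jk] by (simp add: prob_space)
    also have "\<dots> \<le> m ^ 3 * (1 + 1 + 1)"
      using fg_moments H_moment[OF jk] M6_pos m by (intro mult_left_mono add_mono) simp_all
    finally show ?thesis by (simp add: m3)
  qed
  have sq: "(\<gamma> j)\<^sup>2 = \<bar>\<gamma> j\<bar> * \<bar>\<gamma> j\<bar>" for j by (simp add: power2_eq_square)
  \<comment> \<open>The weights \<open>(\<gamma> j)\<^sup>2 * (\<gamma> k)\<^sup>2\<close> sum to 1.
    Half of each weight is consumed by the entrywise bound, and the other half sums to the squared
    l1 norm.\<close>
  have "1 = msum d (\<lambda>j k. (\<gamma> j)\<^sup>2 * (\<gamma> k)\<^sup>2)"
    unfolding msum_prod by (simp add: norm2_eq_1[OF unit_vectors(2)])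
  then have "2 * \<bar>?\<mu>\<bar> = 2 * \<bar>?\<mu>\<bar> * msum d (\<lambda>j k. (\<gamma> j)\<^sup>2 * (\<gamma> k)\<^sup>2)" by simp
  also have "\<dots> = msum d (\<lambda>j k. 2 * \<bar>?\<mu>\<bar> * (\<bar>\<gamma> j\<bar> * \<bar>\<gamma> k\<bar>) * (\<bar>\<gamma> j\<bar> * \<bar>\<gamma> k\<bar>))"
    unfolding sum_distrib_left
    by (intro sum.cong refl) (simp only: sq mult_ac)
  also have "\<dots> \<le> msum d (\<lambda>j k. 3 * sqrt M6 * (\<bar>\<gamma> j\<bar> * \<bar>\<gamma> k\<bar>))"
    by (intro sum_mono mult_right_mono entry) auto
  also have "\<dots> = 3 * sqrt M6 * msum d (\<lambda>j k. \<bar>\<gamma> j\<bar> * \<bar>\<gamma> k\<bar>)"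
    by (simp add: sum_distrib_left)
  also have "\<dots> = 3 * sqrt M6 * (norm1 d \<gamma>)\<^sup>2"
    unfolding msum_prod by (simp add: norm1_def power2_eq_square)
  finally show ?thesis .
qed

lemma truncated_entry_bias:
  assumes jk: "j < d" "k < d" and \<tau>: "0 < \<tau>"
  shows "\<bar>expectation (\<lambda>\<omega>. trunc_prod \<tau> (y \<omega>) (score2_in d px j k (x \<omega>)))
      - expectation (\<lambda>\<omega>. (y \<omega>)\<^sup>2 * score2_in d px j k (x \<omega>))\<bar> \<le> (Ky + 1) * M6 / \<tau> ^ 3"
    and "expectation (\<lambda>\<omega>. (trunc_prod \<tau> (y \<omega>) (score2_in d px j k (x \<omega>)))\<^sup>2) \<le> (Ky + 1) * M6"
proof -
  note [measurable] = H_measurable[OF jk]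
  let ?H = "\<lambda>\<omega>. score2_in d px j k (x \<omega>)"
  let ?Z = "\<lambda>\<omega>. trunc_prod \<tau> (y \<omega>) (?H \<omega>)"
  have [measurable]: "random_variable borel ?Z" unfolding trunc_prod_def by measurable
  have bd: "\<bar>?Z \<omega>\<bar> \<le> \<tau> ^ 3" for \<omega> using trunc_prod_abs_le[of \<tau>] \<tau> by simp
  have iZ: "integrable M ?Z"
    by (rule integrable_const_bound[where B = "\<tau> ^ 3"]) (use bd in auto)
  have moments: "integrable M (\<lambda>\<omega>. y \<omega> ^ 6 + ?H \<omega> ^ 6)"
      "expectation (\<lambda>\<omega>. y \<omega> ^ 6 + ?H \<omega> ^ 6) \<le> (Ky + 1) * M6"
    using y_moment H_moment[OF jk] by (auto simp: distrib_right)
  have "\<bar>expectation ?Z - expectation (\<lambda>\<omega>. (y \<omega>)\<^sup>2 * ?H \<omega>)\<bar>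
      = \<bar>expectation (\<lambda>\<omega>. ?Z \<omega> - (y \<omega>)\<^sup>2 * ?H \<omega>)\<bar>"
    using iZ response_second_moment(1)[OF jk] by simp
  also have "\<dots> \<le> expectation (\<lambda>\<omega>. \<bar>?Z \<omega> - (y \<omega>)\<^sup>2 * ?H \<omega>\<bar>)"
    by (rule integral_abs_bound)
  also have "\<dots> \<le> expectation (\<lambda>\<omega>. (y \<omega> ^ 6 + ?H \<omega> ^ 6) / \<tau> ^ 3)"
    using iZ response_second_moment(1)[OF jk] moments(1) trunc_prod_error[OF \<tau>]
    by (intro integral_mono) auto
  also have "\<dots> = expectation (\<lambda>\<omega>. y \<omega> ^ 6 + ?H \<omega> ^ 6) / \<tau> ^ 3"
    by simp
  also have "\<dots> \<le> (Ky + 1) * M6 / \<tau> ^ 3"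
    using moments(2) \<tau> by (intro divide_right_mono) auto
  finally show "\<bar>expectation ?Z - expectation (\<lambda>\<omega>. (y \<omega>)\<^sup>2 * ?H \<omega>)\<bar> \<le> (Ky + 1) * M6 / \<tau> ^ 3" .
  have "expectation (\<lambda>\<omega>. (?Z \<omega>)\<^sup>2) \<le> expectation (\<lambda>\<omega>. y \<omega> ^ 6 + ?H \<omega> ^ 6)"
  proof (rule integral_mono_AE'[OF moments(1)])
    show "AE \<omega> in M. (?Z \<omega>)\<^sup>2 \<le> y \<omega> ^ 6 + ?H \<omega> ^ 6"
      by (intro AE_I2 trunc_prod_squared_le)
  qed auto
  then show "expectation (\<lambda>\<omega>. (?Z \<omega>)\<^sup>2) \<le> (Ky + 1) * M6"
    using moments(2) by simp
qed

text \<open>The choice of \<open>\<tau>\<close> makes M6 / \<tau>^3 = \<rho> and n * M6 / \<tau>^6 =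
  L. The bias is then at most (Ky + 1) \<rho>, and a deviation of (Ky + 3) \<rho> against the second
  moment (Ky + 1) M6 leaves exactly the exponent -2 L; the two add up to (2 Ky + 4) \<rho>. Since
  exp (- L) = \<delta> / (2 d^2), the factor 2 in the exponent lets a union over d^2 entries cost
  only half of \<delta>.\<close>

lemma truncated_entry_tail:
  fixes n :: nat and \<tau> L :: real
  defines "\<rho> \<equiv> sqrt (M6 * L / real n)"
  assumes iid: "iid_samples M d n y x ys xs" and n: "1 \<le> n" and L: "0 < L"
    and \<tau>: "\<tau> = (real n * M6 / L) powr (1 / 6)" and jk: "j < d" "k < d"
  shows "prob {\<omega> \<in> space M. \<bar>1 / real n * (\<Sum>i<n. trunc_prod \<tau> (ys i \<omega>) (score2_in d px j k (xs i \<omega>)))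
      - (2 * curvature M d x f \<beta> * (\<beta> j * \<beta> k) + 2 * curvature M d x g \<gamma> * (\<gamma> j * \<gamma> k))\<bar>
        \<ge> (2 * Ky + 4) * \<rho>} \<le> 2 * exp (- 2 * L)"
proof -
  note [measurable] = H_measurable[OF jk]
  define W where "W = (\<lambda>z. trunc_prod \<tau> (fst z) (score2_in d px j k (snd z)))"
  let ?N = "borel \<Otimes>\<^sub>M Rd d"
  define m where "m = expectation (\<lambda>\<omega>. W (y \<omega>, x \<omega>))"
  define \<Sigma> where "\<Sigma> = 2 * curvature M d x f \<beta> * (\<beta> j * \<beta> k) + 2 * curvature M d x g \<gamma> * (\<gamma> j * \<gamma> k)"
  have W [measurable]: "W \<in> borel_measurable ?N"
    unfolding W_def trunc_prod_def by measurable
  have n0: "0 < real n" using n by simp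
  have base: "0 < real n * M6 / L" using n0 M6_pos L by simp
  have \<tau>0: "0 < \<tau>" using n0 M6_pos L by (simp add: \<tau>)
  have \<tau>6: "\<tau> ^ 6 = real n * M6 / L"
    using n0 M6_pos L base by (simp add: \<tau> powr_realpow[symmetric] powr_powr)
  have \<rho>: "M6 / \<tau> ^ 3 = \<rho>"
  proof -
    have "(M6 / \<tau> ^ 3)\<^sup>2 = M6\<^sup>2 / \<tau> ^ 6" by (simp add: power_divide flip: power_mult)
    also have "\<dots> = M6 * L / real n" using n0 M6_pos L by (simp add: \<tau>6 power2_eq_square field_simps)
    finally show ?thesis
      unfolding \<rho>_def using M6_pos \<tau>0 by (intro real_sqrt_unique[symmetric]) auto
  qed
  have ind: "indep_vars (\<lambda>_. ?N) (\<lambda>i \<omega>. (ys i \<omega>, xs i \<omega>)) {..<n}"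
    using iid by (simp add: iid_samples_def)
  have yx: "(\<lambda>\<omega>. (y \<omega>, x \<omega>)) \<in> measurable M ?N" by measurable
  have same: "expectation (\<lambda>\<omega>. F (ys i \<omega>, xs i \<omega>)) = expectation (\<lambda>\<omega>. F (y \<omega>, x \<omega>))"
    if i: "i < n" and F: "F \<in> borel_measurable ?N" for i and F :: "real \<times> rvec \<Rightarrow> real"
  proof -
    have yxi: "(\<lambda>\<omega>. (ys i \<omega>, xs i \<omega>)) \<in> measurable M ?N"
      using ind i by (simp add: indep_vars_def)
    show ?thesis
      using iid i integral_distr[OF yxi F] integral_distr[OF yx F] by (simp add: iid_samples_def)
  qed
  have tail: "prob {\<omega> \<in> space M. \<bar>1 / real n * (\<Sum>i<n. W (ys i \<omega>, xs i \<omega>)) - m\<bar> \<ge> (Ky + 3) * \<rho>}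
    \<le> 2 * exp (real n * ((Ky + 1) * M6 / (\<tau> ^ 3)\<^sup>2 - (Ky + 3) * \<rho> / \<tau> ^ 3))"
  proof (rule bounded_mean_tail[OF n])
    show "0 < \<tau> ^ 3" using \<tau>0 by simp
    show "indep_vars (\<lambda>_. borel) (\<lambda>i \<omega>. W (ys i \<omega>, xs i \<omega>)) {..<n}"
      by (rule indep_vars_compose2[OF ind W])
    show "\<bar>W (ys i \<omega>, xs i \<omega>)\<bar> \<le> \<tau> ^ 3" for i \<omega>
      using trunc_prod_abs_le[of \<tau>] \<tau>0 by (simp add: W_def)
    show "expectation (\<lambda>\<omega>. W (ys i \<omega>, xs i \<omega>)) = m" if "i < n" for i
      unfolding m_def by (rule same[OF that W])
    show "expectation (\<lambda>\<omega>. (W (ys i \<omega>, xs i \<omega>))\<^sup>2) \<le> (Ky + 1) * M6" if "i < n" for i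
    proof -
      have "expectation (\<lambda>\<omega>. (W (ys i \<omega>, xs i \<omega>))\<^sup>2) = expectation (\<lambda>\<omega>. (W (y \<omega>, x \<omega>))\<^sup>2)"
        by (rule same[OF that, of "\<lambda>z. (W z)\<^sup>2"]) measurable
      then show ?thesis using truncated_entry_bias(2)[OF jk \<tau>0] by (simp add: W_def)
    qed
  qed
  have e1: "real n * (M6 / \<tau> ^ 6) = L" using n0 M6_pos L by (simp add: \<tau>6)
  have "real n * ((Ky + 1) * M6 / (\<tau> ^ 3)\<^sup>2 - (Ky + 3) * \<rho> / \<tau> ^ 3)
      = (Ky + 1) * (real n * (M6 / \<tau> ^ 6)) - (Ky + 3) * (real n * (M6 / \<tau> ^ 6))"
    by (simp add: \<rho>[symmetric] algebra_simps flip: power_mult power_add)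
  also have "\<dots> = - 2 * L" unfolding e1 by (simp add: algebra_simps)
  finally have expo: "real n * ((Ky + 1) * M6 / (\<tau> ^ 3)\<^sup>2 - (Ky + 3) * \<rho> / \<tau> ^ 3) = - 2 * L" .
  have bias: "\<bar>m - \<Sigma>\<bar> \<le> (Ky + 1) * \<rho>"
    using truncated_entry_bias(1)[OF jk \<tau>0]
    by (simp add: m_def W_def \<Sigma>_def response_second_moment(2)[OF jk] \<rho>[symmetric])
  have "(\<lambda>\<omega>. W (ys i \<omega>, xs i \<omega>)) \<in> borel_measurable M" if "i < n" for i
    using ind that by (intro measurable_compose[OF _ W]) (simp add: indep_vars_def)
  then have "(\<lambda>\<omega>. \<bar>1 / real n * (\<Sum>i<n. W (ys i \<omega>, xs i \<omega>)) - m\<bar>) \<in> borel_measurable M"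
    by measurable
  then have ev: "{\<omega> \<in> space M. \<bar>1 / real n * (\<Sum>i<n. W (ys i \<omega>, xs i \<omega>)) - m\<bar> \<ge> (Ky + 3) * \<rho>} \<in> events"
    by measurable
  have "{\<omega> \<in> space M. \<bar>1 / real n * (\<Sum>i<n. W (ys i \<omega>, xs i \<omega>)) - \<Sigma>\<bar> \<ge> (2 * Ky + 4) * \<rho>}
      \<subseteq> {\<omega> \<in> space M. \<bar>1 / real n * (\<Sum>i<n. W (ys i \<omega>, xs i \<omega>)) - m\<bar> \<ge> (Ky + 3) * \<rho>}"
  proof safe
    fix \<omega> assume "(2 * Ky + 4) * \<rho> \<le> \<bar>1 / real n * (\<Sum>i<n. W (ys i \<omega>, xs i \<omega>)) - \<Sigma>\<bar>"
    then show "(Ky + 3) * \<rho> \<le> \<bar>1 / real n * (\<Sum>i<n. W (ys i \<omega>, xs i \<omega>)) - m\<bar>"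
      using bias by (simp add: distrib_right)
  qed
  from order_trans[OF finite_measure_mono[OF this ev] tail[unfolded expo]] show ?thesis
    by (simp add: \<Sigma>_def W_def)
qed

end

end

subsection \<open>The estimation error\<close>

text \<open>With \<open>q = sqrt (L / n)\<close> and \<open>\<rho> = sqrt M6 * q\<close>, the bounds \<open>q \<le> R * \<rho>\<close> and \<open>s * q \<le> K\<close> hold
  unless the claim is trivial; inserting them into \<open>deflate_error\<close> gives the constant.\<close>

definition deflation_constant :: "real \<Rightarrow> real \<Rightarrow> real \<Rightarrow> real \<Rightarrow> real \<Rightarrow> real \<Rightarrow> real" where
  "deflation_constant c1 a \<eta> \<mu> B G =
    (let R = 3 * G\<^sup>2 / (2 * \<bar>\<mu>\<bar>); K = \<bar>\<mu>\<bar> * R / 4 in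
      max 1 (c1 + 2 * \<bar>\<eta>\<bar> * (a * R * (2 + a * K))
        + (1 + a * K)\<^sup>2 * (c1 * (B + a * K)\<^sup>2 + 2 * \<bar>\<eta>\<bar> * (B * (a * R) * (2 + B * (a * K)))
          + 2 * \<bar>\<mu>\<bar> * (G\<^sup>2 * (a * R) * (a * K)))))"

lemma good_event_error:
  fixes q \<rho> l c1 c M6 \<eta> \<mu> :: real
  assumes beta: "norm2 d \<beta> = 1" and gamma: "norm2 d \<gamma> = 1" and orth: "dotp d \<beta> \<gamma> = 0"
    and s: "norm0 d \<gamma> \<le> s" and \<mu>: "\<mu> \<noteq> 0" and q: "0 \<le> q" and c1: "0 \<le> c1"
    and \<rho>: "\<rho> = sqrt M6 * q" and M6: "0 < M6" "2 * \<bar>\<mu>\<bar> \<le> 3 * sqrt M6 * (norm1 d \<gamma>)\<^sup>2"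
    and U: "\<And>j k. j < d \<Longrightarrow> k < d \<Longrightarrow>
      \<bar>U j k - (2 * \<eta> * (\<beta> j * \<beta> k) + 2 * \<mu> * (\<gamma> j * \<gamma> k))\<bar> \<le> c1 * \<rho>"
    and b_inf: "\<And>j. j < d \<Longrightarrow> \<bar>b j - \<beta> j\<bar> \<le> c * q"
    and b_1: "norm1 d (\<lambda>j. b j - \<beta> j) \<le> c * (real s * q)"
    and l: "deflation_constant c1 \<bar>c\<bar> \<eta> \<mu> (norm1 d \<beta>) (norm1 d \<gamma>) * \<rho> \<le> l"
    and T: "is_T d l (\<lambda>j k. sgn \<mu> * deflate d U b j k) 1 V"
    and lead: "is_leading_direction d V v"
  shows "Min ((\<lambda>\<iota>. norm2 d (\<lambda>j. \<iota> * v j - \<gamma> j)) ` {1, -1}) \<le> 4 * sqrt 2 * real s * l / \<bar>\<mu>\<bar>"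
proof -
  define a where "a = \<bar>c\<bar>"
  define B where "B = norm1 d \<beta>"
  define G where "G = norm1 d \<gamma>"
  define R where "R = 3 * G\<^sup>2 / (2 * \<bar>\<mu>\<bar>)"
  define K where "K = \<bar>\<mu>\<bar> * R / 4"
  define C where "C = deflation_constant c1 a \<eta> \<mu> B G"
  have nn: "0 \<le> a" "0 \<le> B" "0 \<le> G" "0 \<le> R" "0 \<le> K"
    by (auto simp: a_def B_def G_def R_def K_def norm1_def sum_nonneg)
  have \<rho>0: "0 \<le> \<rho>" using q M6 by (simp add: \<rho>)
  \<comment> \<open>The floor 1 in the constant yields \<rho> <= l, so that l is nonnegative and
    smallness of s * l implies smallness of s * \<rho>.\<close>
  have C1: "1 \<le> C" by (simp add: C_def deflation_constant_def Let_def)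
  have l': "C * \<rho> \<le> l" using l by (simp add: C_def a_def B_def G_def)
  have \<rho>l: "\<rho> \<le> l" using mult_right_mono[OF C1 \<rho>0] l' by simp
  then have l0: "0 \<le> l" using \<rho>0 by simp
  have \<mu>0: "0 < \<bar>\<mu>\<bar>" using \<mu> by simp
  define D where "D = Min ((\<lambda>\<iota>. norm2 d (\<lambda>j. \<iota> * v j - \<gamma> j)) ` {1, -1})"
  have norm_v: "norm2 d v \<le> 1" using lead by (simp add: is_leading_direction_def is_arg_max_def)
  show ?thesis
  proof (cases "\<bar>\<mu>\<bar> \<le> 4 * real s * l")
    case True
    have "D\<^sup>2 \<le> 2"
      using sign_distance_squared[OF gamma norm_v] unfolding D_def by linarith
    then have "D \<le> sqrt 2" by (rule real_le_rsqrt)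
    also have "\<dots> \<le> sqrt 2 * (4 * real s * l / \<bar>\<mu>\<bar>)"
      using True \<mu>0 by (simp add: mult_le_cancel_left1 pos_le_divide_eq)
    finally show ?thesis by (simp add: D_def mult_ac)
  next
    case False
    obtain i where i: "i < d" "\<gamma> i \<noteq> 0" using norm2_one_nonzero[OF gamma] by blast
    have "0 < norm0 d \<gamma>" unfolding norm0_def using i by (intro card_gt_0_iff[THEN iffD2]) auto
    then have s1: "1 \<le> real s" using s by simp
    \<comment> \<open>The bound of |mu2| by sqrt M6 supplies the factor sqrt M6 by which
      \<open>\<rho>\<close> exceeds \<open>q\<close>.\<close>
    have qR: "q \<le> R * \<rho>"
    proof -
      have "2 * \<bar>\<mu>\<bar> * q \<le> 3 * sqrt M6 * G\<^sup>2 * q"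
        using M6(2) q unfolding G_def by (rule mult_right_mono)
      then show ?thesis using \<mu>0 by (simp add: R_def \<rho> field_simps)
    qed
    have "4 * real s * \<rho> \<le> 4 * real s * l" using \<rho>l by (intro mult_left_mono) auto
    then have "4 * (real s * \<rho>) < \<bar>\<mu>\<bar>" using False by simp
    then have "R * (4 * (real s * \<rho>)) \<le> R * \<bar>\<mu>\<bar>" using nn(4) by (intro mult_left_mono) auto
    moreover have "real s * q \<le> real s * (R * \<rho>)" using qR by (rule mult_left_mono) simp
    ultimately have sqK: "real s * q \<le> K" by (simp add: K_def mult_ac)
    then have qK: "q \<le> K" using mult_right_mono[OF s1 q] by simp
    define \<Delta> where "\<Delta> = a * q"
    have \<Delta>: "0 \<le> \<Delta>" "\<Delta> \<le> a * K" "\<Delta> \<le> a * R * \<rho>"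
      using nn q qK qR by (auto simp: \<Delta>_def mult.assoc intro!: mult_left_mono)
    have cq: "c * t \<le> a * t" if "0 \<le> t" for t
      using that by (auto simp: a_def intro: mult_right_mono)
    have b1: "norm1 d (\<lambda>j. b j - \<beta> j) \<le> a * K"
    proof -
      have "a * (real s * q) \<le> a * K" using nn(1) sqK by (intro mult_left_mono)
      then show ?thesis using b_1 cq[of "real s * q"] q by simp
    qed
    have b_inf': "\<bar>b j - \<beta> j\<bar> \<le> \<Delta>" if "j < d" for j
      using b_inf[OF that] cq[OF q] by (simp add: \<Delta>_def)
    \<comment> \<open>In each product containing \<open>\<Delta>\<close> but not yet
      \<open>\<rho>\<close>, one factor \<open>\<Delta>\<close> is replaced by
      \<open>a * R * \<rho>\<close>; all others become the constant \<open>a * K\<close>. The total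
      is thus linear in \<open>\<rho>\<close>.\<close>
    have total: "c1 * \<rho> + 2 * \<bar>\<eta>\<bar> * (\<Delta> * (2 + \<Delta>))
      + (1 + \<Delta>)\<^sup>2 * (c1 * \<rho> * (B + a * K)\<^sup>2 + 2 * \<bar>\<eta>\<bar> * (B * \<Delta> * (2 + B * \<Delta>)) + 2 * \<bar>\<mu>\<bar> * (G * \<Delta>)\<^sup>2)
      \<le> C * \<rho>"
    proof -
      have nn': "0 \<le> a * K" "0 \<le> a * R * \<rho>" "0 \<le> B * \<Delta>" "0 \<le> B * (a * R * \<rho>)" "0 \<le> B * (a * K)"
        using nn \<rho>0 \<Delta>(1) by (simp_all add: mult_nonneg_nonneg)
      have t1: "\<Delta> * (2 + \<Delta>) \<le> a * R * \<rho> * (2 + a * K)"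
        by (rule mult_mono) (use \<Delta> nn' in linarith)+
      have t2: "B * \<Delta> * (2 + B * \<Delta>) \<le> B * (a * R * \<rho>) * (2 + B * (a * K))"
      proof (rule mult_mono)
        show "B * \<Delta> \<le> B * (a * R * \<rho>)" using \<Delta>(3) nn(2) by (rule mult_left_mono)
        have "B * \<Delta> \<le> B * (a * K)" using \<Delta>(2) nn(2) by (rule mult_left_mono)
        then show "2 + B * \<Delta> \<le> 2 + B * (a * K)" by simp
      qed (use nn' in linarith)+
      have "(G * \<Delta>)\<^sup>2 = G\<^sup>2 * (\<Delta> * \<Delta>)" by (simp add: power2_eq_square)
      also have "\<dots> \<le> G\<^sup>2 * ((a * R * \<rho>) * (a * K))"
        by (intro mult_left_mono mult_mono) (use \<Delta> nn' in auto)
      finally have t3: "(G * \<Delta>)\<^sup>2 \<le> G\<^sup>2 * ((a * R * \<rho>) * (a * K))" .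
      have t4: "(1 + \<Delta>)\<^sup>2 \<le> (1 + a * K)\<^sup>2" using \<Delta> by (intro power_mono) auto
      have "c1 * \<rho> + 2 * \<bar>\<eta>\<bar> * (\<Delta> * (2 + \<Delta>))
          + (1 + \<Delta>)\<^sup>2 * (c1 * \<rho> * (B + a * K)\<^sup>2 + 2 * \<bar>\<eta>\<bar> * (B * \<Delta> * (2 + B * \<Delta>)) + 2 * \<bar>\<mu>\<bar> * (G * \<Delta>)\<^sup>2)
        \<le> c1 * \<rho> + 2 * \<bar>\<eta>\<bar> * (a * R * \<rho> * (2 + a * K))
          + (1 + a * K)\<^sup>2 * (c1 * \<rho> * (B + a * K)\<^sup>2 + 2 * \<bar>\<eta>\<bar> * (B * (a * R * \<rho>) * (2 + B * (a * K)))
            + 2 * \<bar>\<mu>\<bar> * (G\<^sup>2 * ((a * R * \<rho>) * (a * K))))"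
      proof (intro add_mono order_refl mult_mono[OF t4] mult_left_mono t1 t2 t3)
        have "0 \<le> c1 * \<rho> * (B + a * K)\<^sup>2" using c1 \<rho>0 by simp
        moreover have "0 \<le> 2 * \<bar>\<eta>\<bar> * (B * \<Delta> * (2 + B * \<Delta>))"
          using nn'(3) by simp
        ultimately show "0 \<le> c1 * \<rho> * (B + a * K)\<^sup>2 + 2 * \<bar>\<eta>\<bar> * (B * \<Delta> * (2 + B * \<Delta>)) + 2 * \<bar>\<mu>\<bar> * (G * \<Delta>)\<^sup>2"
          by simp
      qed auto
      also have "\<dots> = (c1 + 2 * \<bar>\<eta>\<bar> * (a * R * (2 + a * K))
        + (1 + a * K)\<^sup>2 * (c1 * (B + a * K)\<^sup>2 + 2 * \<bar>\<eta>\<bar> * (B * (a * R) * (2 + B * (a * K)))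
          + 2 * \<bar>\<mu>\<bar> * (G\<^sup>2 * (a * R) * (a * K)))) * \<rho>"
        by (simp add: algebra_simps)
      also have "\<dots> \<le> C * \<rho>"
        unfolding C_def deflation_constant_def Let_def R_def[symmetric] K_def[symmetric]
        using \<rho>0 by (intro mult_right_mono) auto
      finally show ?thesis .
    qed
    have A: "\<bar>sgn \<mu> * deflate d U b j k - 2 * \<bar>\<mu>\<bar> * (\<gamma> j * \<gamma> k)\<bar> \<le> l" if jk: "j < d" "k < d" for j k
    proof -
      have "\<bar>deflate d U b j k - 2 * \<mu> * (\<gamma> j * \<gamma> k)\<bar> \<le> C * \<rho>"
        by (rule order_trans[OF deflate_error[OF beta orth U _ \<Delta>(1) b_inf' b1 jk] total[unfolded B_def G_def]])
           (use c1 \<rho>0 in auto)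
      moreover have "sgn \<mu> * deflate d U b j k - 2 * \<bar>\<mu>\<bar> * (\<gamma> j * \<gamma> k)
          = sgn \<mu> * (deflate d U b j k - 2 * \<mu> * (\<gamma> j * \<gamma> k))"
        by (simp add: abs_sgn algebra_simps)
      ultimately show ?thesis using l' \<mu> by (simp add: abs_mult abs_sgn_eq)
    qed
    have V: "fantope d 1 V" using T by (simp add: is_T_def is_arg_max_def)
    have "D \<le> 2 * sqrt (msum d (\<lambda>j k. (V j k - \<gamma> j * \<gamma> k)\<^sup>2))"
      unfolding D_def by (rule leading_direction_error[OF V gamma lead])
    also have "\<dots> \<le> 2 * (2 * real s * l / \<bar>\<mu>\<bar>)"
      by (intro mult_left_mono is_T_frobenius_error[OF T gamma s \<mu>0 l0 A]) auto
    also have "\<dots> = 1 * (4 * real s * l / \<bar>\<mu>\<bar>)" by simp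
    \<comment> \<open>This regime does not produce the factor sqrt 2. It is there for the other
      regime, where it makes the claimed bound at least the trivial bound sqrt 2 on the
      distance.\<close>
    also have "\<dots> \<le> sqrt 2 * (4 * real s * l / \<bar>\<mu>\<bar>)"
      using l0 by (intro mult_right_mono) auto
    finally show ?thesis by (simp add: D_def mult_ac)
  qed
qed

text \<open>The good event is compared with others only up to null sets, and for that its
  measurability is required.\<close>

lemma sign_distance_measurable:
  assumes "\<gamma>h \<in> measurable M (Rd d)"
  shows "{\<omega> \<in> space M. Min ((\<lambda>\<iota>. norm2 d (\<lambda>j. \<iota> * \<gamma>h \<omega> j - \<gamma> j)) ` {1, -1 :: real}) \<le> r} \<in> sets M"
proof -
  have [measurable]: "(\<lambda>\<omega>. \<gamma>h \<omega> j) \<in> borel_measurable M" if "j < d" for j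
    by (rule measurable_compose[OF assms measurable_Rd_component[OF that]])
  have [measurable]: "(\<lambda>\<omega>. norm2 d (\<lambda>j. \<iota> * \<gamma>h \<omega> j - \<gamma> j)) \<in> borel_measurable M" for \<iota> :: real
    unfolding norm2_def L2_set_def by measurable
  have "(\<lambda>\<omega>. min (norm2 d (\<lambda>j. 1 * \<gamma>h \<omega> j - \<gamma> j)) (norm2 d (\<lambda>j. - 1 * \<gamma>h \<omega> j - \<gamma> j)))
      \<in> borel_measurable M"
    by (rule borel_measurable_min) measurable
  then show ?thesis by simp
qed

theorem theorem3p8:
  fixes p c Ke Ky :: real
  assumes "p \<ge> 6"
  shows "\<exists>C' :: real \<Rightarrow> real \<Rightarrow> real \<Rightarrow> real \<Rightarrow> real.
    \<forall>(M :: 'a measure) (d :: nat) (n :: nat) (s :: nat)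
      (x :: 'a \<Rightarrow> rvec) (px :: rvec \<Rightarrow> real) (\<epsilon> :: 'a \<Rightarrow> real)
      (f :: real \<Rightarrow> real) (g :: real \<Rightarrow> real) (\<beta> :: rvec) (\<gamma> :: rvec)
      (Mp :: real) (M6 :: real) (ys :: nat \<Rightarrow> 'a \<Rightarrow> real) (xs :: nat \<Rightarrow> 'a \<Rightarrow> rvec)
      (\<beta>h :: 'a \<Rightarrow> rvec) (\<eta>2 :: real) (\<mu>2 :: real).
      1 \<le> n \<and>
      index_volatility_model M d x px \<epsilon> f g \<beta> \<gamma> \<and>
      second_order_regular M d x px (\<lambda>u. (f (dotp d u \<beta>))\<^sup>2) \<and>
      second_order_regular M d x px (\<lambda>u. (g (dotp d u \<gamma>))\<^sup>2) \<and>
      max (norm0 d \<beta>) (norm0 d \<gamma>) \<le> s \<and>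
      dotp d \<beta> \<gamma> = 0 \<and>
      curvature_exists M d x f \<beta> \<and> \<eta>2 = curvature M d x f \<beta> \<and>
      curvature_exists M d x g \<gamma> \<and> \<mu>2 = curvature M d x g \<gamma> \<and> \<mu>2 \<noteq> 0 \<and>
      finite_moments M d x px \<epsilon> f g \<beta> \<gamma> Ke Ky p Mp \<and>
      finite_moments M d x px \<epsilon> f g \<beta> \<gamma> Ke Ky 6 M6 \<and>
      iid_samples M d n (response d f g \<beta> \<gamma> x \<epsilon>) x ys xs \<and>
      indep_of_samples M d n ys xs \<beta>h \<and>
      estimator_rate M d n s c \<beta> \<beta>h \<longrightarrow>
      (\<forall>(\<delta> :: real) (\<tau> :: real) (l :: real) (Vbar :: 'a \<Rightarrow> rmat) (\<gamma>h :: 'a \<Rightarrow> rvec).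
        0 < \<delta> \<and> \<delta> < 1 \<and>
        \<tau> = (real n * M6 / ln (2 * (real d)\<^sup>2 / \<delta>)) powr (1 / 6) \<and>
        l \<ge> C' \<eta>2 \<mu>2 (norm1 d \<beta>) (norm1 d \<gamma>) * sqrt (M6 * ln (2 * (real d)\<^sup>2 / \<delta>) / real n) \<and>
        (\<forall>\<omega>\<in>space M.
           is_T d l (\<lambda>j k. sgn \<mu>2 * deflate d (U_tilde n \<tau> px ys xs \<omega>) (\<beta>h \<omega>) j k) 1 (Vbar \<omega>)) \<and>
        \<gamma>h \<in> measurable M (Rd d) \<and>
        (\<forall>\<omega>\<in>space M. is_leading_direction d (Vbar \<omega>) (\<gamma>h \<omega>)) \<longrightarrow>
        measure M {\<omega> \<in> space M.
            Min ((\<lambda>\<iota>. norm2 d (\<lambda>j. \<iota> * \<gamma>h \<omega> j - \<gamma> j)) ` {1, -1})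
              \<le> 4 * sqrt 2 * real s * l / \<bar>\<mu>2\<bar>} \<ge> 1 - \<delta>)"
proof (intro exI allI impI, elim conjE)
  fix M :: "'a measure" and d n s :: nat and x :: "'a \<Rightarrow> rvec" and px :: "rvec \<Rightarrow> real"
    and \<epsilon> :: "'a \<Rightarrow> real" and f g :: "real \<Rightarrow> real" and \<beta> \<gamma> :: rvec and Mp M6 :: real
    and ys :: "nat \<Rightarrow> 'a \<Rightarrow> real" and xs :: "nat \<Rightarrow> 'a \<Rightarrow> rvec" and \<beta>h :: "'a \<Rightarrow> rvec" and \<eta>2 \<mu>2 :: real
    and \<delta> \<tau> l :: real and Vbar :: "'a \<Rightarrow> rmat" and \<gamma>h :: "'a \<Rightarrow> rvec"
  define L where "L = ln (2 * (real d)\<^sup>2 / \<delta>)"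
  define \<rho> where "\<rho> = sqrt (M6 * L / real n)"
  define q where "q = sqrt (L / real n)"
  define c1 where "c1 = 2 * Ky + 4"
  \<comment> \<open>The witness for C' stayed schematic after \<open>exI\<close> and is fixed by the
    assumption \<open>l'\<close>: it is
    \<open>deflation_constant (2 * Ky + 4) \<bar>c\<bar>\<close>. It depends on \<open>Ky\<close>
    and \<open>c\<close>, which are fixed outside the statement, but on none of the quantified model
    data except through its four arguments.\<close>
  assume n: "1 \<le> n" and model: "index_volatility_model M d x px \<epsilon> f g \<beta> \<gamma>"
    and reg2: "second_order_regular M d x px (\<lambda>u. (f (dotp d u \<beta>))\<^sup>2)"
    and s: "max (norm0 d \<beta>) (norm0 d \<gamma>) \<le> s" and orth: "dotp d \<beta> \<gamma> = 0"
    and curvs: "curvature_exists M d x f \<beta>" "curvature_exists M d x g \<gamma>"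
    and \<eta>2: "\<eta>2 = curvature M d x f \<beta>" and \<mu>2: "\<mu>2 = curvature M d x g \<gamma>" "\<mu>2 \<noteq> 0"
    and fin: "finite_moments M d x px \<epsilon> f g \<beta> \<gamma> Ke Ky 6 M6"
    and iid: "iid_samples M d n (response d f g \<beta> \<gamma> x \<epsilon>) x ys xs"
    and rate: "estimator_rate M d n s c \<beta> \<beta>h"
    and \<delta>: "0 < \<delta>" "\<delta> < 1"
    and \<tau>': "\<tau> = (real n * M6 / ln (2 * (real d)\<^sup>2 / \<delta>)) powr (1 / 6)"
    and l': "deflation_constant (2 * Ky + 4) \<bar>c\<bar> \<eta>2 \<mu>2 (norm1 d \<beta>) (norm1 d \<gamma>)
      * sqrt (M6 * ln (2 * (real d)\<^sup>2 / \<delta>) / real n) \<le> l"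
    and T: "\<forall>\<omega>\<in>space M. is_T d l (\<lambda>j k. sgn \<mu>2 * deflate d (U_tilde n \<tau> px ys xs \<omega>) (\<beta>h \<omega>) j k) 1 (Vbar \<omega>)"
    and \<gamma>h: "\<gamma>h \<in> measurable M (Rd d)"
    and lead: "\<forall>\<omega>\<in>space M. is_leading_direction d (Vbar \<omega>) (\<gamma>h \<omega>)"
  interpret index_volatility_model M d x px \<epsilon> f g \<beta> \<gamma> by (rule model)
  have reg: "regular_density M d x px" using reg2 by (simp add: second_order_regular_def)
  note Mpos = M6_pos[OF reg fin curvs]
  note Ky = Ky_nonneg[OF reg fin curvs]
  obtain i0 where "i0 < d" using norm2_one_nonzero[OF unit_vectors(1)] by blast
  then have d1: "1 \<le> real d" by simp
  then have d2: "1 \<le> (real d)\<^sup>2" by simp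
  have arg: "2 * (real d)\<^sup>2 / \<delta> > 1" using d2 \<delta> by (simp add: less_divide_eq)
  have L: "0 < L" using arg by (simp add: L_def)
  have n0: "0 < real n" using n by simp
  have \<tau>: "\<tau> = (real n * M6 / L) powr (1 / 6)" using \<tau>' by (simp add: L_def)
  have q0: "0 \<le> q" using L by (simp add: q_def)
  have \<rho>: "\<rho> = sqrt M6 * q" by (simp add: \<rho>_def q_def flip: real_sqrt_mult)
  define \<Sigma> where "\<Sigma> j k = 2 * \<eta>2 * (\<beta> j * \<beta> k) + 2 * \<mu>2 * (\<gamma> j * \<gamma> k)" for j k
  define S where "S j k \<omega> = 1 / real n * (\<Sum>i<n. trunc_prod \<tau> (ys i \<omega>) (score2_in d px j k (xs i \<omega>)))" for j k \<omega>
  define Bad where "Bad j k = {\<omega> \<in> space M. c1 * \<rho> \<le> \<bar>S j k \<omega> - \<Sigma> j k\<bar>}" for j k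
  have pairs: "(\<lambda>\<omega>. (ys i \<omega>, xs i \<omega>)) \<in> measurable M (borel \<Otimes>\<^sub>M Rd d)" if "i < n" for i
    using iid that by (simp add: iid_samples_def indep_vars_def)
  have Bad: "Bad j k \<in> events" "prob (Bad j k) \<le> 2 * exp (- 2 * L)" if jk: "j < d" "k < d" for j k
  proof -
    note [measurable] = score2_in_measurable[OF prob_space_axioms reg jk]
    have "(\<lambda>z. trunc_prod \<tau> (fst z) (score2_in d px j k (snd z))) \<in> borel_measurable (borel \<Otimes>\<^sub>M Rd d)"
      unfolding trunc_prod_def by measurable
    from measurable_compose[OF pairs this]
    have "(\<lambda>\<omega>. S j k \<omega>) \<in> borel_measurable M" unfolding S_def by simp
    then show "Bad j k \<in> events" unfolding Bad_def by measurable
    show "prob (Bad j k) \<le> 2 * exp (- 2 * L)"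
      using truncated_entry_tail[OF reg fin curvs iid n L \<tau> jk]
      by (simp add: Bad_def S_def \<Sigma>_def \<rho>_def \<eta>2 \<mu>2(1) c1_def)
  qed
  define BadU where "BadU = (\<Union>z\<in>{..<d} \<times> {..<d}. Bad (fst z) (snd z))"
  have BadU: "BadU \<in> events" unfolding BadU_def using Bad(1) by (intro sets.finite_UN) auto
  have "prob BadU \<le> (\<Sum>z\<in>{..<d} \<times> {..<d}. prob (Bad (fst z) (snd z)))"
    unfolding BadU_def using Bad(1) by (intro measure_UNION_le) auto
  also have "\<dots> \<le> (\<Sum>z\<in>{..<d} \<times> {..<d}. 2 * exp (- 2 * L))"
    using Bad(2) by (intro sum_mono) auto
  also have "\<dots> = 2 * (real d)\<^sup>2 * exp (- 2 * L)"
    by (simp add: power2_eq_square)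
  also have "exp (- 2 * L) = (\<delta> / (2 * (real d)\<^sup>2))\<^sup>2"
  proof -
    have "exp (- 2 * L) = (exp (- L))\<^sup>2" by (simp flip: exp_of_nat_mult)
    also have "exp (- L) = \<delta> / (2 * (real d)\<^sup>2)"
      using arg by (simp add: L_def exp_minus)
    finally show ?thesis .
  qed
  also have "2 * (real d)\<^sup>2 * (\<delta> / (2 * (real d)\<^sup>2))\<^sup>2 = \<delta> * \<delta> / (2 * (real d)\<^sup>2)"
    using d2 by (simp add: power2_eq_square)
  also have "\<dots> \<le> 1 * \<delta> / (2 * 1)"
    using \<delta> d2 by (intro frac_le mult_mono) auto
  finally have PBadU: "prob BadU \<le> \<delta> / 2" by simp
  define E where "E = {\<omega> \<in> space M.
      norm2 d (\<lambda>j. \<beta>h \<omega> j - \<beta> j) \<le> c * sqrt (real s * ln (real d / (\<delta> / 2)) / real n) \<and>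
      norm1 d (\<lambda>j. \<beta>h \<omega> j - \<beta> j) \<le> c * (real s * sqrt (ln (real d / (\<delta> / 2)) / real n)) \<and>
      norm_inf d (\<lambda>j. \<beta>h \<omega> j - \<beta> j) \<le> c * sqrt (ln (real d / (\<delta> / 2)) / real n)}"
  have PE: "1 - \<delta> / 2 \<le> prob E"
    using rate[unfolded estimator_rate_def, rule_format, of "\<delta> / 2"] \<delta> by (simp only: E_def) simp
  \<comment> \<open>A set that is not measurable has measure 0 by convention, and \<open>E\<close>
    has measure at least 1 - \<delta> / 2 > 0.\<close>
  then have E: "E \<in> events" using \<delta> measure_notin_sets[of E M] by fastforce
  define q' where "q' = sqrt (ln (real d / (\<delta> / 2)) / real n)"
  \<comment> \<open>The rates are used at level \<delta> / 2, the other half of the failure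
    probability. Their logarithm ln (2 d / \<delta>) is at most L because d >= 1.\<close>
  have q': "0 \<le> q'" "q' \<le> q"
  proof -
    have "1 < real d / (\<delta> / 2)" using d1 \<delta> by (simp add: less_divide_eq)
    moreover have "real d / (\<delta> / 2) \<le> 2 * (real d)\<^sup>2 / \<delta>"
      using d1 \<delta> by (simp add: divide_right_mono power2_eq_square)
    ultimately have "0 \<le> ln (real d / (\<delta> / 2))" "ln (real d / (\<delta> / 2)) \<le> L"
      by (auto simp: L_def)
    then show "0 \<le> q'" "q' \<le> q"
      using n0 by (auto simp: q'_def q_def intro!: divide_right_mono)
  qed
  \<comment> \<open>Each sample has the law of \<open>x\<close> and therefore lies in the interior
    almost surely. Only this allows the literal \<open>score2\<close> inside \<open>U_tilde\<close>
    to be replaced by its Borel version.\<close>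
  have samples: "AE \<omega> in M. \<forall>i\<in>{..<n}. \<forall>j k. score2_in d px j k (xs i \<omega>) = score2 px (xs i \<omega>) j k"
  proof (rule AE_finite_allI)
    fix i assume i: "i \<in> {..<n}"
    let ?U = "support_interior d px"
    have U [measurable]: "?U \<in> sets (Rd d)" by (rule sets_Rd_openin[OF support_interior_openin])
    interpret smooth_density d ?U "zero_off ?U px" M x "\<lambda>j. zero_off ?U (partial j px)"
      "\<lambda>j k. zero_off ?U (\<lambda>u. hessian px u j k)"
      by (rule regular_density_smooth[OF prob_space_axioms reg]) (use d1 in simp)
    let ?D = "\<lambda>y x. distr M (borel \<Otimes>\<^sub>M Rd d) (\<lambda>\<omega>. (y \<omega> :: real, x \<omega>))"
    have pred: "{z \<in> space (borel \<Otimes>\<^sub>M Rd d). snd z \<in> ?U} \<in> sets (borel \<Otimes>\<^sub>M Rd d)"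
      by measurable
    have "AE z in ?D (response d f g \<beta> \<gamma> x \<epsilon>) x. snd z \<in> ?U"
      using AE_in_U by (subst AE_distr_iff[OF _ pred]) (auto intro!: measurable_Pair x_measurable)
    moreover have "?D (ys i) (xs i) = ?D (response d f g \<beta> \<gamma> x \<epsilon>) x"
      using iid i by (simp add: iid_samples_def)
    ultimately have "AE z in ?D (ys i) (xs i). snd z \<in> ?U" by (simp only:)
    then have "AE \<omega> in M. xs i \<omega> \<in> ?U"
      using i by (subst (asm) AE_distr_iff[OF _ pred]) (auto intro!: pairs)
    then show "AE \<omega> in M. \<forall>j k. score2_in d px j k (xs i \<omega>) = score2 px (xs i \<omega>) j k"
      by eventually_elim (simp add: score2_in_def zero_off_def)
  qed simp
  define Good where "Good = {\<omega> \<in> space M. Min ((\<lambda>\<iota>. norm2 d (\<lambda>j. \<iota> * \<gamma>h \<omega> j - \<gamma> j)) ` {1, -1})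
      \<le> 4 * sqrt 2 * real s * l / \<bar>\<mu>2\<bar>}"
  have Good: "Good \<in> events" unfolding Good_def by (rule sign_distance_measurable[OF \<gamma>h])
  have "AE \<omega> in M. \<omega> \<in> E - BadU \<longrightarrow> \<omega> \<in> Good"
    using samples
  proof eventually_elim
    case (elim \<omega>)
    show ?case
    proof
      assume \<omega>: "\<omega> \<in> E - BadU"
      then have sp: "\<omega> \<in> space M" by (simp add: E_def)
      have U: "U_tilde n \<tau> px ys xs \<omega> j k = S j k \<omega>" for j k
        unfolding U_tilde_def S_def trunc_prod_def using elim by simp
      have b1: "norm1 d (\<lambda>j. \<beta>h \<omega> j - \<beta> j) \<le> c * (real s * q')"
        and binf: "norm_inf d (\<lambda>j. \<beta>h \<omega> j - \<beta> j) \<le> c * q'"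
        using \<omega> by (auto simp: E_def q'_def)
      have binf': "\<bar>\<beta>h \<omega> j - \<beta> j\<bar> \<le> c * q'" if "j < d" for j
        using that by (intro order_trans[OF _ binf]) (auto simp: norm_inf_def)
      have bound: "Min ((\<lambda>\<iota>. norm2 d (\<lambda>j. \<iota> * \<gamma>h \<omega> j - \<gamma> j)) ` {1, -1})
          \<le> 4 * sqrt 2 * real s * l / \<bar>\<mu>2\<bar>"
      proof (rule good_event_error[OF unit_vectors orth _ \<mu>2(2) q0 _ \<rho> Mpos])
        show "norm0 d \<gamma> \<le> s" using s by simp
        show "0 \<le> c1" using Ky by (simp add: c1_def)
        show "2 * \<bar>\<mu>2\<bar> \<le> 3 * sqrt M6 * (norm1 d \<gamma>)\<^sup>2"
          using curvature_le_moment[OF reg fin curvs] by (simp add: \<mu>2(1))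
        show "\<bar>U_tilde n \<tau> px ys xs \<omega> j k - (2 * \<eta>2 * (\<beta> j * \<beta> k) + 2 * \<mu>2 * (\<gamma> j * \<gamma> k))\<bar> \<le> c1 * \<rho>"
          if jk: "j < d" "k < d" for j k
        proof -
          have "\<omega> \<notin> Bad j k" using \<omega> jk by (force simp: BadU_def)
          then show ?thesis using sp by (simp add: Bad_def U \<Sigma>_def)
        qed
        \<comment> \<open>Passing to the modulus of \<open>c\<close> makes the right side monotone
          in the rate, so that \<open>q'\<close> may be enlarged to \<open>q\<close>.\<close>
        show "\<bar>\<beta>h \<omega> j - \<beta> j\<bar> \<le> \<bar>c\<bar> * q" if "j < d" for j
        proof -
          have "c * q' \<le> \<bar>c\<bar> * q" using q' by (intro mult_mono) auto
          then show ?thesis using binf'[OF that] by simp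
        qed
        show "norm1 d (\<lambda>j. \<beta>h \<omega> j - \<beta> j) \<le> \<bar>c\<bar> * (real s * q)"
        proof -
          have "c * (real s * q') \<le> \<bar>c\<bar> * (real s * q)" using q' by (intro mult_mono) auto
          then show ?thesis using b1 by simp
        qed
        show "deflation_constant c1 \<bar>\<bar>c\<bar>\<bar> \<eta>2 \<mu>2 (norm1 d \<beta>) (norm1 d \<gamma>) * \<rho> \<le> l"
          using l' by (simp add: \<rho>_def L_def c1_def)
        show "is_T d l (\<lambda>j k. sgn \<mu>2 * deflate d (U_tilde n \<tau> px ys xs \<omega>) (\<beta>h \<omega>) j k) 1 (Vbar \<omega>)"
          using T sp by blast
        show "is_leading_direction d (Vbar \<omega>) (\<gamma>h \<omega>)" using lead sp by blast
      qed
      then show "\<omega> \<in> Good" using sp by (simp only: Good_def) simp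
    qed
  qed
  then have "prob (E - BadU) \<le> prob Good"
    by (rule finite_measure_mono_AE) (rule Good)
  moreover have "prob E \<le> prob (E - BadU) + prob BadU"
    using finite_measure_mono[of E "(E - BadU) \<union> BadU"] measure_Un_le[of "E - BadU" M BadU] E BadU by auto
  ultimately have "1 - \<delta> \<le> prob Good" using PE PBadU by linarith
  then show "1 - \<delta> \<le> prob {\<omega> \<in> space M. Min ((\<lambda>\<iota>. norm2 d (\<lambda>j. \<iota> * \<gamma>h \<omega> j - \<gamma> j)) ` {1, -1})
      \<le> 4 * sqrt 2 * real s * l / \<bar>\<mu>2\<bar>}"
    unfolding Good_def .
qed

end
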